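(* Let $(\mathcal{X},p(y_1,y_2|x),\mathcal{Y}_1\times\mathcal{Y}_2)$ be any discrete memoryless broadcast channel, with cooperating receivers having noiseless conference links of finite capacities $C_{12}$ (from receiver 1 to receiver 2) and $C_{21}$ (from receiver 2 to receiver 1), the receivers being restricted to a single-step conference. Then, for sending a common message to both receivers, any rate $R$ satisfying $$R\le\sup_{p(x)}\Big\{\min\big\{I(X;Y_1,\hat U),\,I(X;Y_2,\hat V)\big\}\Big\},$$ subject to $$C_{21}\ge I(\hat U;Y_2)-I(\hat U;Y_1),\qquad C_{12}\ge I(\hat V;Y_1)-I(\hat V;Y_2),$$ for some joint distribution $p(x,y_1,y_2,\hat u,\hat v)=p(x)p(y_1,y_2|x)p(\hat u|y_2)p(\hat v|y_1)$, is achievable, with $\|\hat{\mathcal{U}}\|\le\|\mathcal{Y}_2\|+1$ and $\|\hat{\mathcal{V}}\|\le\|\mathcal{Y}_1\|+1$. (The supremum is over input distributions $p(x)$ on $\mathcal{X}$, together with conditional distributions $p(\hat u|y_2)$, $p(\hat v|y_1)$ such that the two displayed link constraints hold under the resulting joint distribution.)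
   Context: All alphabets are finite, $\|\mathcal{A}\|$ denotes the cardinality of a finite set $\mathcal{A}$, and mutual informations are in bits; $\hat{\mathcal{U}},\hat{\mathcal{V}}$ are the ranges of $\hat U,\hat V$. Rates and link capacities are nonnegative reals. A discrete memoryless broadcast channel with input alphabet $\mathcal{X}$, output alphabets $\mathcal{Y}_1,\mathcal{Y}_2$ and transition function $p(y_1,y_2|x)$ satisfies $p(y_1^n,y_2^n|x^n)=\prod_{i=1}^n p(y_{1,i},y_{2,i}|x_i)$; receiver $k$ observes $Y_k^n$. Single-step conference: after reception each receiver sends one message to the other based only on its own channel output: $W_{12}=h_{12}(Y_1^n)\in\mathcal{W}_{12}=\{1,\dots,2^{nR_{12}}\}$ with $R_{12}\le C_{12}$ (from receiver 1 to receiver 2), and $W_{21}=h_{21}(Y_2^n)\in\mathcal{W}_{21}=\{1,\dots,2^{nR_{21}}\}$ with $R_{21}\le C_{21}$ (from receiver 2 to receiver 1). Both receivers decode after this exchange. A code of block length $n$ and rate $R$ for a common message consists of a message set $\mathcal{W}=\{1,2,\dots,2^{nR}\}$, an encoder $f:\mathcal{W}\to\mathcal{X}^n$, a single-step conference as just described, and decoders $g_1:\mathcal{W}_{21}\times\mathcal{Y}_1^n\to\mathcal{W}$, $g_2:\mathcal{W}_{12}\times\mathcal{Y}_2^n\to\mathcal{W}$. The message $W$ is uniform on $\mathcal{W}$, $X^n=f(W)$ is sent, and $P_e^{(n)}=\Pr(g_1(W_{21},Y_1^n)\ne W\text{ or }g_2(W_{12},Y_2^n)\ne W)$. A rate $R$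 is achievable if there exists a sequence of codes of rate $R$ with $P_e^{(n)}\to0$ as $n\to\infty$.
   Formalization: At R equal to the supremum, "achievable" is taken with message sets whose rate log2(M_n)/n tends to R, since with exactly 2^{nR} messages the claim fails there (e.g. a binary symmetric channel at capacity); for R below the supremum the literal definition is kept. *)

theory Defs
  imports "HOL-Probability.Probability"
begin

(* Used only for random variables with countably many possible values, for which the product of
   the two counting measures is again a counting measure. The base 2 gives bits. *)
definition mi :: "'w pmf \<Rightarrow> ('w \<Rightarrow> 'a) \<Rightarrow> ('w \<Rightarrow> 'b) \<Rightarrow> real" where
  "mi P A B =
     prob_space.mutual_information (measure_pmf P) 2 (count_space UNIV) (count_space UNIV) A B"

(* p(x) p(y1,y2|x) p(u|y2) p(v|y1) *)
definition joint ::
  "('x \<Rightarrow> ('y1 \<times> 'y2) pmf) \<Rightarrow> 'x pmf \<Rightarrow> ('y2 \<Rightarrow> 'u pmf) \<Rightarrow> ('y1 \<Rightarrow> 'v pmf)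
     \<Rightarrow> ('x \<times> 'y1 \<times> 'y2 \<times> 'u \<times> 'v) pmf" where
  "joint ch px qu qv =
     do {
       x \<leftarrow> px;
       (y1, y2) \<leftarrow> ch x;
       u \<leftarrow> qu y2;
       v \<leftarrow> qv y1;
       return_pmf (x, y1, y2, u, v)
     }"

definition rvX :: "'x \<times> 'y1 \<times> 'y2 \<times> 'u \<times> 'v \<Rightarrow> 'x" where "rvX = (\<lambda>(x, y1, y2, u, v). x)"
definition rvY1 :: "'x \<times> 'y1 \<times> 'y2 \<times> 'u \<times> 'v \<Rightarrow> 'y1" where "rvY1 = (\<lambda>(x, y1, y2, u, v). y1)"
definition rvY2 :: "'x \<times> 'y1 \<times> 'y2 \<times> 'u \<times> 'v \<Rightarrow> 'y2" where "rvY2 = (\<lambda>(x, y1, y2, u, v). y2)"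
definition rvU :: "'x \<times> 'y1 \<times> 'y2 \<times> 'u \<times> 'v \<Rightarrow> 'u" where "rvU = (\<lambda>(x, y1, y2, u, v). u)"
definition rvV :: "'x \<times> 'y1 \<times> 'y2 \<times> 'u \<times> 'v \<Rightarrow> 'v" where "rvV = (\<lambda>(x, y1, y2, u, v). v)"

definition link_constraints ::
  "real \<Rightarrow> real \<Rightarrow> ('x \<times> 'y1 \<times> 'y2 \<times> 'u \<times> 'v) pmf \<Rightarrow> bool" where
  "link_constraints C12 C21 J \<longleftrightarrow>
     C21 \<ge> mi J rvU rvY2 - mi J rvU rvY1 \<and>
     C12 \<ge> mi J rvV rvY1 - mi J rvV rvY2"

definition rate_bound :: "('x \<times> 'y1 \<times> 'y2 \<times> 'u \<times> 'v) pmf \<Rightarrow> real" where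
  "rate_bound J =
     min (mi J rvX (\<lambda>\<omega>. (rvY1 \<omega>, rvU \<omega>)))
         (mi J rvX (\<lambda>\<omega>. (rvY2 \<omega>, rvV \<omega>)))"

(* Values of the objective over all admissible distributions whose auxiliary variables take values
   in the alphabets \<U> and \<V>. Letting these be finite sets of naturals loses no generality and
   makes it possible to quantify over alphabets. *)
definition rates_with_alphabets ::
  "real \<Rightarrow> real \<Rightarrow> ('x \<Rightarrow> ('y1 \<times> 'y2) pmf) \<Rightarrow> nat set \<Rightarrow> nat set \<Rightarrow> real set" where
  "rates_with_alphabets C12 C21 ch \<U> \<V> =
     {rate_bound (joint ch px qu qv) | px qu qv.
        (\<forall>y2. set_pmf (qu y2) \<subseteq> \<U>) \<and>
        (\<forall>y1. set_pmf (qv y1) \<subseteq> \<V>) \<and>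
        link_constraints C12 C21 (joint ch px qu qv)}"

(* For finite input and output alphabets and nonnegative capacities both sets of reals below are
   nonempty (constant auxiliary variables are admissible) and bounded above (by the binary
   logarithm of the size of the input alphabet), so that Sup is the genuine supremum. *)
definition conference_rate ::
  "real \<Rightarrow> real \<Rightarrow> ('x \<Rightarrow> ('y1 \<times> 'y2) pmf) \<Rightarrow> real" where
  "conference_rate C12 C21 ch =
     Sup (\<Union>{rates_with_alphabets C12 C21 ch \<U> \<V> | \<U> \<V>. finite \<U> \<and> finite \<V>})"

definition conference_rate_bounded ::
  "real \<Rightarrow> real \<Rightarrow> ('x \<Rightarrow> ('y1::finite \<times> 'y2::finite) pmf) \<Rightarrow> real" where
  "conference_rate_bounded C12 C21 ch =
     Sup (\<Union>{rates_with_alphabets C12 C21 ch \<U> \<V> | \<U> \<V>.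
            finite \<U> \<and> card \<U> \<le> CARD('y2) + 1 \<and>
            finite \<V> \<and> card \<V> \<le> CARD('y1) + 1})"

(* A word of length n is a function on nat of which only the values at indices below n matter. *)
record ('x, 'y1, 'y2) conf_code =
  enc :: "nat \<Rightarrow> (nat \<Rightarrow> 'x)"
  rate12 :: real
  rate21 :: real
  conf12 :: "(nat \<Rightarrow> 'y1) \<Rightarrow> nat"
  conf21 :: "(nat \<Rightarrow> 'y2) \<Rightarrow> nat"
  dec1 :: "nat \<Rightarrow> (nat \<Rightarrow> 'y1) \<Rightarrow> nat"
  dec2 :: "nat \<Rightarrow> (nat \<Rightarrow> 'y2) \<Rightarrow> nat"

(* 2^{nR} is in general not an integer. The conference messages are rounded down, so that the
   number of bits sent over a link never exceeds n times its capacity. *)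
definition num_conf_msgs :: "nat \<Rightarrow> real \<Rightarrow> nat" where
  "num_conf_msgs n r = nat \<lfloor>2 powr (real n * r)\<rfloor>"

definition is_conf_code ::
  "real \<Rightarrow> real \<Rightarrow> nat \<Rightarrow> nat \<Rightarrow> ('x, 'y1, 'y2) conf_code \<Rightarrow> bool" where
  "is_conf_code C12 C21 n M c \<longleftrightarrow>
     1 \<le> M \<and>
     0 \<le> rate12 c \<and> rate12 c \<le> C12 \<and>
     0 \<le> rate21 c \<and> rate21 c \<le> C21 \<and>
     (\<forall>y1 \<in> {..<n} \<rightarrow>\<^sub>E UNIV. conf12 c y1 \<in> {1..num_conf_msgs n (rate12 c)}) \<and>
     (\<forall>y2 \<in> {..<n} \<rightarrow>\<^sub>E UNIV. conf21 c y2 \<in> {1..num_conf_msgs n (rate21 c)}) \<and>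
     (\<forall>w21 \<in> {1..num_conf_msgs n (rate21 c)}. \<forall>y1 \<in> {..<n} \<rightarrow>\<^sub>E UNIV.
        dec1 c w21 y1 \<in> {1..M}) \<and>
     (\<forall>w12 \<in> {1..num_conf_msgs n (rate12 c)}. \<forall>y2 \<in> {..<n} \<rightarrow>\<^sub>E UNIV.
        dec2 c w12 y2 \<in> {1..M})"

(* The default value puts the two output words into {..<n} \<rightarrow>\<^sub>E UNIV. *)
definition memoryless ::
  "('x \<Rightarrow> ('y1 \<times> 'y2) pmf) \<Rightarrow> nat \<Rightarrow> (nat \<Rightarrow> 'x)
     \<Rightarrow> ((nat \<Rightarrow> 'y1) \<times> (nat \<Rightarrow> 'y2)) pmf" where
  "memoryless ch n x =
     map_pmf (\<lambda>y. (fst \<circ> y, snd \<circ> y))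
       (Pi_pmf {..<n} (undefined, undefined) (\<lambda>i. ch (x i)))"

definition error_prob ::
  "('x \<Rightarrow> ('y1 \<times> 'y2) pmf) \<Rightarrow> nat \<Rightarrow> nat \<Rightarrow> ('x, 'y1, 'y2) conf_code \<Rightarrow> real" where
  "error_prob ch n M c =
     measure_pmf.prob
       (do {
          w \<leftarrow> pmf_of_set {1..M};
          (y1, y2) \<leftarrow> memoryless ch n (enc c w);
          return_pmf (w, y1, y2)
        })
       {(w, y1, y2). dec1 c (conf21 c y2) y1 \<noteq> w \<or> dec2 c (conf12 c y1) y2 \<noteq> w}"

definition achievable ::
  "real \<Rightarrow> real \<Rightarrow> ('x \<Rightarrow> ('y1 \<times> 'y2) pmf) \<Rightarrow> real \<Rightarrow> bool" where
  "achievable C12 C21 ch R \<longleftrightarrow>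
     (\<exists>code :: nat \<Rightarrow> ('x, 'y1, 'y2) conf_code.
        (\<forall>n. is_conf_code C12 C21 n (nat \<lceil>2 powr (real n * R)\<rceil>) (code n)) \<and>
        (\<lambda>n. error_prob ch n (nat \<lceil>2 powr (real n * R)\<rceil>) (code n)) \<longlonglongrightarrow> 0)"

(* Here "2^{nR} messages" is understood to first order in the exponent. This is implied by
   achievable; it differs from it only at the boundary: vanishing error probability with exactly
   2^{nR} messages fails already for a binary symmetric channel with R equal to its capacity. *)
definition limit_achievable ::
  "real \<Rightarrow> real \<Rightarrow> ('x \<Rightarrow> ('y1 \<times> 'y2) pmf) \<Rightarrow> real \<Rightarrow> bool" where
  "limit_achievable C12 C21 ch R \<longleftrightarrow>
     (\<exists>(M :: nat \<Rightarrow> nat) (code :: nat \<Rightarrow> ('x, 'y1, 'y2) conf_code).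
        (\<forall>n. is_conf_code C12 C21 n (M n) (code n)) \<and>
        (\<lambda>n. log 2 (real (M n)) / real n) \<longlonglongrightarrow> R \<and>
        (\<lambda>n. error_prob ch n (M n) (code n)) \<longlonglongrightarrow> 0)"

end

(* Each receiver describes a quantized version of its output to the other one: receiver 2 quantizes
   Y2 to U and sends the bin index of U. The quantizer is a likelihood encoder: it picks the codeword u
   with probability proportional to p(u|y2)/p(u), so that, up to a factor 2 and the event that the
   normalization is atypically small, (X,Y1,Y2,U) behaves as under the target distribution and no
   Markov lemma is needed. Receiver 1 looks for the message w such that (x(w),u,y1) has large
   information densities for some u in the announced bin. Since u itself need not be recovered, the
   relevant condition is R + I(U;Y2) - C21 < I(X;Y1,U) + I(U;Y1), which already follows from the
   nonstrict link constraint and R < I(X;Y1,U). Everything is first bounded for a single use of an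
   arbitrary channel and then applied to n uses, where Chebyshev's inequality replaces typicality.
   One random codebook x(.) serves both receivers, whose error bounds add up.

   Cardinality: multiplying p(u|y2) by weights m(u) that preserve p(y2) makes all mutual informations
   linear in m. An optimal vertex of the resulting linear program with card(Y2)+1 equality constraints
   (p(y2) and the link functional) has at most card(Y2)+1 nonzero weights. *)
theory Submission
  imports Defs
begin

section \<open>Finitely supported distributions\<close>

text \<open>A conference message must be a deterministic function of the received word, but the
  likelihood encoder is random. It therefore enters only as an averaging distribution: the actual
  encoder announces the bin of least error cost, and a minimum is at most any average. Its weight
  p(u|z)/p(u) is the density of the conditional law of u relative to the marginal, so independently
  drawn codewords weighted by it have exactly the target law. Every error term then becomes an
  expectation over independent draws, and a change of measure bounds it. The receivers share the
  message codebook but own separate quantization codebooks. Each error bound is therefore stated for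
  a function of the message codebook alone, and the two functions are added before a codebook is
  fixed. Random coding needs slack in the rate. Rates strictly below the supremum have it, because
  some admissible distribution exceeds them even if the supremum is not attained; the supremum
  itself is reached by a diagonal sequence of codes with increasing rates.\<close>

lemma expectation_bind_pmf_finite:
  fixes h :: "'b \<Rightarrow> real"
  assumes "finite (set_pmf p)" "\<And>x. x \<in> set_pmf p \<Longrightarrow> finite (set_pmf (f x))"
  shows "measure_pmf.expectation (bind_pmf p f) h =
         measure_pmf.expectation p (\<lambda>x. measure_pmf.expectation (f x) h)"
  using assms by (subst pmf_expectation_bind[where A = "set_pmf p"])
    (auto simp: integral_measure_pmf[where A = "set_pmf p"])

lemma expectation_pair_pmf_finite:
  fixes h :: "'a \<times> 'b \<Rightarrow> real"
  assumes "finite (set_pmf p)" "finite (set_pmf q)"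
  shows "measure_pmf.expectation (pair_pmf p q) h =
         measure_pmf.expectation p (\<lambda>x. measure_pmf.expectation q (\<lambda>y. h (x, y)))"
  using assms by (simp add: pair_pmf_def expectation_bind_pmf_finite)

lemma expectation_mono_finite:
  fixes f g :: "'a \<Rightarrow> real"
  assumes "finite (set_pmf p)" "\<And>x. x \<in> set_pmf p \<Longrightarrow> f x \<le> g x"
  shows "measure_pmf.expectation p f \<le> measure_pmf.expectation p g"
  using assms by (intro integral_mono_AE integrable_measure_pmf_finite AE_pmfI)

lemma expectation_cong_pmf:
  fixes f g :: "'a \<Rightarrow> real"
  assumes "\<And>x. x \<in> set_pmf p \<Longrightarrow> f x = g x"
  shows "measure_pmf.expectation p f = measure_pmf.expectation p g"
  using assms by (intro integral_cong_AE AE_pmfI) auto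

lemma expectation_sum_finite:
  fixes f :: "'i \<Rightarrow> 'a \<Rightarrow> real"
  assumes "finite (set_pmf p)"
  shows "measure_pmf.expectation p (\<lambda>x. \<Sum>i\<in>I. f i x) = (\<Sum>i\<in>I. measure_pmf.expectation p (f i))"
  using assms by (intro Bochner_Integration.integral_sum integrable_measure_pmf_finite)

lemma expectation_add_finite:
  fixes f g :: "'a \<Rightarrow> real"
  assumes "finite (set_pmf p)"
  shows "measure_pmf.expectation p (\<lambda>x. f x + g x) = measure_pmf.expectation p f +
    measure_pmf.expectation p g"
  using assms by (intro Bochner_Integration.integral_add integrable_measure_pmf_finite)

lemma expectation_swap_finite:
  fixes h :: "'a \<Rightarrow> 'b \<Rightarrow> real"
  assumes "finite (set_pmf p)" "finite (set_pmf q)"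
  shows "measure_pmf.expectation p (\<lambda>x. measure_pmf.expectation q (h x)) =
         measure_pmf.expectation q (\<lambda>y. measure_pmf.expectation p (\<lambda>x. h x y))"
  using assms
  by (simp add: integral_measure_pmf[where A = "set_pmf p"] integral_measure_pmf[where A = "set_pmf q"]
        sum_distrib_left sum.swap[of _ "set_pmf p"] mult_ac)

lemma expectation_of_bool:
  "measure_pmf.expectation p (\<lambda>x. of_bool (Q x)) = measure_pmf.prob p {x. Q x}"
proof -
  have "(\<lambda>x. of_bool (Q x) :: real) = indicator {x. Q x}" by (auto simp: indicator_def)
  then show ?thesis by simp
qed

text \<open>The existence step of random coding: a function above \<open>c\<close> on the whole
  finite support would have a mean above \<open>c\<close>.\<close>

lemma ex_le_expectation:
  fixes f :: "'a \<Rightarrow> real"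
  assumes "finite (set_pmf p)" "measure_pmf.expectation p f \<le> c"
  shows "\<exists>x\<in>set_pmf p. f x \<le> c"
proof (rule ccontr)
  assume "\<not> ?thesis"
  then have *: "c < f x" if "x \<in> set_pmf p" for x using that by force
  have "(\<Sum>x\<in>set_pmf p. c * pmf p x) < (\<Sum>x\<in>set_pmf p. f x * pmf p x)"
    using * by (intro sum_strict_mono) (auto simp: assms set_pmf_not_empty pmf_positive)
  also have "(\<Sum>x\<in>set_pmf p. c * pmf p x) = c"
    using assms by (simp add: sum_distrib_left[symmetric] sum_pmf_eq_1)
  finally show False using assms
    by (simp add: integral_measure_pmf_real[where A = "set_pmf p"])
qed

section \<open>Product distributions and their second moments\<close>

lemma finite_set_Pi_pmf:
  assumes "finite I" "\<And>i. i \<in> I \<Longrightarrow> finite (set_pmf (p i))"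
  shows "finite (set_pmf (Pi_pmf I d p))"
  using assms by (auto simp: set_Pi_pmf intro!: finite_PiE_dflt)

lemma Pi_pmf_two_components:
  assumes "finite I" "i \<in> I" "j \<in> I" "i \<noteq> j"
  shows "map_pmf (\<lambda>f. (f i, f j)) (Pi_pmf I d p) = pair_pmf (p i) (p j)"
proof -
  have "Pi_pmf I d p = map_pmf (\<lambda>(y,f). f(i:=y)) (pair_pmf (p i) (Pi_pmf (I - {i}) d p))"
    using assms by (subst Pi_pmf_insert[symmetric]) (auto simp: insert_absorb)
  then have "map_pmf (\<lambda>f. (f i, f j)) (Pi_pmf I d p) =
      map_pmf (\<lambda>(y, f). (y, f j)) (pair_pmf (p i) (Pi_pmf (I - {i}) d p))"
    using assms by (simp add: pmf.map_comp o_def case_prod_unfold)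
  also have "\<dots> = pair_pmf (p i) (map_pmf (\<lambda>f. f j) (Pi_pmf (I - {i}) d p))"
    by (simp add: pair_map_pmf2 apsnd_def map_prod_def)
  also have "map_pmf (\<lambda>f. f j) (Pi_pmf (I - {i}) d p) = p j"
    using assms by (subst Pi_pmf_component) auto
  finally show ?thesis .
qed

lemma expectation_Pi_pmf_component:
  fixes h :: "'b \<Rightarrow> real"
  assumes "finite I" "i \<in> I"
  shows "measure_pmf.expectation (Pi_pmf I d p) (\<lambda>f. h (f i)) = measure_pmf.expectation (p i) h"
proof -
  have "measure_pmf.expectation (p i) h =
      measure_pmf.expectation (map_pmf (\<lambda>f. f i) (Pi_pmf I d p)) h"
    using assms by (subst Pi_pmf_component) auto
  then show ?thesis by simp
qed

lemma expectation_Pi_pmf_two_components: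
  fixes h :: "'b \<Rightarrow> 'b \<Rightarrow> real"
  assumes "finite I" "i \<in> I" "j \<in> I" "i \<noteq> j" "finite (set_pmf (p i))" "finite (set_pmf (p j))"
  shows "measure_pmf.expectation (Pi_pmf I d p) (\<lambda>f. h (f i) (f j)) =
         measure_pmf.expectation (p i) (\<lambda>x. measure_pmf.expectation (p j) (h x))"
proof -
  have "measure_pmf.expectation (pair_pmf (p i) (p j)) (\<lambda>(x, y). h x y) =
        measure_pmf.expectation (map_pmf (\<lambda>f. (f i, f j)) (Pi_pmf I d p)) (\<lambda>(x, y). h x y)"
    using assms by (subst Pi_pmf_two_components) auto
  then show ?thesis using assms by (simp add: expectation_pair_pmf_finite)
qed

text \<open>Distinct components are independent and centred, so the cross terms of the expanded
  square vanish and only the diagonal survives.\<close>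

lemma expectation_square_sum_Pi_pmf:
  fixes g :: "'b \<Rightarrow> real"
  assumes "finite I" and fin: "finite (set_pmf p)" and 0: "measure_pmf.expectation p g = 0"
  shows "measure_pmf.expectation (Pi_pmf I d (\<lambda>_. p)) (\<lambda>f. (\<Sum>i\<in>I. g (f i))\<^sup>2) =
         card I * measure_pmf.expectation p (\<lambda>x. (g x)\<^sup>2)"
proof -
  let ?P = "Pi_pmf I d (\<lambda>_. p)"
  have fP: "finite (set_pmf ?P)" using assms by (intro finite_set_Pi_pmf)
  have "measure_pmf.expectation ?P (\<lambda>f. (\<Sum>i\<in>I. g (f i))\<^sup>2) =
        measure_pmf.expectation ?P (\<lambda>f. \<Sum>i\<in>I. \<Sum>j\<in>I. g (f i) * g (f j))"
    by (simp add: power2_eq_square sum_product)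
  also have "\<dots> = (\<Sum>i\<in>I. \<Sum>j\<in>I. measure_pmf.expectation ?P (\<lambda>f. g (f i) * g (f j)))"
    using fP by (simp add: expectation_sum_finite)
  also have "\<dots> = (\<Sum>i\<in>I. \<Sum>j\<in>I. if i = j then measure_pmf.expectation p (\<lambda>x. (g x)\<^sup>2) else 0)"
  proof (intro sum.cong refl)
    fix i j assume ij: "i \<in> I" "j \<in> I"
    show "measure_pmf.expectation ?P (\<lambda>f. g (f i) * g (f j)) =
        (if i = j then measure_pmf.expectation p (\<lambda>x. (g x)\<^sup>2) else 0)"
    proof (cases "i = j")
      case True
      then show ?thesis using ij assms
          expectation_Pi_pmf_component[of I i d "\<lambda>_. p" "\<lambda>x. (g x)\<^sup>2"] by (simp add: power2_eq_square)
    next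
      case False
      then show ?thesis using ij assms
        by (subst expectation_Pi_pmf_two_components[where h = "\<lambda>x y. g x * g y"]) auto
    qed
  qed
  also have "\<dots> = card I * measure_pmf.expectation p (\<lambda>x. (g x)\<^sup>2)"
    using assms by simp
  finally show ?thesis .
qed

lemma Pi_pmf_Chebyshev:
  fixes h :: "'b \<Rightarrow> real"
  assumes "finite I" and fin: "finite (set_pmf p)" and a: "a > 0"
  shows "measure_pmf.prob (Pi_pmf I d (\<lambda>_. p))
           {f. \<bar>(\<Sum>i\<in>I. h (f i)) - card I * measure_pmf.expectation p h\<bar> \<ge> a} \<le>
         card I * measure_pmf.variance p h / a\<^sup>2"
proof -
  let ?P = "Pi_pmf I d (\<lambda>_. p)"
  define \<mu> where "\<mu> = measure_pmf.expectation p h"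
  have fP: "finite (set_pmf ?P)" using assms by (intro finite_set_Pi_pmf)
  have g0: "measure_pmf.expectation p (\<lambda>x. h x - \<mu>) = 0"
    using fin by (simp add: \<mu>_def Bochner_Integration.integral_diff integrable_measure_pmf_finite)
  have "measure_pmf.prob ?P {f. \<bar>(\<Sum>i\<in>I. h (f i)) - card I * \<mu>\<bar> \<ge> a} =
      measure_pmf.expectation ?P (\<lambda>f. of_bool (\<bar>(\<Sum>i\<in>I. h (f i)) - card I * \<mu>\<bar> \<ge> a))"
    by (simp add: expectation_of_bool)
  also have "\<dots> \<le> measure_pmf.expectation ?P (\<lambda>f. (\<Sum>i\<in>I. h (f i) - \<mu>)\<^sup>2 / a\<^sup>2)"
  proof (rule expectation_mono_finite[OF fP])
    fix f
    have "a\<^sup>2 \<le> y\<^sup>2" if "a \<le> \<bar>y\<bar>" for y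
      using that a by (metis abs_le_square_iff abs_of_pos)
    then show "of_bool (\<bar>(\<Sum>i\<in>I. h (f i)) - card I * \<mu>\<bar> \<ge> a) \<le> (\<Sum>i\<in>I. h (f i) - \<mu>)\<^sup>2 / a\<^sup>2"
      using a by (auto simp: sum_subtractf)
  qed
  also have "\<dots> = card I * measure_pmf.expectation p (\<lambda>x. (h x - \<mu>)\<^sup>2) / a\<^sup>2"
    using expectation_square_sum_Pi_pmf[OF assms(1) fin g0, of d] by simp
  finally show ?thesis by (simp add: \<mu>_def)
qed

text \<open>\<open>A\<close> will be a set where a likelihood ratio reaches \<open>a\<close>:
  independent draws (law \<open>p\<close>) rarely pass a test made for dependent ones (law
  \<open>p'\<close>), since \<open>p'\<close> gives \<open>A\<close> mass at most 1. This replaces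
  counting jointly typical words.\<close>

lemma prob_le_change_of_measure:
  assumes "finite (set_pmf p)" "a > 0" and le: "\<And>x. x \<in> A \<Longrightarrow> a * pmf p x \<le> pmf p' x"
  shows "measure_pmf.prob p A \<le> 1 / a"
proof -
  let ?A = "A \<inter> set_pmf p"
  have "a * measure_pmf.prob p A = a * measure_pmf.prob p ?A"
    by (simp add: measure_Int_set_pmf)
  also have "\<dots> = (\<Sum>x\<in>?A. a * pmf p x)"
    using assms by (simp add: measure_measure_pmf_finite sum_distrib_left)
  also have "\<dots> \<le> (\<Sum>x\<in>?A. pmf p' x)" by (intro sum_mono le) auto
  also have "\<dots> = measure_pmf.prob p' ?A" using assms by (simp add: measure_measure_pmf_finite)
  also have "\<dots> \<le> 1" by simp
  finally show ?thesis using assms by (simp add: pos_le_divide_eq mult.commute)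
qed

section \<open>A one-shot compress-and-forward bound\<close>

text \<open>The situation of a single receiver: \<open>y\<close> is its own output, \<open>z\<close>
  the output of the helping receiver and \<open>u\<close> the quantization of \<open>z\<close>.
  Receiver 2 is covered by the channel with swapped outputs.\<close>

definition quantized_joint ::
  "'x pmf \<Rightarrow> ('x \<Rightarrow> ('y \<times> 'z) pmf) \<Rightarrow> ('z \<Rightarrow> 'u pmf) \<Rightarrow> ('x \<times> 'y \<times> 'z \<times> 'u) pmf" where
  "quantized_joint px ch q =
     do {
       x \<leftarrow> px;
       (y, z) \<leftarrow> ch x;
       u \<leftarrow> q z;
       return_pmf (x, y, z, u)
     }"

lemma finite_set_quantized_joint:
  assumes "finite (set_pmf px)" "\<And>x. x \<in> set_pmf px \<Longrightarrow> finite (set_pmf (ch x))" "\<And>z. finite (set_pmf (q z))"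
  shows "finite (set_pmf (quantized_joint px ch q))"
  using assms by (auto simp: quantized_joint_def)

lemma expectation_quantized_joint:
  fixes f :: "'x \<times> 'y \<times> 'z \<times> 'u \<Rightarrow> real"
  assumes "finite (set_pmf px)" "\<And>x. x \<in> set_pmf px \<Longrightarrow> finite (set_pmf (ch x))" "\<And>z. finite (set_pmf (q z))"
  shows "measure_pmf.expectation (quantized_joint px ch q) f =
    measure_pmf.expectation px (\<lambda>x. measure_pmf.expectation (ch x) (\<lambda>(y, z).
      measure_pmf.expectation (q z) (\<lambda>u. f (x, y, z, u))))"
proof -
  have "measure_pmf.expectation (case yz of (y, z) \<Rightarrow> q z \<bind> (\<lambda>u. return_pmf (x, y, z, u))) f =
      (case yz of (y, z) \<Rightarrow> measure_pmf.expectation (q z) (\<lambda>u. f (x, y, z, u)))" for x yz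
    using assms by (cases yz) (simp add: expectation_bind_pmf_finite)
  then show ?thesis
    unfolding quantized_joint_def using assms
    by (subst expectation_bind_pmf_finite)
      (auto intro!: expectation_cong_pmf simp: expectation_bind_pmf_finite split: prod.splits)
qed

section \<open>The random code and its deterministic conference encoder\<close>

context
  fixes px :: "'x pmf" and ch :: "'x \<Rightarrow> ('y \<times> 'z) pmf" and q :: "'z \<Rightarrow> 'u pmf"
    and M B J :: nat and T :: "('x \<times> 'u \<times> 'y) set"
  assumes fin_px: "finite (set_pmf px)"
    and fin_ch: "\<And>x. x \<in> set_pmf px \<Longrightarrow> finite (set_pmf (ch x))"
    and fin_q: "\<And>z. finite (set_pmf (q z))"
    and M1: "1 \<le> M" and B1: "1 \<le> B" and J1: "1 \<le> J"
begin

private definition "P = quantized_joint px ch q"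
private definition "pu = map_pmf (\<lambda>(x, y, z, u). u) P"
private definition "SY = fst ` set_pmf (bind_pmf px ch)"
private definition "SZ = snd ` set_pmf (bind_pmf px ch)"
text \<open>The density of \<open>q z\<close> relative to the marginal \<open>pu\<close>, which is
  the weight used by the likelihood encoder.\<close>

private definition "r u z = pmf (q z) u / pmf pu u"
private definition "I = {1..B} \<times> {1..J}"
private definition "L = real (B * J)"
private definition "XS d = Pi_pmf {1..M} d (\<lambda>_. px)"
private definition "US d = Pi_pmf I d (\<lambda>_. pu)"

text \<open>The weight \<open>r\<close> couples an independently drawn codeword \<open>u\<close> to
  the channel output. Finite sums are used so that \<open>D\<close> commutes with expectations over
  codebooks.\<close>

private definition
  "D x u f = (\<Sum>y\<in>SY. \<Sum>z\<in>SZ. pmf (ch x) (y, z) * r u z * f y)" for f :: "'y \<Rightarrow> real"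

private definition "fits xs us b y w \<longleftrightarrow> w \<in> {1..M} \<and> (\<exists>j\<in>{1..J}. (xs w, us (b, j), y) \<in> T)"

text \<open>The fallback 1 keeps the decoder inside the message set when no message or more than one
  fits.\<close>

private definition "decode xs us b y =
  (if \<exists>!w. fits xs us b y w then THE w. fits xs us b y w else (1 :: nat))"

text \<open>The joint probability of \<open>z\<close> and a wrong decision if bin \<open>b\<close>
  is announced, not conditioned on \<open>z\<close>. Costs therefore add up over \<open>z\<close> to
  the error probability, and the bin can be optimized separately for each \<open>z\<close>.\<close>

private definition "cost xs us z b =
  (\<Sum>w\<in>{1..M}. \<Sum>y\<in>SY. pmf (ch (xs w)) (y, z) * of_bool (decode xs us b y \<noteq> w)) / M"

private definition "conf xs us z = arg_min_on (cost xs us z) {1..B}"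

private definition "err xs us =
  (\<Sum>w\<in>{1..M}. measure_pmf.prob (ch (xs w)) {(y, z). decode xs us (conf xs us z) y \<noteq> w}) / M"

private definition "S us z = (\<Sum>i\<in>I. r (us i) z) / L"

private lemma fin_P: "finite (set_pmf P)"
  unfolding P_def by (intro finite_set_quantized_joint fin_px fin_ch fin_q)

private lemma fin_pu: "finite (set_pmf pu)"
  using fin_P by (simp add: pu_def)

private lemma fin_S [simp]: "finite SY" "finite SZ" "finite I"
  using fin_px fin_ch by (auto simp: SY_def SZ_def I_def)

private lemma fin_XS: "finite (set_pmf (XS d))"
  using fin_px by (auto simp: XS_def intro!: finite_set_Pi_pmf)

private lemma fin_US: "finite (set_pmf (US d))"
  using fin_pu by (auto simp: US_def intro!: finite_set_Pi_pmf)

private lemma L_pos: "L > 0" using B1 J1 by (simp add: L_def)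

private lemma card_I: "real (card I) = L" by (simp add: I_def L_def)

private lemma r_nonneg: "r u z \<ge> 0" by (simp add: r_def)

private lemma set_q_subset: "x \<in> set_pmf px \<Longrightarrow> (y, z) \<in> set_pmf (ch x) \<Longrightarrow> set_pmf (q z) \<subseteq> set_pmf pu"
  by (force simp: pu_def P_def quantized_joint_def image_iff)

private lemma SYZ: "x \<in> set_pmf px \<Longrightarrow> (y, z) \<in> set_pmf (ch x) \<Longrightarrow> y \<in> SY \<and> z \<in> SZ"
  by (force simp: SY_def SZ_def)

private lemma expectation_ch:
  fixes f :: "_ \<Rightarrow> real"
  assumes "x \<in> set_pmf px"
  shows "measure_pmf.expectation (ch x) f = (\<Sum>y\<in>SY. \<Sum>z\<in>SZ. pmf (ch x) (y, z) * f (y, z))"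
proof -
  have "measure_pmf.expectation (ch x) f = (\<Sum>a\<in>SY \<times> SZ. pmf (ch x) a *\<^sub>R f a)"
    using assms SYZ by (intro integral_measure_pmf) auto
  then show ?thesis by (simp add: sum.cartesian_product case_prod_unfold)
qed

private lemma expectation_tilt_pu:
  fixes f :: "_ \<Rightarrow> real"
  assumes "set_pmf (q z) \<subseteq> set_pmf pu"
  shows "measure_pmf.expectation pu (\<lambda>u. r u z * f u) = measure_pmf.expectation (q z) f"
proof -
  have "measure_pmf.expectation (q z) f = (\<Sum>u\<in>set_pmf pu. pmf (q z) u *\<^sub>R f u)"
    using assms fin_pu by (intro integral_measure_pmf) auto
  also have "\<dots> = (\<Sum>u\<in>set_pmf pu. pmf pu u *\<^sub>R (r u z * f u))"
    by (intro sum.cong) (auto simp: r_def set_pmf_iff)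
  also have "\<dots> = measure_pmf.expectation pu (\<lambda>u. r u z * f u)"
    using fin_pu by (intro integral_measure_pmf[symmetric]) auto
  finally show ?thesis by simp
qed

text \<open>Reweighting an independent pair \<open>(x, u)\<close> by \<open>r\<close> yields the law
  of a quantized channel use, because \<open>pu\<close> times \<open>r\<close> restores
  \<open>q z\<close>. Expected errors can thus be computed with independent codewords.\<close>

private lemma expectation_D:
  fixes f :: "_ \<Rightarrow> _ \<Rightarrow> _ \<Rightarrow> real"
  shows "measure_pmf.expectation px (\<lambda>x. measure_pmf.expectation pu (\<lambda>u. D x u (f x u))) =
         measure_pmf.expectation P (\<lambda>(x, y, z, u). f x u y)"
proof -
  have "measure_pmf.expectation pu (\<lambda>u. D x u (f x u)) =
      measure_pmf.expectation (ch x) (\<lambda>(y, z). measure_pmf.expectation (q z) (\<lambda>u. f x u y))"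
    if x: "x \<in> set_pmf px" for x
  proof -
    have "measure_pmf.expectation pu (\<lambda>u. D x u (f x u)) =
        (\<Sum>y\<in>SY. \<Sum>z\<in>SZ. measure_pmf.expectation pu (\<lambda>u. pmf (ch x) (y, z) * (r u z * f x u y)))"
      unfolding D_def by (simp add: expectation_sum_finite fin_pu mult.assoc del: integral_mult_right_zero)
    also have "\<dots> = (\<Sum>y\<in>SY. \<Sum>z\<in>SZ. pmf (ch x) (y, z) * measure_pmf.expectation (q z) (\<lambda>u. f x u y))"
    proof (intro sum.cong refl)
      fix y z
      show "measure_pmf.expectation pu (\<lambda>u. pmf (ch x) (y, z) * (r u z * f x u y)) =
          pmf (ch x) (y, z) * measure_pmf.expectation (q z) (\<lambda>u. f x u y)"
      \<comment> \<open>The support of \<open>q z\<close> is known to lie in that of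
        \<open>pu\<close> only for outputs that can occur; otherwise the factor
        \<open>pmf (ch x) (y, z)\<close> is zero.\<close>
      proof (cases "(y, z) \<in> set_pmf (ch x)")
        case True
        then show ?thesis using expectation_tilt_pu[OF set_q_subset[OF x True]] by simp
      qed (simp add: set_pmf_iff)
    qed
    finally show ?thesis using x by (simp add: expectation_ch)
  qed
  then show ?thesis
    unfolding P_def by (subst expectation_quantized_joint[OF fin_px fin_ch fin_q])
      (auto intro!: expectation_cong_pmf)
qed

private lemma expectation_YZ:
  fixes f :: "_ \<Rightarrow> real"
  shows "measure_pmf.expectation px (\<lambda>x. \<Sum>y\<in>SY. \<Sum>z\<in>SZ. pmf (ch x) (y, z) * f z) =
   measure_pmf.expectation P (\<lambda>(x, y, z, u). f z)"
  unfolding P_def by (subst expectation_quantized_joint[OF fin_px fin_ch fin_q])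
    (auto intro!: expectation_cong_pmf simp: expectation_ch)

private lemma decode_in: "decode xs us b y \<in> {1..M}"
proof (cases "\<exists>!w. fits xs us b y w")
  case True
  then have "fits xs us b y (decode xs us b y)"
    unfolding decode_def by (simp only: if_True) (rule theI')
  then show ?thesis by (simp only: fits_def)
qed (use M1 in \<open>simp add: decode_def\<close>)

private lemma conf_in: "conf xs us z \<in> {1..B}"
  using B1 unfolding conf_def by (intro arg_min_if_finite(1)) auto

private lemma cost_conf_le: "b \<in> {1..B} \<Longrightarrow> cost xs us z (conf xs us z) \<le> cost xs us z b"
  unfolding conf_def by (intro arg_min_least) auto

private lemma cost_nonneg: "cost xs us z b \<ge> 0"
  by (auto simp: cost_def intro!: divide_nonneg_nonneg sum_nonneg)

text \<open>Exchanging the sums groups the error by what the helper sees. The codewords have to lie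
  in the support of \<open>px\<close> because \<open>SY\<close> and \<open>SZ\<close> collect only
  the outputs of such inputs.\<close>

private lemma err_eq:
  assumes "\<And>w. w \<in> {1..M} \<Longrightarrow> xs w \<in> set_pmf px"
  shows "err xs us = (\<Sum>z\<in>SZ. cost xs us z (conf xs us z))"
proof -
  have "measure_pmf.prob (ch (xs w)) {(y, z). decode xs us (conf xs us z) y \<noteq> w} =
      (\<Sum>z\<in>SZ. \<Sum>y\<in>SY. pmf (ch (xs w)) (y, z) * of_bool (decode xs us (conf xs us z) y \<noteq> w))"
    if "w \<in> {1..M}" for w
    using expectation_ch[OF assms[OF that], of "\<lambda>a. of_bool (a \<in> {(y, z).
      decode xs us (conf xs us z) y \<noteq> w})"]
    by (subst sum.swap) (simp add: expectation_of_bool del: integral_indicator)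
  then show ?thesis
    by (simp add: err_def cost_def sum_divide_distrib[symmetric] sum.swap[of _ SZ])
qed

text \<open>Only the message has to be unique: a wrong codeword index \<open>j\<close> together with the correct message
  is not an error.\<close>

private lemma decode_wrong:
  assumes "w \<in> {1..M}" "b \<in> {1..B}" "j \<in> {1..J}"
  shows "of_bool (decode xs us b y \<noteq> w) \<le> (of_bool ((xs w, us (b, j), y) \<notin> T) +
    (\<Sum>w'\<in>{1..M} - {w}. of_bool ((xs w', us (b, j), y) \<in> T) +
       (\<Sum>j'\<in>{1..J} - {j}. of_bool ((xs w', us (b, j'), y) \<in> T))) :: real)"
    (is "_ \<le> ?a + (\<Sum>w'\<in>_. ?b w' + (\<Sum>j'\<in>_. ?c w' j'))")
proof (rule ccontr)
  define X where "X = (\<Sum>w'\<in>{1..M} - {w}. ?b w' + (\<Sum>j'\<in>{1..J} - {j}. ?c w' j'))"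
  assume "\<not> ?thesis"
  then have *: "\<not> of_bool (decode xs us b y \<noteq> w) \<le> ?a + X" unfolding X_def .
  have "X \<ge> 0" unfolding X_def by (intro sum_nonneg add_nonneg_nonneg) auto
  \<comment> \<open>A violated bound leaves one situation: a decoding error although the correct
    message fits through index \<open>j\<close>, and \<open>X < 1\<close>. But each wrong message
    that fits would contribute at least 1 to \<open>X\<close>.\<close>
  with * have d: "decode xs us b y \<noteq> w" and t: "(xs w, us (b, j), y) \<in> T" and s: "X < 1"
    by (auto simp: of_bool_def split: if_splits)
  have "\<not> fits xs us b y w'" if w': "w' \<noteq> w" for w'
  proof
    assume f: "fits xs us b y w'"
    then obtain j' where j': "j' \<in> {1..J}" "(xs w', us (b, j'), y) \<in> T" and w'M: "w' \<in> {1..M}"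
      by (auto simp: fits_def)
    have "1 \<le> ?b w' + (\<Sum>j'\<in>{1..J} - {j}. ?c w' j')"
    proof (cases "j' = j")
      case True
      then show ?thesis using j' by (simp add: sum_nonneg)
    next
      case False
      have "?c w' j' \<le> (\<Sum>j'\<in>{1..J} - {j}. ?c w' j')"
        using False j' by (intro member_le_sum) auto
      with j' show ?thesis by (simp add: add_increasing)
    qed
    also have "\<dots> \<le> X"
      unfolding X_def using w' w'M by (intro member_le_sum[of w' _ "\<lambda>w'. ?b w' + (\<Sum>j'\<in>{1..J} - {j}.
        ?c w' j')"])
        (auto intro!: add_nonneg_nonneg sum_nonneg)
    finally show False using s by simp
  qed
  moreover have "fits xs us b y w" using assms t by (auto simp: fits_def)
  ultimately have "decode xs us b y = w" 
    unfolding decode_def by (metis the_equality)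
  with d show False ..
qed

private lemma cost_le_total:
  "cost xs us z b \<le> (\<Sum>w\<in>{1..M}. \<Sum>y\<in>SY. pmf (ch (xs w)) (y, z)) / M"
  unfolding cost_def by (intro divide_right_mono sum_mono) (auto simp: of_bool_def)

text \<open>Derandomization: the cheapest bin costs at most the average over the codewords, where codeword
  \<open>(b, j)\<close> is chosen with probability \<open>r (us (b, j)) z / (L * S us z)\<close>.\<close>

private lemma cost_conf:
  "cost xs us z (conf xs us z) \<le>
     2 / L * (\<Sum>(b, j)\<in>I. r (us (b, j)) z * cost xs us z b) +
     of_bool (S us z < 1 / 2) * ((\<Sum>w\<in>{1..M}. \<Sum>y\<in>SY. pmf (ch (xs w)) (y, z)) / M)"
proof (cases "S us z < 1 / 2")
  case True
  have "0 \<le> (\<Sum>(b, j)\<in>I. r (us (b, j)) z * cost xs us z b)"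
    by (auto intro!: sum_nonneg mult_nonneg_nonneg r_nonneg cost_nonneg)
  then have "0 \<le> 2 / L * (\<Sum>(b, j)\<in>I. r (us (b, j)) z * cost xs us z b)"
    using L_pos by simp
  with True cost_le_total[of xs us z "conf xs us z"] show ?thesis by simp
next
  case False
  let ?c = "cost xs us z (conf xs us z)"
  \<comment> \<open>Normalizing the weights would mean dividing by \<open>S us z\<close>. As this is
    at least 1/2, the factor 2 replaces the division and the bound stays linear in the
    weights.\<close>
  have "?c \<le> 2 * S us z * ?c"
    using False cost_nonneg[of xs us z "conf xs us z"] mult_right_mono[of 1 "2 * S us z" ?c] by simp
  also have "\<dots> = 2 / L * (\<Sum>(b, j)\<in>I. r (us (b, j)) z * ?c)"
    by (simp add: S_def sum_distrib_right case_prod_unfold)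
  also have "\<dots> \<le> 2 / L * (\<Sum>(b, j)\<in>I. r (us (b, j)) z * cost xs us z b)"
    using L_pos by (intro mult_left_mono sum_mono)
      (auto simp: I_def case_prod_unfold intro!: mult_left_mono cost_conf_le r_nonneg)
  finally show ?thesis using False by simp
qed

section \<open>Expected error over independent codewords\<close>

private lemma D_mono: "(\<And>y. f y \<le> g y) \<Longrightarrow> D x u f \<le> D x u g"
  unfolding D_def by (intro sum_mono mult_left_mono mult_nonneg_nonneg) (auto simp: r_nonneg)

private lemma D_add: "D x u (\<lambda>y. f y + g y) = D x u f + D x u g"
  by (simp add: D_def algebra_simps sum.distrib)

private lemma D_sum: "D x u (\<lambda>y. \<Sum>k\<in>K. f k y) = (\<Sum>k\<in>K. D x u (f k))"
  by (simp add: D_def sum_distrib_left sum.swap[of _ K])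

text \<open>Three ways to fail: the sent input and its quantization do not fit; a fresh input fits
  the true quantization; a fresh input and a fresh quantization fit. In the last two, the fresh
  draws are independent of the output \<open>y\<close>.\<close>

private definition "miss_prob =
  measure_pmf.prob P {(x, y, z, u). (x, u, y) \<notin> T}"
private definition "wrong_msg_prob =
  measure_pmf.expectation px (\<lambda>x'. measure_pmf.prob P {(x, y, z, u). (x', u, y) \<in> T})"
private definition "wrong_both_prob =
  measure_pmf.expectation px (\<lambda>x'. measure_pmf.expectation pu (\<lambda>u'.
     measure_pmf.prob P {(x, y, z, u). (x', u', y) \<in> T}))"

private lemma expectation_miss:
  assumes "w \<in> {1..M}" "i \<in> I"
  shows "measure_pmf.expectation (XS d) (\<lambda>xs. measure_pmf.expectation (US d') (\<lambda>us.
     D (xs w) (us i) (\<lambda>y. of_bool ((xs w, us i, y) \<notin> T)))) = miss_prob"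
proof -
  have "measure_pmf.expectation (XS d) (\<lambda>xs. measure_pmf.expectation (US d') (\<lambda>us.
      D (xs w) (us i) (\<lambda>y. of_bool ((xs w, us i, y) \<notin> T)))) =
    measure_pmf.expectation (XS d) (\<lambda>xs. measure_pmf.expectation pu (\<lambda>u.
      D (xs w) u (\<lambda>y. of_bool ((xs w, u, y) \<notin> T))))"
    unfolding US_def using assms
    by (subst expectation_Pi_pmf_component[where h = "\<lambda>u. D (_ w) u (\<lambda>y. of_bool ((_ w, u, y) \<notin> T))"]) auto
  also have "\<dots> = measure_pmf.expectation px (\<lambda>x. measure_pmf.expectation pu (\<lambda>u.
      D x u (\<lambda>y. of_bool ((x, u, y) \<notin> T))))"
    unfolding XS_def using assms
    by (subst expectation_Pi_pmf_component[where h = "\<lambda>x. measure_pmf.expectation pu (\<lambda>u.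
      D x u (\<lambda>y. of_bool ((x, u, y) \<notin> T)))"]) auto
  also have "\<dots> = miss_prob"
    by (simp add: expectation_D miss_prob_def expectation_of_bool[symmetric] case_prod_unfold del:
      integral_indicator)
  finally show ?thesis .
qed

text \<open>Distinct messages have independent codewords, so \<open>xs w'\<close> acts as a fresh
  input. The codeword \<open>us i\<close> is both weighted and tested and hence stays coupled to
  \<open>y\<close>.\<close>

private lemma expectation_wrong_msg:
  assumes "w \<in> {1..M}" "w' \<in> {1..M}" "w \<noteq> w'" "i \<in> I"
  shows "measure_pmf.expectation (XS d) (\<lambda>xs. measure_pmf.expectation (US d') (\<lambda>us.
     D (xs w) (us i) (\<lambda>y. of_bool ((xs w', us i, y) \<in> T)))) = wrong_msg_prob"
proof -
  let ?h = "\<lambda>x x' u. D x u (\<lambda>y. of_bool ((x', u, y) \<in> T))"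
  have "measure_pmf.expectation (XS d) (\<lambda>xs. measure_pmf.expectation (US d') (\<lambda>us.
    ?h (xs w) (xs w') (us i))) =
    measure_pmf.expectation (XS d) (\<lambda>xs. measure_pmf.expectation pu (?h (xs w) (xs w')))"
    unfolding US_def using assms
    by (subst expectation_Pi_pmf_component[where h = "?h (_ w) (_ w')"]) auto
  also have "\<dots> = measure_pmf.expectation px (\<lambda>x. measure_pmf.expectation px (\<lambda>x'.
      measure_pmf.expectation pu (?h x x')))"
    unfolding XS_def using assms fin_px
    by (subst expectation_Pi_pmf_two_components[where h = "\<lambda>x x'.
      measure_pmf.expectation pu (?h x x')"]) auto
  also have "\<dots> = measure_pmf.expectation px (\<lambda>x'. measure_pmf.expectation px (\<lambda>x.
      measure_pmf.expectation pu (?h x x')))"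
    by (rule expectation_swap_finite) (auto simp: fin_px)
  also have "\<dots> = wrong_msg_prob"
    by (simp add: expectation_D wrong_msg_prob_def expectation_of_bool[symmetric] case_prod_unfold
        del: integral_indicator)
  finally show ?thesis .
qed

text \<open>Only \<open>us i\<close> is coupled to the output by \<open>D\<close>, while another
  codeword is tested. Reordering the expectations integrates out the coupled \<open>u\<close> and
  leaves \<open>u'\<close> independent of \<open>y\<close>.\<close>

private lemma expectation_wrong_both:
  assumes "w \<in> {1..M}" "w' \<in> {1..M}" "w \<noteq> w'" "i \<in> I" "i' \<in> I" "i \<noteq> i'"
  shows "measure_pmf.expectation (XS d) (\<lambda>xs. measure_pmf.expectation (US d') (\<lambda>us.
     D (xs w) (us i) (\<lambda>y. of_bool ((xs w', us i', y) \<in> T)))) = wrong_both_prob"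
proof -
  let ?h = "\<lambda>x x' u u'. D x u (\<lambda>y. of_bool ((x', u', y) \<in> T))"
  have "measure_pmf.expectation (XS d) (\<lambda>xs. measure_pmf.expectation (US d') (\<lambda>us.
    ?h (xs w) (xs w') (us i) (us i'))) =
    measure_pmf.expectation (XS d) (\<lambda>xs. measure_pmf.expectation pu (\<lambda>u.
      measure_pmf.expectation pu (?h (xs w) (xs w') u)))"
    unfolding US_def using assms fin_pu
    by (subst expectation_Pi_pmf_two_components[where h = "?h (_ w) (_ w')"]) auto
  also have "\<dots> = measure_pmf.expectation px (\<lambda>x. measure_pmf.expectation px (\<lambda>x'.
      measure_pmf.expectation pu (\<lambda>u. measure_pmf.expectation pu (?h x x' u))))"
    unfolding XS_def using assms fin_px
    by (subst expectation_Pi_pmf_two_components[where h = "\<lambda>x x'. measure_pmf.expectation pu (\<lambda>u.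
      measure_pmf.expectation pu (?h x x' u))"]) auto
  also have "\<dots> = measure_pmf.expectation px (\<lambda>x'. measure_pmf.expectation px (\<lambda>x.
      measure_pmf.expectation pu (\<lambda>u. measure_pmf.expectation pu (?h x x' u))))"
    by (rule expectation_swap_finite) (auto simp: fin_px)
  also have "\<dots> = measure_pmf.expectation px (\<lambda>x'. measure_pmf.expectation px (\<lambda>x.
      measure_pmf.expectation pu (\<lambda>u'. measure_pmf.expectation pu (\<lambda>u. ?h x x' u u'))))"
    by (subst expectation_swap_finite[OF fin_pu fin_pu]) simp
  also have "\<dots> = measure_pmf.expectation px (\<lambda>x'. measure_pmf.expectation pu (\<lambda>u'.
    measure_pmf.expectation px (\<lambda>x.
      measure_pmf.expectation pu (\<lambda>u. ?h x x' u u'))))"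
    by (subst expectation_swap_finite[OF fin_px fin_pu]) simp
  also have "\<dots> = wrong_both_prob"
    by (simp add: expectation_D wrong_both_prob_def expectation_of_bool[symmetric] case_prod_unfold
        del: integral_indicator)
  finally show ?thesis .
qed

text \<open>Linearity applied to the union bound: \<open>M - 1\<close> competing messages, each with
  the chosen codeword or one of the \<open>J - 1\<close> others in its bin.\<close>

private lemma expectation_decode_wrong:
  assumes w: "w \<in> {1..M}" and b: "b \<in> {1..B}" and j: "j \<in> {1..J}"
  shows "measure_pmf.expectation (XS d) (\<lambda>xs. measure_pmf.expectation (US d') (\<lambda>us.
     D (xs w) (us (b, j)) (\<lambda>y. of_bool (decode xs us b y \<noteq> w)))) \<le>
     miss_prob + real (M - 1) * (wrong_msg_prob + real (J - 1) * wrong_both_prob)"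
proof -
  let ?E = "\<lambda>f. measure_pmf.expectation (XS d) (\<lambda>xs. measure_pmf.expectation (US d') (f xs))"
  have I: "(b, j) \<in> I" using b j by (simp add: I_def)
  have E_add: "?E (\<lambda>xs us. f xs us + g xs us) = ?E f + ?E g" for f g :: "_ \<Rightarrow> _ \<Rightarrow> real"
    by (simp add: expectation_add_finite fin_XS fin_US)
  have E_sum: "?E (\<lambda>xs us. \<Sum>k\<in>K. f k xs us) = (\<Sum>k\<in>K. ?E (f k))" for f :: "nat \<Rightarrow> _ \<Rightarrow> _ \<Rightarrow> real" and K
    by (simp add: expectation_sum_finite fin_XS fin_US)
  have "?E (\<lambda>xs us. D (xs w) (us (b, j)) (\<lambda>y. of_bool (decode xs us b y \<noteq> w))) \<le>
    ?E (\<lambda>xs us. D (xs w) (us (b, j)) (\<lambda>y. of_bool ((xs w, us (b, j), y) \<notin> T) +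
      (\<Sum>w'\<in>{1..M} - {w}. of_bool ((xs w', us (b, j), y) \<in> T) +
       (\<Sum>j'\<in>{1..J} - {j}. of_bool ((xs w', us (b, j'), y) \<in> T)))))"
    by (intro expectation_mono_finite fin_XS fin_US D_mono decode_wrong assms)
  also have "\<dots> = ?E (\<lambda>xs us. D (xs w) (us (b, j)) (\<lambda>y. of_bool ((xs w, us (b, j), y) \<notin> T))) +
      (\<Sum>w'\<in>{1..M} - {w}. ?E (\<lambda>xs us. D (xs w) (us (b, j)) (\<lambda>y. of_bool ((xs w', us (b, j), y) \<in> T))) +
       (\<Sum>j'\<in>{1..J} - {j}. ?E (\<lambda>xs us. D (xs w) (us (b, j)) (\<lambda>y. of_bool ((xs w', us (b, j'), y) \<in> T)))))"
    by (simp only: D_add D_sum E_add E_sum)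
  also have "\<dots> = miss_prob + (\<Sum>w'\<in>{1..M} - {w}. wrong_msg_prob + (\<Sum>j'\<in>{1..J} - {j}. wrong_both_prob))"
  proof (intro arg_cong2[where f = "(+)"] sum.cong refl)
    show "?E (\<lambda>xs us. D (xs w) (us (b, j)) (\<lambda>y. of_bool ((xs w, us (b, j), y) \<notin> T))) = miss_prob"
      by (rule expectation_miss[OF w I])
    fix w' assume w': "w' \<in> {1..M} - {w}"
    then show "?E (\<lambda>xs us. D (xs w) (us (b, j)) (\<lambda>y. of_bool ((xs w', us (b, j), y) \<in> T))) = wrong_msg_prob"
      using w I by (intro expectation_wrong_msg) auto
    fix j' assume "j' \<in> {1..J} - {j}"
    then show "?E (\<lambda>xs us. D (xs w) (us (b, j)) (\<lambda>y. of_bool ((xs w', us (b, j'), y) \<in> T))) =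
      wrong_both_prob"
      using w w' I by (intro expectation_wrong_both) (auto simp: I_def)
  qed
  also have "\<dots> = miss_prob + real (M - 1) * (wrong_msg_prob + real (J - 1) * wrong_both_prob)"
    using w j by simp
  finally show ?thesis .
qed

text \<open>By symmetry all \<open>L * M\<close> choices of codeword and message obey the same
  bound, so their average does too; the 2 is the price for not normalizing the weights.\<close>

private lemma expectation_average_cost:
  "measure_pmf.expectation (XS d) (\<lambda>xs. measure_pmf.expectation (US d') (\<lambda>us.
     \<Sum>z\<in>SZ. 2 / L * (\<Sum>(b, j)\<in>I. r (us (b, j)) z * cost xs us z b))) \<le>
   2 * (miss_prob + real (M - 1) * (wrong_msg_prob + real (J - 1) * wrong_both_prob))"
proof -
  let ?E = "\<lambda>f. measure_pmf.expectation (XS d) (\<lambda>xs. measure_pmf.expectation (US d') (f xs))"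
  let ?e = "miss_prob + real (M - 1) * (wrong_msg_prob + real (J - 1) * wrong_both_prob)"
  let ?D = "\<lambda>w b j xs us. D (xs w) (us (b, j)) (\<lambda>y. of_bool (decode xs us b y \<noteq> w))"
  have D: "(\<Sum>z\<in>SZ. r (us (b, j)) z * cost xs us z b) = (\<Sum>w\<in>{1..M}. ?D w b j xs us) / M" for xs us b j
    unfolding cost_def D_def sum_divide_distrib sum_distrib_left
    by (subst sum.swap, intro sum.cong refl, subst sum.swap) (simp add: mult_ac)
  have "(\<Sum>z\<in>SZ. 2 / L * (\<Sum>(b, j)\<in>I. r (us (b, j)) z * cost xs us z b)) =
     2 / (L * M) * (\<Sum>(b, j)\<in>I. \<Sum>w\<in>{1..M}. ?D w b j xs us)" for xs us
  proof -
    have "(\<Sum>z\<in>SZ. 2 / L * (\<Sum>(b, j)\<in>I. r (us (b, j)) z * cost xs us z b)) =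
        2 / L * (\<Sum>(b, j)\<in>I. \<Sum>z\<in>SZ. r (us (b, j)) z * cost xs us z b)"
      by (subst sum_distrib_left[symmetric], subst sum.swap) (simp add: case_prod_unfold)
    then show ?thesis by (simp add: D case_prod_unfold sum_divide_distrib[symmetric])
  qed
  then have "?E (\<lambda>xs us. \<Sum>z\<in>SZ. 2 / L * (\<Sum>(b, j)\<in>I. r (us (b, j)) z * cost xs us z b)) =
      2 / (L * M) * (\<Sum>(b, j)\<in>I. \<Sum>w\<in>{1..M}. ?E (?D w b j))"
    by (simp add: case_prod_unfold expectation_sum_finite fin_XS fin_US)
  also have "\<dots> \<le> 2 / (L * M) * (\<Sum>(b, j)\<in>I. \<Sum>w\<in>{1..M}. ?e)"
    using L_pos by (intro mult_left_mono sum_mono)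
      (auto simp: I_def simp del: sum_constant One_nat_def of_nat_diff intro!: sum_mono
        expectation_decode_wrong)
  also have "\<dots> = 2 * ?e"
    using L_pos M1 by (simp add: case_prod_unfold card_I)
  finally show ?thesis .
qed

text \<open>Soft covering: under \<open>pu\<close> the mean of \<open>r u z\<close> is 1, so its average \<open>S us z\<close> over the codebook is close
  to 1 by Chebyshev's inequality, provided \<open>r\<close> is first truncated at a level \<open>K\<close> well below \<open>L\<close>.\<close>

private lemma S_small:
  assumes "set_pmf (q z) \<subseteq> set_pmf pu" and K: "K > 0"
  shows "measure_pmf.prob (US d) {us. S us z < 1 / 2} \<le>
         4 * measure_pmf.prob (q z) {u. r u z > K} + 16 * K / L"
proof -
  define h where "h u = r u z * of_bool (r u z \<le> K)" for u
  define a where "a = measure_pmf.expectation pu h"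
  have a: "a = measure_pmf.prob (q z) {u. r u z \<le> K}"
    unfolding a_def h_def using expectation_tilt_pu[OF assms(1), of "\<lambda>u. of_bool (r u z \<le> K)"]
    by (simp only: expectation_of_bool)
  have a': "measure_pmf.prob (q z) {u. r u z > K} = 1 - a"
  proof -
    have "{u. r u z > K} = - {u. r u z \<le> K}" by auto
    then show ?thesis using measure_pmf.prob_compl[of "{u. r u z \<le> K}" "q z"] a
      by (simp add: Compl_eq_Diff_UNIV)
  qed
  have h: "0 \<le> h u" "h u \<le> K" for u using K r_nonneg by (auto simp: h_def of_bool_def)
  have pos: "16 * K / L \<ge> 0" using K L_pos by simp
  show ?thesis
  \<comment> \<open>Below 3/4, more than a quarter of the mass is truncated and the factor 4 makes
    the bound exceed 1. Otherwise \<open>S us z < 1 / 2\<close> forces a deviation of at least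
    \<open>L / 4\<close> from a mean of at least \<open>3 * L / 4\<close>; squaring 1/4 gives the
    16.\<close>
  proof (cases "a < 3 / 4")
    case True
    then have "1 \<le> 4 * (1 - a) + 16 * K / L" using pos by (intro add_increasing2) auto
    then show ?thesis unfolding a' by (rule order_trans[OF measure_pmf.prob_le_1])
  next
    case False
    \<comment> \<open>A variable between 0 and \<open>K\<close> with mean at most 1 has second
      moment at most \<open>K\<close>.\<close>
    have var: "measure_pmf.variance pu h \<le> K"
    proof -
      have "measure_pmf.variance pu h = measure_pmf.expectation pu (\<lambda>u. (h u)\<^sup>2) - a\<^sup>2"
        unfolding a_def using fin_pu by (intro measure_pmf.variance_eq integrable_measure_pmf_finite)
      also have "\<dots> \<le> measure_pmf.expectation pu (\<lambda>u. (h u)\<^sup>2)" by simp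
      also have "\<dots> \<le> measure_pmf.expectation pu (\<lambda>u. K * h u)"
        using h by (intro expectation_mono_finite fin_pu) (auto simp: power2_eq_square intro:
          mult_right_mono)
      also have "\<dots> = K * a" by (simp add: a_def)
      also have "\<dots> \<le> K" using K a by (simp add: mult_le_cancel_left1)
      finally show ?thesis .
    qed
    have "measure_pmf.prob (US d) {us. S us z < 1 / 2} \<le>
        measure_pmf.prob (US d) {us. \<bar>(\<Sum>i\<in>I. h (us i)) - card I * a\<bar> \<ge> L / 4}"
    proof (rule measure_pmf.finite_measure_mono, rule subsetI)
      fix us assume "us \<in> {us. S us z < 1 / 2}"
      then have "S us z < 1 / 2" by simp
      moreover have "(\<Sum>i\<in>I. h (us i)) \<le> L * S us z"
        using L_pos r_nonneg by (auto simp: S_def h_def of_bool_def intro!: sum_mono)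
      moreover have "L * S us z \<le> L * (1 / 2)"
        using L_pos \<open>S us z < 1 / 2\<close> by (intro mult_left_mono) auto
      ultimately have "(\<Sum>i\<in>I. h (us i)) \<le> L / 2" by simp
      moreover have "L * a \<ge> L * (3 / 4)" using False L_pos by (intro mult_left_mono) auto
      ultimately show "us \<in> {us. \<bar>(\<Sum>i\<in>I. h (us i)) - card I * a\<bar> \<ge> L / 4}"
        unfolding card_I mem_Collect_eq by linarith
    qed simp
    also have "\<dots> \<le> card I * measure_pmf.variance pu h / (L / 4)\<^sup>2"
      unfolding US_def a_def using L_pos fin_pu by (intro Pi_pmf_Chebyshev) auto
    also have "\<dots> = 16 * measure_pmf.variance pu h / L"
      using L_pos by (simp add: card_I power2_eq_square field_simps)
    also have "\<dots> \<le> 16 * K / L" using var L_pos by (intro divide_right_mono mult_left_mono) auto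
    finally show ?thesis by (simp add: add_increasing)
  qed
qed

private lemma expectation_S_small:
  assumes K: "K > 0"
  shows "measure_pmf.expectation (XS d) (\<lambda>xs. measure_pmf.expectation (US d') (\<lambda>us.
     \<Sum>z\<in>SZ. of_bool (S us z < 1 / 2) * ((\<Sum>w\<in>{1..M}. \<Sum>y\<in>SY. pmf (ch (xs w)) (y, z)) / M))) \<le>
   4 * measure_pmf.prob P {(x, y, z, u). pmf (q z) u > K * pmf pu u} + 16 * K / L"
proof -
  define \<phi> where "\<phi> z = measure_pmf.prob (US d') {us. S us z < 1 / 2}" for z
  have "measure_pmf.expectation (US d') (\<lambda>us. \<Sum>z\<in>SZ. of_bool (S us z < 1 / 2) * c z) =
      (\<Sum>z\<in>SZ. \<phi> z * c z)" for c
    by (simp add: expectation_sum_finite fin_US \<phi>_def expectation_of_bool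
        del: integral_indicator sum_of_bool_mult_eq)
  moreover have "(\<Sum>z\<in>SZ. \<phi> z * ((\<Sum>w\<in>{1..M}. \<Sum>y\<in>SY. pmf (ch (xs w)) (y, z)) / M)) =
      (\<Sum>w\<in>{1..M}. \<Sum>y\<in>SY. \<Sum>z\<in>SZ. pmf (ch (xs w)) (y, z) * \<phi> z) / M" for xs
  proof -
    have "(\<Sum>w\<in>{1..M}. \<Sum>y\<in>SY. \<Sum>z\<in>SZ. pmf (ch (xs w)) (y, z) * \<phi> z) =
        (\<Sum>w\<in>{1..M}. \<Sum>z\<in>SZ. \<Sum>y\<in>SY. pmf (ch (xs w)) (y, z) * \<phi> z)"
      by (rule sum.cong[OF refl], rule sum.swap)
    also have "\<dots> = (\<Sum>z\<in>SZ. \<Sum>w\<in>{1..M}. \<Sum>y\<in>SY. pmf (ch (xs w)) (y, z) * \<phi> z)"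
      by (rule sum.swap)
    finally show ?thesis by (simp add: sum_divide_distrib sum_distrib_left mult.commute)
  qed
  ultimately have "measure_pmf.expectation (XS d) (\<lambda>xs. measure_pmf.expectation (US d') (\<lambda>us.
     \<Sum>z\<in>SZ. of_bool (S us z < 1 / 2) * ((\<Sum>w\<in>{1..M}. \<Sum>y\<in>SY. pmf (ch (xs w)) (y, z)) / M))) =
     measure_pmf.expectation (XS d) (\<lambda>xs. (\<Sum>w\<in>{1..M}. \<Sum>y\<in>SY. \<Sum>z\<in>SZ. pmf (ch (xs w)) (y, z) * \<phi> z) / M)"
    by (simp only:)
  also have "\<dots> = (\<Sum>w\<in>{1..M}. measure_pmf.expectation (XS d) (\<lambda>xs. \<Sum>y\<in>SY. \<Sum>z\<in>SZ.
    pmf (ch (xs w)) (y, z) * \<phi> z)) / M"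
    by (simp add: expectation_sum_finite fin_XS)
  also have "\<dots> = (\<Sum>w\<in>{1..M}. measure_pmf.expectation P (\<lambda>(x, y, z, u). \<phi> z)) / M"
  proof (intro arg_cong2[where f = "(/)"] sum.cong refl)
    fix w assume "w \<in> {1..M}"
    then show "measure_pmf.expectation (XS d) (\<lambda>xs. \<Sum>y\<in>SY. \<Sum>z\<in>SZ. pmf (ch (xs w)) (y, z) * \<phi> z) =
        measure_pmf.expectation P (\<lambda>(x, y, z, u). \<phi> z)"
      unfolding XS_def expectation_YZ[symmetric]
      by (intro expectation_Pi_pmf_component[where h = "\<lambda>x. \<Sum>y\<in>SY. \<Sum>z\<in>SZ. pmf (ch x) (y, z) * \<phi> z"]) auto
  qed
  also have "\<dots> = measure_pmf.expectation P (\<lambda>(x, y, z, u). \<phi> z)" using M1 by simp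
  also have "\<dots> \<le> measure_pmf.expectation P (\<lambda>(x, y, z, u).
      4 * measure_pmf.prob (q z) {u. r u z > K} + 16 * K / L)"
    using S_small[OF _ K] by (intro expectation_mono_finite fin_P)
      (force simp: \<phi>_def pu_def P_def quantized_joint_def image_iff)
  also have "\<dots> = 4 * measure_pmf.expectation P (\<lambda>(x, y, z, u). measure_pmf.prob (q z) {u. r u z > K}) +
    16 * K / L"
    by (simp add: case_prod_unfold expectation_add_finite fin_P)
  \<comment> \<open>Under \<open>P\<close> the value \<open>u\<close> is itself drawn from
    \<open>q z\<close>, so averaging the conditional probability gives the joint one.\<close>
  also have "measure_pmf.expectation P (\<lambda>(x, y, z, u). measure_pmf.prob (q z) {u. r u z > K}) =
      measure_pmf.expectation P (\<lambda>(x, y, z, u). of_bool (r u z > K))"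
    unfolding P_def by (simp add: expectation_quantized_joint[OF fin_px fin_ch fin_q] case_prod_unfold)
      (simp add: expectation_of_bool del: integral_indicator)
  also have "\<dots> = measure_pmf.expectation P (\<lambda>(x, y, z, u). of_bool (pmf (q z) u > K * pmf pu u))"
  proof (rule expectation_cong_pmf)
    fix a assume "a \<in> set_pmf P"
    moreover obtain x y z u where xyzu: "a = (x, y, z, u)" by (cases a)
    ultimately have "u \<in> set_pmf pu" by (force simp: pu_def)
    then have "pmf pu u > 0" by (rule pmf_positive)
    then show "(\<lambda>(x, y, z, u). of_bool (K < r u z)) a = (\<lambda>(x, y, z, u).
      of_bool (K * pmf pu u < pmf (q z) u)) a"
      by (simp add: xyzu r_def pos_less_divide_eq)
  qed
  also have "\<dots> = measure_pmf.prob P {(x, y, z, u). pmf (q z) u > K * pmf pu u}"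
    by (simp add: expectation_of_bool case_prod_unfold del: integral_indicator)
  finally show ?thesis by simp
qed

text \<open>Change of measure from the law with \<open>x\<close> independent of
  \<open>(u, y)\<close> to the true joint law, whose ratio is at least \<open>a\<close> on
  \<open>T\<close>.\<close>

private lemma wrong_msg_prob_le:
  assumes a: "a > 0"
    and T: "\<And>x u y. (x, u, y) \<in> T \<Longrightarrow> a * (pmf px x * pmf (map_pmf (\<lambda>(x, y, z, u). (u, y)) P) (u, y)) \<le>
       pmf (map_pmf (\<lambda>(x, y, z, u). (x, u, y)) P) (x, u, y)"
  shows "wrong_msg_prob \<le> 1 / a"
proof -
  let ?uy = "map_pmf (\<lambda>(x, y, z, u). (u, y)) P"
  have "wrong_msg_prob = measure_pmf.expectation (pair_pmf px ?uy) (\<lambda>(x, u, y). of_bool ((x, u, y) \<in> T))"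
    using fin_px fin_P unfolding wrong_msg_prob_def
    by (simp add: expectation_pair_pmf_finite case_prod_unfold)
      (simp add: expectation_of_bool del: integral_indicator)
  also have "\<dots> = measure_pmf.prob (pair_pmf px ?uy) T"
    by (simp add: case_prod_unfold expectation_of_bool del: integral_indicator)
  also have "\<dots> \<le> 1 / a"
    using fin_px fin_P a
    by (intro prob_le_change_of_measure[where p' = "map_pmf (\<lambda>(x, y, z, u). (x, u, y)) P"])
      (auto simp: pmf_pair T)
  finally show ?thesis .
qed

private lemma wrong_both_prob_le:
  assumes a: "a > 0"
    and T: "\<And>x u y. (x, u, y) \<in> T \<Longrightarrow>
       a * (pmf px x * (pmf pu u * pmf (map_pmf (\<lambda>(x, y, z, u). y) P) y)) \<le>
       pmf (map_pmf (\<lambda>(x, y, z, u). (x, u, y)) P) (x, u, y)"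
  shows "wrong_both_prob \<le> 1 / a"
proof -
  let ?y = "map_pmf (\<lambda>(x, y, z, u). y) P"
  let ?Q = "pair_pmf px (pair_pmf pu ?y)"
  have "wrong_both_prob = measure_pmf.expectation ?Q (\<lambda>(x, u, y). of_bool ((x, u, y) \<in> T))"
    using fin_px fin_P fin_pu unfolding wrong_both_prob_def
    by (simp add: expectation_pair_pmf_finite case_prod_unfold)
      (simp add: expectation_of_bool del: integral_indicator)
  also have "\<dots> = measure_pmf.prob ?Q T"
    by (simp add: case_prod_unfold expectation_of_bool del: integral_indicator)
  also have "\<dots> \<le> 1 / a"
    using fin_px fin_P fin_pu a
    by (intro prob_le_change_of_measure[where p' = "map_pmf (\<lambda>(x, y, z, u). (x, u, y)) P"])
      (auto simp: pmf_pair T)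
  finally show ?thesis .
qed

text \<open>\<open>\<phi>\<close> averages the error over quantization codebooks with the message
  codebook held fixed. For each \<open>xs\<close> some quantization codebook does at least as well
  as this average; a codebook \<open>xs\<close> common to two receivers can thus be chosen
  first.\<close>

lemma one_shot_compress_forward:
  assumes K: "K > 0" and a: "a > 0" and b: "b > 0"
    and T1: "\<And>x u y. (x, u, y) \<in> T \<Longrightarrow>
       a * (pmf px x * pmf (map_pmf (\<lambda>(x, y, z, u). (u, y)) (quantized_joint px ch q)) (u, y)) \<le>
       pmf (map_pmf (\<lambda>(x, y, z, u). (x, u, y)) (quantized_joint px ch q)) (x, u, y)"
    and T2: "\<And>x u y. (x, u, y) \<in> T \<Longrightarrow>
       b * (pmf (map_pmf (\<lambda>(x, y, z, u). u) (quantized_joint px ch q)) u *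
            pmf (map_pmf (\<lambda>(x, y, z, u). y) (quantized_joint px ch q)) y) \<le>
       pmf (map_pmf (\<lambda>(x, y, z, u). (u, y)) (quantized_joint px ch q)) (u, y)"
  shows "\<exists>\<phi>. measure_pmf.expectation (Pi_pmf {1..M} d (\<lambda>_. px)) \<phi> \<le>
       2 * (measure_pmf.prob (quantized_joint px ch q) {(x, y, z, u). (x, u, y) \<notin> T} +
            real (M - 1) * (1 / a + real (J - 1) * (1 / (a * b)))) +
       (4 * measure_pmf.prob (quantized_joint px ch q)
          {(x, y, z, u). pmf (q z) u >
             K * pmf (map_pmf (\<lambda>(x, y, z, u). u) (quantized_joint px ch q)) u} + 16 * K / (B * J)) \<and>
     (\<forall>xs\<in>set_pmf (Pi_pmf {1..M} d (\<lambda>_. px)). \<exists>h g. (\<forall>z. h z \<in> {1..B}) \<and> (\<forall>b y. g b y \<in> {1..M}) \<and>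
        (\<Sum>w\<in>{1..M}. measure_pmf.prob (ch (xs w)) {(y, z). g (h z) y \<noteq> w}) / M \<le> \<phi> xs)"
proof -
  define \<phi> where "\<phi> xs = measure_pmf.expectation (US undefined) (err xs)" for xs
  let ?e1 = "\<lambda>xs us. \<Sum>z\<in>SZ. 2 / L * (\<Sum>(b, j)\<in>I. r (us (b, j)) z * cost xs us z b)"
  let ?e2 = "\<lambda>xs us. \<Sum>z\<in>SZ. of_bool (S us z < 1 / 2) * ((\<Sum>w\<in>{1..M}. \<Sum>y\<in>SY. pmf (ch (xs w)) (y, z)) / M)"
  have "measure_pmf.expectation (XS d) \<phi> \<le>
      measure_pmf.expectation (XS d) (\<lambda>xs. measure_pmf.expectation (US undefined) (\<lambda>us. ?e1 xs us +
        ?e2 xs us))"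
    unfolding \<phi>_def
  proof (intro expectation_mono_finite fin_XS fin_US)
    fix xs us assume "xs \<in> set_pmf (XS d)"
    then have "err xs us = (\<Sum>z\<in>SZ. cost xs us z (conf xs us z))"
      by (intro err_eq) (auto simp: XS_def set_Pi_pmf PiE_dflt_def)
    then show "err xs us \<le> ?e1 xs us + ?e2 xs us"
      by (simp only: sum.distrib[symmetric]) (intro sum_mono cost_conf)
  qed
  also have "\<dots> = measure_pmf.expectation (XS d) (\<lambda>xs. measure_pmf.expectation (US undefined) (?e1 xs)) +
      measure_pmf.expectation (XS d) (\<lambda>xs. measure_pmf.expectation (US undefined) (?e2 xs))"
    by (simp only: expectation_add_finite fin_XS fin_US)
  also have "\<dots> \<le> 2 * (miss_prob + real (M - 1) * (wrong_msg_prob + real (J - 1) * wrong_both_prob)) +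
      (4 * measure_pmf.prob P {(x, y, z, u). pmf (q z) u > K * pmf pu u} + 16 * K / L)"
    by (intro add_mono expectation_average_cost expectation_S_small K)
  also have "\<dots> \<le> 2 * (miss_prob + real (M - 1) * (1 / a + real (J - 1) * (1 / (a * b)))) +
      (4 * measure_pmf.prob P {(x, y, z, u). pmf (q z) u > K * pmf pu u} + 16 * K / L)"
  proof -
    have "wrong_msg_prob \<le> 1 / a"
      by (rule wrong_msg_prob_le[OF a T1[folded P_def]])
    \<comment> \<open>Full independence of \<open>x\<close>, \<open>u\<close> and \<open>y\<close>
      costs both ratios: \<open>a\<close> for separating \<open>x\<close> from \<open>(u, y)\<close>
      and \<open>b\<close> for separating \<open>u\<close> from \<open>y\<close>.\<close>
    moreover have "wrong_both_prob \<le> 1 / (a * b)"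
    proof (rule wrong_both_prob_le)
      fix x u y assume t: "(x, u, y) \<in> T"
      have "a * b * (pmf px x * (pmf pu u * pmf (map_pmf (\<lambda>(x, y, z, u). y) P) y)) =
          a * (pmf px x * (b * (pmf pu u * pmf (map_pmf (\<lambda>(x, y, z, u). y) P) y)))"
        by (simp add: mult_ac)
      also have "\<dots> \<le> a * (pmf px x * pmf (map_pmf (\<lambda>(x, y, z, u). (u, y)) P) (u, y))"
        using T2[OF t, folded P_def, folded pu_def] a by (intro mult_left_mono) auto
      also have "\<dots> \<le> pmf (map_pmf (\<lambda>(x, y, z, u). (x, u, y)) P) (x, u, y)"
        using T1[OF t, folded P_def] .
      finally show "a * b * (pmf px x * (pmf pu u * pmf (map_pmf (\<lambda>(x, y, z, u). y) P) y)) \<le>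
        pmf (map_pmf (\<lambda>(x, y, z, u). (x, u, y)) P) (x, u, y)" .
    qed (use a b in simp)
    ultimately show ?thesis by (intro add_mono mult_left_mono) auto
  qed
  finally have 1: "measure_pmf.expectation (XS d) \<phi> \<le> \<dots>" .
  have 2: "\<exists>h g. (\<forall>z. h z \<in> {1..B}) \<and> (\<forall>b y. g b y \<in> {1..M}) \<and>
        (\<Sum>w\<in>{1..M}. measure_pmf.prob (ch (xs w)) {(y, z). g (h z) y \<noteq> w}) / M \<le> \<phi> xs" for xs
  proof -
    obtain us where "err xs us \<le> \<phi> xs"
      using ex_le_expectation[OF fin_US, of undefined "err xs" "\<phi> xs"] by (auto simp: \<phi>_def)
    then show ?thesis
      by (intro exI[of _ "conf xs us"] exI[of _ "decode xs us"] conjI allI conf_in decode_in)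
        (simp add: err_def)
  qed
  show ?thesis
    by (rule exI[of _ \<phi>], rule conjI)
      (use 1 in \<open>simp only: XS_def pu_def P_def L_def miss_prob_def\<close>, use 2 in blast)
qed

end

section \<open>Information densities\<close>

text \<open>Its mean is the mutual information and it is additive over independent uses, so the
  one-shot thresholds turn into statements about sums.\<close>

definition info_density :: "'w pmf \<Rightarrow> ('w \<Rightarrow> 'a) \<Rightarrow> ('w \<Rightarrow> 'b) \<Rightarrow> 'w \<Rightarrow> real" where
  "info_density P A B \<omega> =
     log 2 (pmf (map_pmf (\<lambda>\<omega>. (A \<omega>, B \<omega>)) P) (A \<omega>, B \<omega>) /
            (pmf (map_pmf A P) (A \<omega>) * pmf (map_pmf B P) (B \<omega>)))"

lemma mi_eq_expectation_info_density:
  fixes A :: "'w \<Rightarrow> 'a::countable" and B :: "'w \<Rightarrow> 'b::countable"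
  shows "mi P A B = measure_pmf.expectation P (info_density P A B)"
proof -
  interpret information_space "measure_pmf P" 2
    by unfold_locales simp
  define Q where "Q = map_pmf (\<lambda>\<omega>. (A \<omega>, B \<omega>)) P"
  have cs: "count_space (UNIV :: 'a set) \<Otimes>\<^sub>M count_space (UNIV :: 'b set) = count_space UNIV"
    by (subst pair_measure_countable) auto
  have dist: "distributed (measure_pmf P) (count_space UNIV) F (pmf (map_pmf F P))" for F :: "'w \<Rightarrow> 'c"
    unfolding distributed_def
    by (simp add: map_pmf_rep_eq[symmetric] measure_pmf_eq_density[symmetric])
  have "mi P A B = integral\<^sup>L (count_space UNIV \<Otimes>\<^sub>M count_space UNIV)
      (\<lambda>x. pmf Q x * log 2 (pmf Q x / (pmf (map_pmf A P) (fst x) * pmf (map_pmf B P) (snd x))))"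
    unfolding mi_def
    by (intro mutual_information_distr dist)
      (auto simp: cs Q_def intro!: sigma_finite_measure_count_space_countable dist)
  also have "\<dots> = measure_pmf.expectation Q
      (\<lambda>x. log 2 (pmf Q x / (pmf (map_pmf A P) (fst x) * pmf (map_pmf B P) (snd x))))"
    unfolding cs by (simp add: measure_pmf_eq_density[of Q] integral_density)
  also have "\<dots> = measure_pmf.expectation P (info_density P A B)"
    unfolding Q_def info_density_def by (simp add: Q_def)
  finally show ?thesis .
qed

lemma info_density_map_pmf:
  "info_density (map_pmf f P) A B (f \<omega>) = info_density P (\<lambda>\<omega>. A (f \<omega>)) (\<lambda>\<omega>. B (f \<omega>)) \<omega>"
  by (simp add: info_density_def pmf.map_comp o_def)

text \<open>Allows a word of pairs to be read as a pair of words, which is an injective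
  relabelling.\<close>

lemma info_density_inj_right:
  assumes "inj g"
  shows "info_density P A (\<lambda>\<omega>. g (B \<omega>)) = info_density P A B"
proof
  fix \<omega>
  have "inj (map_prod (\<lambda>x. x) g)" using assms by (auto simp: inj_on_def)
  then have "pmf (map_pmf (map_prod (\<lambda>x. x) g) (map_pmf (\<lambda>\<omega>. (A \<omega>, B \<omega>)) P)) (map_prod (\<lambda>x.
    x) g (A \<omega>, B \<omega>)) =
      pmf (map_pmf (\<lambda>\<omega>. (A \<omega>, B \<omega>)) P) (A \<omega>, B \<omega>)"
    by (rule pmf_map_inj')
  moreover have "pmf (map_pmf g (map_pmf B P)) (g (B \<omega>)) = pmf (map_pmf B P) (B \<omega>)"
    using assms by (rule pmf_map_inj')
  ultimately show "info_density P A (\<lambda>\<omega>. g (B \<omega>)) \<omega> = info_density P A B \<omega>"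
    by (simp add: info_density_def pmf.map_comp o_def)
qed

lemma pmf_map_pos: "\<omega> \<in> set_pmf P \<Longrightarrow> pmf (map_pmf A P) (A \<omega>) > 0"
  by (intro pmf_positive) auto

text \<open>On the support all three probabilities are positive, so the logarithm can be cleared.
  The product form is the one used by the change of measure.\<close>

lemma le_info_density_iff:
  assumes "\<omega> \<in> set_pmf P"
  shows "s \<le> info_density P A B \<omega> \<longleftrightarrow>
    2 powr s * (pmf (map_pmf A P) (A \<omega>) * pmf (map_pmf B P) (B \<omega>)) \<le>
    pmf (map_pmf (\<lambda>\<omega>. (A \<omega>, B \<omega>)) P) (A \<omega>, B \<omega>)"
  using pmf_map_pos[OF assms, of A] pmf_map_pos[OF assms, of B] pmf_map_pos[OF assms, of "\<lambda>\<omega>. (A \<omega>, B \<omega>)"]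
  by (simp add: info_density_def le_log_iff pos_le_divide_eq)

lemma pmf_map_Pi_pmf:
  fixes P :: "'w pmf" and n :: nat
  assumes "\<omega> \<in> set_pmf (Pi_pmf {..<n} d (\<lambda>_. P))"
  shows "pmf (map_pmf (\<lambda>\<omega> i. F (\<omega> i)) (Pi_pmf {..<n} d (\<lambda>_. P))) (\<lambda>i. F (\<omega> i)) =
         (\<Prod>i<n. pmf (map_pmf F P) (F (\<omega> i)))"
proof -
  have "map_pmf (\<lambda>\<omega> i. F (\<omega> i)) (Pi_pmf {..<n} d (\<lambda>_. P)) = Pi_pmf {..<n} (F d) (\<lambda>_. map_pmf F P)"
    by (subst Pi_pmf_map[where dflt = d]) (auto simp: comp_def[abs_def])
  \<comment> \<open>A word carrying anything else beyond the block would have probability zero under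
    the product distribution.\<close>
  moreover have "\<omega> i = d" if "i \<notin> {..<n}" for i
    using assms set_Pi_pmf_subset[of "{..<n}" d "\<lambda>_. P"] that by auto
  ultimately show ?thesis by (simp add: pmf_Pi)
qed

lemma info_density_Pi_pmf:
  fixes P :: "'w pmf" and n :: nat and A :: "'w \<Rightarrow> 'a" and B :: "'w \<Rightarrow> 'b"
  assumes \<omega>: "\<omega> \<in> set_pmf (Pi_pmf {..<n} d (\<lambda>_. P))"
  shows "info_density (Pi_pmf {..<n} d (\<lambda>_. P)) (\<lambda>\<omega> i. A (\<omega> i)) (\<lambda>\<omega> i. B (\<omega> i)) \<omega> =
         (\<Sum>i<n. info_density P A B (\<omega> i))"
proof -
  let ?P = "Pi_pmf {..<n} d (\<lambda>_. P)"
  have sup: "\<omega> i \<in> set_pmf P" if "i < n" for i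
    using \<omega> that by (auto simp: set_Pi_pmf PiE_dflt_def)
  let ?unzip = "\<lambda>f :: nat \<Rightarrow> 'a \<times> 'b. (\<lambda>i. fst (f i), \<lambda>i. snd (f i))"
  have "inj ?unzip" by (auto simp: inj_on_def fun_eq_iff prod_eq_iff)
  then have "pmf (map_pmf ?unzip (map_pmf (\<lambda>\<omega> i. (A (\<omega> i), B (\<omega> i))) ?P)) (?unzip (\<lambda>i.
    (A (\<omega> i), B (\<omega> i)))) =
      pmf (map_pmf (\<lambda>\<omega> i. (A (\<omega> i), B (\<omega> i))) ?P) (\<lambda>i. (A (\<omega> i), B (\<omega> i)))"
    by (rule pmf_map_inj')
  then have AB: "pmf (map_pmf (\<lambda>\<omega>. (\<lambda>i. A (\<omega> i), \<lambda>i. B (\<omega> i))) ?P) (\<lambda>i. A (\<omega> i), \<lambda>i. B (\<omega> i)) =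
      (\<Prod>i<n. pmf (map_pmf (\<lambda>\<omega>. (A \<omega>, B \<omega>)) P) (A (\<omega> i), B (\<omega> i)))"
    by (simp add: pmf.map_comp o_def pmf_map_Pi_pmf[OF \<omega>, of "\<lambda>\<omega>. (A \<omega>, B \<omega>)"])
  have pos: "0 < pmf (map_pmf (\<lambda>\<omega>. (A \<omega>, B \<omega>)) P) (A (\<omega> i), B (\<omega> i)) /
      (pmf (map_pmf A P) (A (\<omega> i)) * pmf (map_pmf B P) (B (\<omega> i)))" if "i \<in> {..<n}" for i
    using that by (intro divide_pos_pos mult_pos_pos pmf_map_pos
        pmf_map_pos[of _ _ "\<lambda>\<omega>. (A \<omega>, B \<omega>)"] sup) auto
  have "info_density ?P (\<lambda>\<omega> i. A (\<omega> i)) (\<lambda>\<omega> i. B (\<omega> i)) \<omega> =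
      log 2 (\<Prod>i<n. pmf (map_pmf (\<lambda>\<omega>. (A \<omega>, B \<omega>)) P) (A (\<omega> i), B (\<omega> i)) /
         (pmf (map_pmf A P) (A (\<omega> i)) * pmf (map_pmf B P) (B (\<omega> i))))"
    unfolding info_density_def AB pmf_map_Pi_pmf[OF \<omega>, of A] pmf_map_Pi_pmf[OF \<omega>, of B]
    by (simp add: prod_dividef prod.distrib)
  also have "\<dots> = (\<Sum>i<n. info_density P A B (\<omega> i))"
    unfolding info_density_def log_def using less_imp_neq[OF pos] by (subst ln_prod) (auto simp:
      sum_divide_distrib)
  finally show ?thesis .
qed

lemma weak_law_of_large_numbers_Pi_pmf:
  fixes g :: "'w \<Rightarrow> real"
  assumes fin: "finite (set_pmf P)" and \<epsilon>: "\<epsilon> > 0"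
  shows "(\<lambda>n. measure_pmf.prob (Pi_pmf {..<n} d (\<lambda>_. P))
           {\<omega> :: nat \<Rightarrow> 'w. \<bar>(\<Sum>i<n. g (\<omega> i)) - real n * measure_pmf.expectation P g\<bar> \<ge> real n * \<epsilon>}) \<longlonglongrightarrow> 0"
proof -
  let ?V = "measure_pmf.variance P g"
  let ?p = "\<lambda>n. measure_pmf.prob (Pi_pmf {..<n} d (\<lambda>_. P))
      {\<omega> :: nat \<Rightarrow> 'w. \<bar>(\<Sum>i<n. g (\<omega> i)) - real n * measure_pmf.expectation P g\<bar> \<ge> real n * \<epsilon>}"
  have "\<forall>\<^sub>F n in sequentially. ?p n \<le> (?V / \<epsilon>\<^sup>2) / n"
    using eventually_gt_at_top[of "0::nat"]
  proof eventually_elim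
    case (elim n)
    have "?p n \<le> n * ?V / (n * \<epsilon>)\<^sup>2"
      using Pi_pmf_Chebyshev[of "{..<n}" P "n * \<epsilon>" d g] fin \<epsilon> elim by simp
    also have "\<dots> = (?V / \<epsilon>\<^sup>2) / n" using elim by (simp add: power2_eq_square)
    finally show ?case .
  qed
  moreover have "(\<lambda>n. (?V / \<epsilon>\<^sup>2) / real n) \<longlonglongrightarrow> 0" by (rule lim_const_over_n)
  ultimately show ?thesis
    by (intro tendsto_sandwich[of "\<lambda>_. 0" ?p sequentially "\<lambda>n. (?V / \<epsilon>\<^sup>2) / n" 0]) auto
qed

section \<open>Marginals of the quantized channel and thresholds on densities\<close>

definition pX :: "'x \<times> 'y \<times> 'z \<times> 'u \<Rightarrow> 'x" where "pX = (\<lambda>(x, y, z, u). x)"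
definition pY :: "'x \<times> 'y \<times> 'z \<times> 'u \<Rightarrow> 'y" where "pY = (\<lambda>(x, y, z, u). y)"
definition pZ :: "'x \<times> 'y \<times> 'z \<times> 'u \<Rightarrow> 'z" where "pZ = (\<lambda>(x, y, z, u). z)"
definition pU :: "'x \<times> 'y \<times> 'z \<times> 'u \<Rightarrow> 'u" where "pU = (\<lambda>(x, y, z, u). u)"
definition pYU :: "'x \<times> 'y \<times> 'z \<times> 'u \<Rightarrow> 'y \<times> 'u" where "pYU = (\<lambda>(x, y, z, u). (y, u))"

lemma proj_simps [simp]:
  "pX (x, y, z, u) = x" "pY (x, y, z, u) = y" "pZ (x, y, z, u) = z" "pU (x, y, z, u) = u"
  "pYU (x, y, z, u) = (y, u)"
  by (simp_all add: pX_def pY_def pZ_def pU_def pYU_def)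

lemma map_pX_quantized_joint: "map_pmf pX (quantized_joint px ch q) = px"
  by (simp add: quantized_joint_def pX_def map_bind_pmf case_prod_unfold bind_return_pmf')

lemma pmf_bind_map_Pair: "pmf (p \<bind> (\<lambda>x. map_pmf (Pair x) (f x))) (x, y) = pmf p x * pmf (f x) y"
proof -
  have "pmf (map_pmf (Pair x') (f x')) (x, y) = indicator {x} x' * pmf (f x) y" for x'
  proof (cases "x' = x")
    case True
    then show ?thesis using pmf_map_inj'[of "Pair x" "f x" y] by (simp add: inj_on_def)
  next
    case False
    then have "(x, y) \<notin> set_pmf (map_pmf (Pair x') (f x'))" by auto
    then have "pmf (map_pmf (Pair x') (f x')) (x, y) = 0" unfolding set_pmf_iff by blast
    with False show ?thesis by simp
  qed
  then show ?thesis by (simp add: pmf_bind measure_pmf_single)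
qed

text \<open>Given \<open>z\<close>, the law of \<open>u\<close> depends neither on \<open>x\<close>
  nor on \<open>y\<close>. The information density of \<open>u\<close> and \<open>z\<close> is
  therefore the logarithm of the encoder weight, and a threshold on it truncates that
  weight.\<close>

lemma pmf_ZU_quantized_joint:
  "pmf (map_pmf (\<lambda>\<omega>. (pU \<omega>, pZ \<omega>)) (quantized_joint px ch q)) (u, z) =
   pmf (map_pmf pZ (quantized_joint px ch q)) z * pmf (q z) u"
proof -
  let ?z = "px \<bind> (\<lambda>x. map_pmf snd (ch x))"
  have z: "map_pmf pZ (quantized_joint px ch q) = ?z"
    by (simp add: quantized_joint_def pZ_def map_bind_pmf case_prod_unfold bind_return_pmf'
        pmf.map_comp o_def map_pmf_def[symmetric])
  have "map_pmf (\<lambda>\<omega>. (pZ \<omega>, pU \<omega>)) (quantized_joint px ch q) = ?z \<bind> (\<lambda>z. map_pmf (Pair z) (q z))"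
    by (simp add: quantized_joint_def pZ_def pU_def map_bind_pmf case_prod_unfold bind_assoc_pmf
        bind_map_pmf) (simp add: map_pmf_def)
  then have "pmf (map_pmf (\<lambda>\<omega>. (pZ \<omega>, pU \<omega>)) (quantized_joint px ch q)) (z, u) = pmf ?z z * pmf (q z) u"
    by (simp add: pmf_bind_map_Pair)
  moreover have "pmf (map_pmf (\<lambda>\<omega>. (pZ \<omega>, pU \<omega>)) (quantized_joint px ch q)) (z, u) =
      pmf (map_pmf (\<lambda>\<omega>. (pU \<omega>, pZ \<omega>)) (quantized_joint px ch q)) (u, z)"
    by (auto simp: pmf_map intro!: arg_cong[where f = "measure (measure_pmf (quantized_joint px ch q))"])
  ultimately show ?thesis unfolding z by simp
qed

lemma one_shot_compress_forward_info_density: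
  fixes px :: "'x pmf" and ch :: "'x \<Rightarrow> ('y \<times> 'z) pmf" and q :: "'z \<Rightarrow> 'u pmf" and M B J :: nat
  defines "P \<equiv> quantized_joint px ch q"
  assumes fin: "finite (set_pmf px)" "\<And>x. x \<in> set_pmf px \<Longrightarrow> finite (set_pmf (ch x))" "\<And>z.
    finite (set_pmf (q z))"
    and MBJ: "1 \<le> M" "1 \<le> B" "1 \<le> J"
  shows "\<exists>\<phi>. measure_pmf.expectation (Pi_pmf {1..M} d (\<lambda>_. px)) \<phi> \<le>
       2 * (measure_pmf.prob P {\<omega>. info_density P pX pYU \<omega> < s \<or> info_density P pU pY \<omega> < t} +
            real (M - 1) * (2 powr - s + real (J - 1) * 2 powr - (s + t))) +
       (4 * measure_pmf.prob P {\<omega>. info_density P pU pZ \<omega> > k} + 16 * 2 powr k / (B * J)) \<and>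
     (\<forall>xs\<in>set_pmf (Pi_pmf {1..M} d (\<lambda>_. px)). \<exists>h g. (\<forall>z. h z \<in> {1..B}) \<and> (\<forall>b y. g b y \<in> {1..M}) \<and>
        (\<Sum>w\<in>{1..M}. measure_pmf.prob (ch (xs w)) {(y, z). g (h z) y \<noteq> w}) / M \<le> \<phi> xs)"
proof -
  \<comment> \<open>Products instead of logarithms make the inequalities valid for every triple in
    \<open>T\<close>, on or off the support, as the change of measure requires.\<close>
  define T where "T = {(x, u, y).
    2 powr s * (pmf px x * pmf (map_pmf (\<lambda>(x, y, z, u). (u, y)) P) (u, y)) \<le>
      pmf (map_pmf (\<lambda>(x, y, z, u). (x, u, y)) P) (x, u, y) \<and>
    2 powr t * (pmf (map_pmf (\<lambda>(x, y, z, u). u) P) u * pmf (map_pmf (\<lambda>(x, y, z, u). y) P) y) \<le>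
      pmf (map_pmf (\<lambda>(x, y, z, u). (u, y)) P) (u, y)}"
  have eq1: "pmf (map_pmf (\<lambda>(x, y, z, u). (u, y)) P) (u, y) = pmf (map_pmf pYU P) (y, u)" for u y
    by (auto simp: pmf_map pYU_def intro!: arg_cong[where f = "measure (measure_pmf P)"])
  have eq1': "pmf (map_pmf (\<lambda>(x, y, z, u). (u, y)) P) (u, y) = pmf (map_pmf (\<lambda>\<omega>.
    (pU \<omega>, pY \<omega>)) P) (u, y)" for u y
    by (auto simp: pmf_map pU_def pY_def intro!: arg_cong[where f = "measure (measure_pmf P)"])
  have eq2: "pmf (map_pmf (\<lambda>(x, y, z, u). (x, u, y)) P) (x, u, y) =
      pmf (map_pmf (\<lambda>\<omega>. (pX \<omega>, pYU \<omega>)) P) (x, y, u)" for x u y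
    by (auto simp: pmf_map pX_def pYU_def intro!: arg_cong[where f = "measure (measure_pmf P)"])
  have T: "(x, u, y) \<in> T \<longleftrightarrow>
      s \<le> info_density P pX pYU (x, y, z, u) \<and> t \<le> info_density P pU pY (x, y, z, u)"
    if "(x, y, z, u) \<in> set_pmf P" for x y z u
  proof -
    have "px = map_pmf pX P" by (simp add: P_def map_pX_quantized_joint)
    then have "2 powr s * (pmf px x * pmf (map_pmf (\<lambda>(x, y, z, u). (u, y)) P) (u, y)) \<le>
        pmf (map_pmf (\<lambda>(x, y, z, u). (x, u, y)) P) (x, u, y) \<longleftrightarrow> s \<le> info_density P pX pYU (x, y, z, u)"
      unfolding eq1 eq2 le_info_density_iff[OF that] by simp
    moreover have "2 powr t * (pmf (map_pmf (\<lambda>(x, y, z, u). u) P) u * pmf (map_pmf (\<lambda>(x, y, z, u).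
      y) P) y) \<le>
        pmf (map_pmf (\<lambda>(x, y, z, u). (u, y)) P) (u, y) \<longleftrightarrow> t \<le> info_density P pU pY (x, y, z, u)"
      unfolding eq1' le_info_density_iff[OF that] by (simp add: pU_def[symmetric] pY_def[symmetric])
    ultimately show ?thesis by (simp add: T_def)
  qed
  have K: "pmf (q z) u > 2 powr k * pmf (map_pmf (\<lambda>(x, y, z, u).
    u) P) u \<longleftrightarrow> info_density P pU pZ (x, y, z, u) > k"
    if "(x, y, z, u) \<in> set_pmf P" for x y z u
  proof -
    have "pmf (map_pmf pZ P) z > 0" "pmf (map_pmf pU P) u > 0"
      using pmf_map_pos[OF that, of pZ] pmf_map_pos[OF that, of pU] by simp_all
    moreover have "pmf (q z) u > 0"
      using that by (auto simp: P_def quantized_joint_def intro!: pmf_positive)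
    ultimately show ?thesis
      by (simp add: info_density_def pU_def[symmetric] mult_ac
          pmf_ZU_quantized_joint[of px ch q, folded P_def] less_log_iff pos_less_divide_eq)
  qed
  have p1: "measure_pmf.prob P {(x, y, z, u). (x, u, y) \<notin> T} =
      measure_pmf.prob P {\<omega>. info_density P pX pYU \<omega> < s \<or> info_density P pU pY \<omega> < t}"
    using T by (intro measure_pmf.finite_measure_eq_AE AE_pmfI) (auto simp: not_le)
  have p2: "measure_pmf.prob P {(x, y, z, u). pmf (q z) u > 2 powr k * pmf (map_pmf (\<lambda>(x, y, z, u).
    u) P) u} =
      measure_pmf.prob P {\<omega>. info_density P pU pZ \<omega> > k}"
    using K by (intro measure_pmf.finite_measure_eq_AE AE_pmfI) auto
  have e: "1 / 2 powr s = 2 powr - s" "1 / (2 powr s * 2 powr t) = 2 powr - (s + t)"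
    by (simp_all only: powr_minus_divide powr_add)
  have T1: "2 powr s * (pmf px x * pmf (map_pmf (\<lambda>(x, y, z, u). (u, y)) P) (u, y)) \<le>
      pmf (map_pmf (\<lambda>(x, y, z, u). (x, u, y)) P) (x, u, y)" if "(x, u, y) \<in> T" for x u y
    using that by (simp add: T_def)
  have T2: "2 powr t * (pmf (map_pmf (\<lambda>(x, y, z, u). u) P) u * pmf (map_pmf (\<lambda>(x, y, z, u). y) P) y) \<le>
      pmf (map_pmf (\<lambda>(x, y, z, u). (u, y)) P) (u, y)" if "(x, u, y) \<in> T" for x u y
    using that by (simp add: T_def)
  have pos: "(0::real) < 2 powr r" for r by simp
  show ?thesis
    using one_shot_compress_forward[where px = px and ch = ch and q = q and M = M and B = B and J = J
        and K = "2 powr k" and a = "2 powr s" and b = "2 powr t" and T = T and d = d,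
        folded P_def, OF fin MBJ pos pos pos T1 T2]
    unfolding p1 p2 e .
qed

section \<open>Block codes for one receiver\<close>

lemma set_Pi_pmf_outside: "finite I \<Longrightarrow> f \<in> set_pmf (Pi_pmf I d p) \<Longrightarrow> i \<notin> I \<Longrightarrow> f i = d"
  using set_Pi_pmf_subset[of I d p] by auto

text \<open>Input, channel and quantizer act separately at each time, so a block is one use of a
  larger quantized channel and the one-shot bound applies to it.\<close>

lemma quantized_joint_memoryless:
  fixes n :: nat
  shows "quantized_joint (Pi_pmf {..<n} dx (\<lambda>_. px)) (memoryless ch n) (\<lambda>z. Pi_pmf {..<n} du (\<lambda>i.
    q (z i))) =
    map_pmf (\<lambda>\<omega>. (\<lambda>i. pX (\<omega> i), \<lambda>i. pY (\<omega> i), \<lambda>i. pZ (\<omega> i), \<lambda>i. pU (\<omega> i)))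
      (Pi_pmf {..<n} (dx, undefined, undefined, du) (\<lambda>_. quantized_joint px ch q))"
proof -
  let ?d = "(dx, undefined, undefined, du)"
  let ?zip = "\<lambda>xs ys us i. if i \<in> {..<n} then (xs i, fst (ys i), snd (ys i), us i) else ?d"
  let ?yz = "\<lambda>xs. Pi_pmf {..<n} (undefined, undefined) (\<lambda>i. ch (xs i))"
  let ?u = "\<lambda>ys. Pi_pmf {..<n} du (\<lambda>i. q (snd (ys i)))"
  have "Pi_pmf {..<n} ?d (\<lambda>_. quantized_joint px ch q) = do {
      xs \<leftarrow> Pi_pmf {..<n} dx (\<lambda>_. px);
      Pi_pmf {..<n} ?d (\<lambda>i. ch (xs i) \<bind> (\<lambda>yz. q (snd yz) \<bind> (\<lambda>u. return_pmf (xs i, fst yz, snd yz, u))))}"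
    unfolding quantized_joint_def case_prod_unfold by (rule Pi_pmf_bind) simp
  also have "\<dots> = do {
      xs \<leftarrow> Pi_pmf {..<n} dx (\<lambda>_. px);
      ys \<leftarrow> ?yz xs;
      Pi_pmf {..<n} ?d (\<lambda>i. q (snd (ys i)) \<bind> (\<lambda>u. return_pmf (xs i, fst (ys i), snd (ys i), u)))}"
    by (intro bind_pmf_cong refl Pi_pmf_bind) simp
  also have "\<dots> = do {
      xs \<leftarrow> Pi_pmf {..<n} dx (\<lambda>_. px);
      ys \<leftarrow> ?yz xs;
      us \<leftarrow> ?u ys;
      Pi_pmf {..<n} ?d (\<lambda>i. return_pmf (xs i, fst (ys i), snd (ys i), us i))}"
    by (intro bind_pmf_cong refl Pi_pmf_bind) simp
  also have "\<dots> = do {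
      xs \<leftarrow> Pi_pmf {..<n} dx (\<lambda>_. px);
      ys \<leftarrow> ?yz xs;
      us \<leftarrow> ?u ys;
      return_pmf (?zip xs ys us)}"
    by (intro bind_pmf_cong refl Pi_pmf_return_pmf) simp
  finally have "map_pmf (\<lambda>\<omega>. (\<lambda>i. pX (\<omega> i), \<lambda>i. pY (\<omega> i), \<lambda>i. pZ (\<omega> i), \<lambda>i. pU (\<omega> i)))
      (Pi_pmf {..<n} ?d (\<lambda>_. quantized_joint px ch q)) = do {
      xs \<leftarrow> Pi_pmf {..<n} dx (\<lambda>_. px);
      ys \<leftarrow> ?yz xs;
      us \<leftarrow> ?u ys;
      return_pmf (\<lambda>i. pX (?zip xs ys us i), \<lambda>i. pY (?zip xs ys us i),
        \<lambda>i. pZ (?zip xs ys us i), \<lambda>i. pU (?zip xs ys us i))}"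
    by (simp add: map_bind_pmf)
  \<comment> \<open>Unzipping recovers the words also at indices from \<open>n\<close> on, because
    the default of the product consists of the defaults of the separate words.\<close>
  also have "\<dots> = do {
      xs \<leftarrow> Pi_pmf {..<n} dx (\<lambda>_. px);
      ys \<leftarrow> ?yz xs;
      us \<leftarrow> ?u ys;
      return_pmf (xs, fst \<circ> ys, snd \<circ> ys, us)}"
    by (intro bind_pmf_cong refl arg_cong[where f = return_pmf])
      (auto simp: fun_eq_iff dest: set_Pi_pmf_outside[rotated])
  also have "\<dots> = quantized_joint (Pi_pmf {..<n} dx (\<lambda>_. px)) (memoryless ch n) (\<lambda>z.
    Pi_pmf {..<n} du (\<lambda>i. q (z i)))"
    by (simp add: quantized_joint_def memoryless_def bind_map_pmf)
  finally show ?thesis ..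
qed

lemma finite_set_memoryless:
  fixes ch :: "'x \<Rightarrow> ('y::finite \<times> 'z::finite) pmf"
  shows "finite (set_pmf (memoryless ch n x))"
  unfolding memoryless_def by (auto intro!: finite_set_Pi_pmf)

lemma compress_forward_block:
  fixes ch :: "'x::finite \<Rightarrow> ('y::finite \<times> 'z::finite) pmf" and px :: "'x pmf" and q :: "'z \<Rightarrow> 'u pmf"
    and M B J n :: nat and s t k :: real
  defines "P \<equiv> quantized_joint px ch q"
  assumes fin_q: "\<And>z. finite (set_pmf (q z))" and MBJ: "1 \<le> M" "1 \<le> B" "1 \<le> J"
  shows "\<exists>\<phi>. measure_pmf.expectation (Pi_pmf {1..M} d (\<lambda>_. Pi_pmf {..<n} dx (\<lambda>_. px))) \<phi> \<le>
       2 * (measure_pmf.prob (Pi_pmf {..<n} (dx, undefined, undefined, du) (\<lambda>_. P))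
              {\<omega>. (\<Sum>i<n. info_density P pX pYU (\<omega> i)) < s \<or> (\<Sum>i<n. info_density P pU pY (\<omega> i)) < t} +
            real (M - 1) * (2 powr - s + real (J - 1) * 2 powr - (s + t))) +
       (4 * measure_pmf.prob (Pi_pmf {..<n} (dx, undefined, undefined, du) (\<lambda>_. P))
              {\<omega>. (\<Sum>i<n. info_density P pU pZ (\<omega> i)) > k} + 16 * 2 powr k / (B * J)) \<and>
     (\<forall>xs\<in>set_pmf (Pi_pmf {1..M} d (\<lambda>_. Pi_pmf {..<n} dx (\<lambda>_. px))). \<exists>h g.
        (\<forall>z. h z \<in> {1..B}) \<and> (\<forall>b y. g b y \<in> {1..M}) \<and>
        (\<Sum>w\<in>{1..M}. measure_pmf.prob (memoryless ch n (xs w)) {(y, z). g (h z) y \<noteq> w}) / M \<le> \<phi> xs)"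
proof -
  let ?Pn = "Pi_pmf {..<n} (dx, undefined, undefined, du) (\<lambda>_. P)"
  let ?f = "\<lambda>\<omega>. (\<lambda>i. pX (\<omega> i), \<lambda>i. pY (\<omega> i), \<lambda>i. pZ (\<omega> i), \<lambda>i. pU (\<omega> i))"
  let ?Q = "quantized_joint (Pi_pmf {..<n} dx (\<lambda>_. px)) (memoryless ch n) (\<lambda>z. Pi_pmf {..<n} du (\<lambda>i.
    q (z i)))"
  have Q: "?Q = map_pmf ?f ?Pn"
    unfolding P_def by (rule quantized_joint_memoryless)
  have dU: "info_density ?Q pU pY (?f \<omega>) = (\<Sum>i<n. info_density P pU pY (\<omega> i))"
       "info_density ?Q pU pZ (?f \<omega>) = (\<Sum>i<n. info_density P pU pZ (\<omega> i))"
    if "\<omega> \<in> set_pmf ?Pn" for \<omega>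
    by (simp_all add: Q info_density_map_pmf[where f = ?f] info_density_Pi_pmf[OF that])
  have dX: "info_density ?Q pX pYU (?f \<omega>) = (\<Sum>i<n. info_density P pX pYU (\<omega> i))"
    if "\<omega> \<in> set_pmf ?Pn" for \<omega>
  proof -
    let ?unzip = "\<lambda>f :: nat \<Rightarrow> 'y \<times> 'u. (\<lambda>i. fst (f i), \<lambda>i. snd (f i))"
    have "inj ?unzip" by (auto simp: inj_on_def fun_eq_iff prod_eq_iff)
    then have "info_density ?Pn (\<lambda>\<omega> i. pX (\<omega> i)) (\<lambda>\<omega>. ?unzip (\<lambda>i. pYU (\<omega> i))) =
        info_density ?Pn (\<lambda>\<omega> i. pX (\<omega> i)) (\<lambda>\<omega> i. pYU (\<omega> i))"
      by (rule info_density_inj_right)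
    moreover have "fst (pYU a) = pY a" "snd (pYU a) = pU a" for a :: "'x \<times> 'y \<times> 'z \<times> 'u"
      by (cases a; simp)+
    ultimately show ?thesis
      by (simp add: Q info_density_map_pmf[where f = ?f] info_density_Pi_pmf[OF that])
  qed
  have 1: "measure_pmf.prob ?Q {\<omega>. info_density ?Q pX pYU \<omega> < s \<or> info_density ?Q pU pY \<omega> < t} =
      measure_pmf.prob ?Pn {\<omega>. (\<Sum>i<n. info_density P pX pYU (\<omega> i)) < s \<or> (\<Sum>i<n.
        info_density P pU pY (\<omega> i)) < t}"
    unfolding measure_map_pmf[of ?f ?Pn, folded Q]
    by (intro measure_pmf.finite_measure_eq_AE AE_pmfI) (auto simp: dU dX)
  have 2: "measure_pmf.prob ?Q {\<omega>. info_density ?Q pU pZ \<omega> > k} =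
      measure_pmf.prob ?Pn {\<omega>. (\<Sum>i<n. info_density P pU pZ (\<omega> i)) > k}"
    unfolding measure_map_pmf[of ?f ?Pn, folded Q]
    by (intro measure_pmf.finite_measure_eq_AE AE_pmfI) (auto simp: dU)
  show ?thesis
    unfolding 1[symmetric] 2[symmetric] using MBJ
    by (intro one_shot_compress_forward_info_density) (auto intro!: finite_set_Pi_pmf fin_q
      finite_set_memoryless)
qed

text \<open>A real number that is at least 1 is at most twice its integer part, so rounding down
  costs at most a factor 2.\<close>

lemma num_conf_msgs_bounds:
  assumes "0 \<le> C"
  shows "1 \<le> num_conf_msgs n C" "1 / num_conf_msgs n C \<le> 2 * 2 powr - (n * C)"
proof -
  have 1: "1 \<le> 2 powr (n * C)" using assms by (intro ge_one_powr_ge_zero) auto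
  then show ge1: "1 \<le> num_conf_msgs n C" unfolding num_conf_msgs_def by linarith
  have "2 powr (n * C) / 2 \<le> num_conf_msgs n C"
  proof -
    have "2 powr (n * C) < real (num_conf_msgs n C) + 1" unfolding num_conf_msgs_def using 1 by linarith
    then show ?thesis using ge1 by simp
  qed
  then have "1 / num_conf_msgs n C \<le> 1 / (2 powr (n * C) / 2)"
    using ge1 by (intro divide_left_mono) auto
  then show "1 / num_conf_msgs n C \<le> 2 * 2 powr - (n * C)"
    by (simp add: powr_minus_divide)
qed

lemma compress_forward_asymptotic:
  fixes ch :: "'x::finite \<Rightarrow> ('y::finite \<times> 'z::finite) pmf" and px :: "'x pmf" and q :: "'z \<Rightarrow> 'u pmf"
  defines "P \<equiv> quantized_joint px ch q"
  assumes fin_q: "\<And>z. finite (set_pmf (q z))" and C: "0 \<le> C" and R: "0 \<le> R"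
    and link: "measure_pmf.expectation P (info_density P pU pZ) -
      measure_pmf.expectation P (info_density P pU pY) \<le> C"
    and rate: "R < measure_pmf.expectation P (info_density P pX pYU)"
  shows "\<exists>e. e \<longlonglongrightarrow> 0 \<and> (\<forall>n. \<exists>\<phi>.
     measure_pmf.expectation (Pi_pmf {1..nat \<lceil>2 powr (real n * R)\<rceil>} d (\<lambda>_. Pi_pmf {..<n} dx (\<lambda>_.
       px))) \<phi> \<le> e n \<and>
     (\<forall>xs\<in>set_pmf (Pi_pmf {1..nat \<lceil>2 powr (real n * R)\<rceil>} d (\<lambda>_. Pi_pmf {..<n} dx (\<lambda>_. px))). \<exists>h g.
        (\<forall>z. h z \<in> {1..num_conf_msgs n C}) \<and> (\<forall>b y. g b y \<in> {1..nat \<lceil>2 powr (real n * R)\<rceil>}) \<and>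
        (\<Sum>w\<in>{1..nat \<lceil>2 powr (real n * R)\<rceil>}.
           measure_pmf.prob (memoryless ch n (xs w)) {(y, z).
             g (h z) y \<noteq> w}) / nat \<lceil>2 powr (real n * R)\<rceil> \<le> \<phi> xs))"
proof -
  define I1 where "I1 = measure_pmf.expectation P (info_density P pX pYU)"
  define I2 where "I2 = measure_pmf.expectation P (info_density P pU pY)"
  define I3 where "I3 = measure_pmf.expectation P (info_density P pU pZ)"
  \<comment> \<open>Five shares of slack: the thresholds \<open>s\<close> and \<open>t\<close> give
    up one each, the quantization codebook takes two, and one remains as exponent of the
    decay.\<close>
  define \<delta> where "\<delta> = (I1 - R) / 5"
  have \<delta>: "\<delta> > 0" using rate by (simp add: \<delta>_def I1_def)
  have fin_P: "finite (set_pmf P)"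
    unfolding P_def by (intro finite_set_quantized_joint fin_q) auto
  define Pn where "Pn n = Pi_pmf {..<n::nat} (dx, undefined, undefined, undefined) (\<lambda>_. P)" for n
  define dev where "dev g n = measure_pmf.prob (Pn n)
      {\<omega>. \<bar>(\<Sum>i<n. g (\<omega> i)) - n * measure_pmf.expectation P g\<bar> \<ge> n * (\<delta> / 2)}" for g and n :: nat
  have dev: "dev g \<longlonglongrightarrow> 0" for g
    unfolding dev_def Pn_def using \<delta> fin_P by (intro weak_law_of_large_numbers_Pi_pmf) auto
  \<comment> \<open>The 22 is 2 * (1 + 2), from the two kinds of wrong messages, plus 16 from the
    normalization of the encoder.\<close>
  define e where "e n = 2 * (dev (info_density P pX pYU) n + dev (info_density P pU pY) n) +
      4 * dev (info_density P pU pZ) n + 22 * 2 powr - (n * \<delta>)" for n :: nat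
  have "(\<lambda>n. 2 powr - (n * \<delta>)) \<longlonglongrightarrow> 0"
  proof -
    have "(\<lambda>n. (2 powr - \<delta>) ^ n) \<longlonglongrightarrow> 0"
      using \<delta> by (intro LIMSEQ_power_zero) (simp add: powr_less_one)
    then show ?thesis by (simp add: powr_realpow[symmetric] powr_powr mult.commute)
  qed
  then have "e \<longlonglongrightarrow> 2 * (0 + 0) + 4 * 0 + 22 * 0"
    unfolding e_def by (intro tendsto_intros dev)
  then have e0: "e \<longlonglongrightarrow> 0" by simp
  define M where "M n = nat \<lceil>2 powr (real n * R)\<rceil>" for n :: nat
  have "\<exists>\<phi>. measure_pmf.expectation (Pi_pmf {1..M n} d (\<lambda>_. Pi_pmf {..<n} dx (\<lambda>_. px))) \<phi> \<le> e n \<and>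
     (\<forall>xs\<in>set_pmf (Pi_pmf {1..M n} d (\<lambda>_. Pi_pmf {..<n} dx (\<lambda>_. px))). \<exists>h g.
        (\<forall>z. h z \<in> {1..num_conf_msgs n C}) \<and> (\<forall>b y. g b y \<in> {1..M n}) \<and>
        (\<Sum>w\<in>{1..M n}. measure_pmf.prob (memoryless ch n (xs w)) {(y, z). g (h z) y \<noteq> w}) / M n \<le>
          \<phi> xs)" for n
  \<comment> \<open>The empty block has a single message and no error. The strict gaps between
    thresholds and deviations below need \<open>n > 0\<close>.\<close>
  proof (cases "n = 0")
    case True
    have M: "M n = 1" using True by (simp add: M_def)
    have "0 \<le> e n" by (auto simp: e_def dev_def intro!: add_nonneg_nonneg)
    then show ?thesis using num_conf_msgs_bounds(1)[OF C, of n]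
      by (intro exI[of _ "\<lambda>_. 0"] conjI ballI exI[of _ "\<lambda>_. 1"] exI[of _ "\<lambda>_ _. 1"]) (auto simp: M)
  next
    case False
    then have n: "n > 0" by simp
    define B where "B = num_conf_msgs n C"
    \<comment> \<open>The link fixes the number \<open>B\<close> of bins, and \<open>J\<close> fills
      the codebook to a rate \<open>2 * \<delta>\<close> above \<open>I3\<close>. If
      \<open>B\<close> alone reaches that size, \<open>J\<close> is 1 and each bin holds a single
      codeword.\<close>
    define J where "J = nat \<lceil>2 powr (n * (I3 + 2 * \<delta>)) / B\<rceil>"
    define s where "s = n * (I1 - \<delta>)"
    define t where "t = n * (I2 - \<delta>)"
    define k where "k = n * (I3 + \<delta>)"
    have B: "1 \<le> B" "1 / B \<le> 2 * 2 powr - (n * C)"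
      using num_conf_msgs_bounds[OF C, of n] by (simp_all add: B_def)
    have B0: "real B > 0" using B(1) by simp
    have M1: "1 \<le> M n"
    proof -
      have "0 < 2 powr (n * R)" by simp
      then show ?thesis unfolding M_def by linarith
    qed
    have MR: "real (M n - 1) \<le> 2 powr (n * R)"
    proof -
      have "0 < 2 powr (n * R)" by simp
      then have "real (M n) < 2 powr (n * R) + 1" unfolding M_def by linarith
      then show ?thesis using M1 by (simp add: of_nat_diff)
    qed
    have J1: "1 \<le> J"
      using B0 by (simp add: J_def Suc_le_eq)
    have JB: "2 powr (n * (I3 + 2 * \<delta>)) \<le> B * J"
    proof -
      have "2 powr (n * (I3 + 2 * \<delta>)) / B \<le> J" unfolding J_def by linarith
      then show ?thesis using B0 by (simp add: pos_divide_le_eq mult.commute)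
    qed
    have JJ: "real (J - 1) \<le> 2 powr (n * (I3 + 2 * \<delta>)) * (1 / B)"
    proof -
      have "0 < 2 powr (n * (I3 + 2 * \<delta>)) / B" using B0 by simp
      then have "real J < 2 powr (n * (I3 + 2 * \<delta>)) / B + 1" unfolding J_def by linarith
      then show ?thesis using J1 by (simp add: of_nat_diff)
    qed
    have p1: "measure_pmf.prob (Pn n)
        {\<omega>. (\<Sum>i<n. info_density P pX pYU (\<omega> i)) < s \<or> (\<Sum>i<n. info_density P pU pY (\<omega> i)) < t} \<le>
        dev (info_density P pX pYU) n + dev (info_density P pU pY) n"
    proof -
      have lt: "s < n * I1 - n * (\<delta> / 2)" "t < n * I2 - n * (\<delta> / 2)"
        using n \<delta> by (simp_all add: s_def t_def algebra_simps)
      have "{\<omega>. (\<Sum>i<n. info_density P pX pYU (\<omega> i)) < s \<or> (\<Sum>i<n. info_density P pU pY (\<omega> i)) < t} \<subseteq>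
          {\<omega>. \<bar>(\<Sum>i<n. info_density P pX pYU (\<omega> i)) - n * I1\<bar> \<ge> n * (\<delta> / 2)} \<union>
          {\<omega>. \<bar>(\<Sum>i<n. info_density P pU pY (\<omega> i)) - n * I2\<bar> \<ge> n * (\<delta> / 2)}"
      proof
        fix \<omega> assume "\<omega> \<in> {\<omega>. (\<Sum>i<n. info_density P pX pYU (\<omega> i)) < s \<or> (\<Sum>i<n.
          info_density P pU pY (\<omega> i)) < t}"
        then consider "(\<Sum>i<n. info_density P pX pYU (\<omega> i)) < s" | "(\<Sum>i<n. info_density P pU pY (\<omega> i)) < t"
          by blast
        then have "\<bar>(\<Sum>i<n. info_density P pX pYU (\<omega> i)) - n * I1\<bar> \<ge> n * (\<delta> / 2) \<or>
            \<bar>(\<Sum>i<n. info_density P pU pY (\<omega> i)) - n * I2\<bar> \<ge> n * (\<delta> / 2)"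
          using lt by cases linarith+
        then show "\<omega> \<in> {\<omega>. \<bar>(\<Sum>i<n. info_density P pX pYU (\<omega> i)) - n * I1\<bar> \<ge> n * (\<delta> / 2)} \<union>
          {\<omega>. \<bar>(\<Sum>i<n. info_density P pU pY (\<omega> i)) - n * I2\<bar> \<ge> n * (\<delta> / 2)}"
          by blast
      qed
      then show ?thesis unfolding dev_def I1_def[symmetric] I2_def[symmetric]
        by (intro order_trans[OF measure_pmf.finite_measure_mono measure_Un_le]) auto
    qed
    have p3: "measure_pmf.prob (Pn n) {\<omega>. (\<Sum>i<n. info_density P pU pZ (\<omega> i)) > k} \<le>
      dev (info_density P pU pZ) n"
    proof -
      have "n * I3 + n * (\<delta> / 2) < k" unfolding k_def using n \<delta> by (simp add: algebra_simps)
      then show ?thesis unfolding dev_def I3_def[symmetric]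
        by (intro measure_pmf.finite_measure_mono subsetI CollectI, unfold mem_Collect_eq) (linarith, simp)
    qed
    have b1: "real (M n - 1) * 2 powr - s \<le> 2 powr - (n * \<delta>)"
    proof -
      have "real (M n - 1) * 2 powr - s \<le> 2 powr (n * R) * 2 powr - s" using MR by (rule
        mult_right_mono) simp
      also have "\<dots> = 2 powr (n * (R - (I1 - \<delta>)))" by (simp add: s_def powr_add[symmetric] algebra_simps)
      also have "\<dots> \<le> 2 powr - (n * \<delta>)"
      proof -
        have "R - (I1 - \<delta>) \<le> - \<delta>" using \<delta> unfolding \<delta>_def by (simp add: field_simps)
        then have "n * (R - (I1 - \<delta>)) \<le> n * (- \<delta>)" by (intro mult_left_mono) auto
        then show ?thesis by simp
      qed
      finally show ?thesis .
    qed
    \<comment> \<open>The link constraint enters here: \<open>I3 - I2 - C\<close> is at most 0, and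
      equality is harmless because all slack comes from the rate.\<close>
    have b2: "real (M n - 1) * (real (J - 1) * 2 powr - (s + t)) \<le> 2 * 2 powr - (n * \<delta>)"
    proof -
      have "real (J - 1) \<le> 2 powr (n * (I3 + 2 * \<delta>)) * (2 * 2 powr - (n * C))"
        using JJ B(2) by (meson mult_left_mono order_trans powr_ge_zero)
      then have "real (M n - 1) * (real (J - 1) * 2 powr - (s + t)) \<le>
          2 powr (n * R) * ((2 powr (n * (I3 + 2 * \<delta>)) * (2 * 2 powr - (n * C))) * 2 powr - (s + t))"
        using MR by (intro mult_mono) auto
      also have "\<dots> = 2 * 2 powr (n * (R + I3 - I2 - C + 4 * \<delta> - I1))"
        by (simp add: s_def t_def powr_add[symmetric] algebra_simps)
      also have "\<dots> \<le> 2 * 2 powr - (n * \<delta>)"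
      proof -
        have "R + I3 - I2 - C + 4 * \<delta> - I1 \<le> - \<delta>" using link unfolding \<delta>_def I2_def I3_def by (simp add:
          field_simps)
        then have "n * (R + I3 - I2 - C + 4 * \<delta> - I1) \<le> n * (- \<delta>)" by (intro mult_left_mono) auto
        then show ?thesis by simp
      qed
      finally show ?thesis .
    qed
    have b3: "16 * 2 powr k / (B * J) \<le> 16 * 2 powr - (n * \<delta>)"
    proof -
      have k: "2 powr k = 2 powr - (n * \<delta>) * 2 powr (n * (I3 + 2 * \<delta>))"
        by (simp add: k_def powr_add[symmetric] algebra_simps)
      have "16 * 2 powr k / (B * J) \<le> 16 * 2 powr k / 2 powr (n * (I3 + 2 * \<delta>))"
        using JB B(1) J1 by (intro divide_left_mono) auto
      also have "\<dots> = 16 * 2 powr - (n * \<delta>)" by (simp add: k)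
      finally show ?thesis .
    qed
    have bound: "2 * (measure_pmf.prob (Pn n)
        {\<omega>. (\<Sum>i<n. info_density P pX pYU (\<omega> i)) < s \<or> (\<Sum>i<n. info_density P pU pY (\<omega> i)) < t} +
        real (M n - 1) * (2 powr - s + real (J - 1) * 2 powr - (s + t))) +
        (4 * measure_pmf.prob (Pn n) {\<omega>. (\<Sum>i<n. info_density P pU pZ (\<omega> i)) > k} +
          16 * 2 powr k / (B * J)) \<le> e n"
    proof -
      have "2 * (p + (x + y)) + (4 * r + z) \<le> 2 * (a + b) + 4 * c + 22 * d"
        if "p \<le> a + b" "r \<le> c" "x \<le> d" "y \<le> 2 * d" "z \<le> 16 * d" for a b c d p r x y z :: real
        using that by argo
      from this[OF p1 p3 b1 b2 b3] show ?thesis unfolding e_def distrib_left[of "real (M n - 1)"] .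
    qed
    obtain \<phi> where \<phi>: "measure_pmf.expectation (Pi_pmf {1..M n} d (\<lambda>_. Pi_pmf {..<n} dx (\<lambda>_. px))) \<phi> \<le>
        2 * (measure_pmf.prob (Pn n)
        {\<omega>. (\<Sum>i<n. info_density P pX pYU (\<omega> i)) < s \<or> (\<Sum>i<n. info_density P pU pY (\<omega> i)) < t} +
        real (M n - 1) * (2 powr - s + real (J - 1) * 2 powr - (s + t))) +
        (4 * measure_pmf.prob (Pn n) {\<omega>. (\<Sum>i<n. info_density P pU pZ (\<omega> i)) > k} + 16 * 2 powr k / (B * J))"
      and code: "\<forall>xs\<in>set_pmf (Pi_pmf {1..M n} d (\<lambda>_. Pi_pmf {..<n} dx (\<lambda>_. px))). \<exists>h g.
        (\<forall>z. h z \<in> {1..B}) \<and> (\<forall>b y. g b y \<in> {1..M n}) \<and>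
        (\<Sum>w\<in>{1..M n}. measure_pmf.prob (memoryless ch n (xs w)) {(y, z). g (h z) y \<noteq> w}) / M n \<le> \<phi> xs"
      using compress_forward_block[where M = "M n" and B = B and J = J and q = q and s = s and t =
        t and k = k and d = d
          and dx = dx and n = n and px = px and ch = ch and du = undefined,
          OF fin_q M1 B(1) J1, folded P_def, folded Pn_def] by (elim exE conjE)
    show ?thesis
      using code unfolding B_def by (intro exI[of _ \<phi>] conjI order_trans[OF \<phi> bound])
  qed
  then show ?thesis using e0 unfolding M_def by blast
qed

section \<open>Achievability\<close>

lemma mi_map_pmf:
  fixes A :: "'w \<Rightarrow> 'a::countable" and B :: "'w \<Rightarrow> 'b::countable"
  shows "mi (map_pmf f P) A B = mi P (\<lambda>\<omega>. A (f \<omega>)) (\<lambda>\<omega>. B (f \<omega>))"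
  by (simp add: mi_eq_expectation_info_density info_density_map_pmf)

lemma quantized_joint_receiver1:
  "quantized_joint px ch qu = map_pmf (\<lambda>\<omega>. (rvX \<omega>, rvY1 \<omega>, rvY2 \<omega>, rvU \<omega>)) (joint ch px qu qv)"
  by (simp add: joint_def quantized_joint_def map_bind_pmf case_prod_unfold
      rvX_def rvY1_def rvY2_def rvU_def)

lemma quantized_joint_receiver2:
  "quantized_joint px (\<lambda>x. map_pmf prod.swap (ch x)) qv =
   map_pmf (\<lambda>\<omega>. (rvX \<omega>, rvY2 \<omega>, rvY1 \<omega>, rvV \<omega>)) (joint ch px qu qv)"
  by (simp add: joint_def quantized_joint_def map_bind_pmf bind_map_pmf case_prod_unfold
      rvX_def rvY1_def rvY2_def rvV_def)

text \<open>Each term of the objective and the constraints involves only one auxiliary variable. The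
  problem splits into two single-receiver problems that share the input distribution and the
  channel.\<close>

lemma mi_joint:
  fixes ch :: "'x::finite \<Rightarrow> ('y1::finite \<times> 'y2::finite) pmf"
    and qu :: "'y2 \<Rightarrow> 'u::countable pmf" and qv :: "'y1 \<Rightarrow> 'v::countable pmf"
  shows "mi (joint ch px qu qv) rvX (\<lambda>\<omega>. (rvY1 \<omega>, rvU \<omega>)) = mi (quantized_joint px ch qu) pX pYU"
    and "mi (joint ch px qu qv) rvU rvY2 = mi (quantized_joint px ch qu) pU pZ"
    and "mi (joint ch px qu qv) rvU rvY1 = mi (quantized_joint px ch qu) pU pY"
    and "mi (joint ch px qu qv) rvX (\<lambda>\<omega>. (rvY2 \<omega>, rvV \<omega>)) =
         mi (quantized_joint px (\<lambda>x. map_pmf prod.swap (ch x)) qv) pX pYU"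
    and "mi (joint ch px qu qv) rvV rvY1 =
         mi (quantized_joint px (\<lambda>x. map_pmf prod.swap (ch x)) qv) pU pZ"
    and "mi (joint ch px qu qv) rvV rvY2 =
         mi (quantized_joint px (\<lambda>x. map_pmf prod.swap (ch x)) qv) pU pY"
  unfolding quantized_joint_receiver1[of px ch qu qv] quantized_joint_receiver2[of px ch qv qu]
  by (simp_all add: mi_map_pmf)

lemma memoryless_swap:
  "memoryless (\<lambda>x. map_pmf prod.swap (ch x)) n xs = map_pmf prod.swap (memoryless ch n xs)"
proof -
  have "Pi_pmf {..<n} (undefined, undefined) (\<lambda>i. map_pmf prod.swap (ch (xs i))) =
      map_pmf (\<lambda>h. prod.swap \<circ> h) (Pi_pmf {..<n} (undefined, undefined) (\<lambda>i. ch (xs i)))"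
    by (rule Pi_pmf_map) auto
  then show ?thesis by (simp add: memoryless_def pmf.map_comp o_def)
qed

text \<open>Union bound over the receivers; swapping the outputs in the second sum gives both terms
  the shape of the single-receiver bound.\<close>

lemma error_prob_le:
  fixes ch :: "'x::finite \<Rightarrow> ('y1::finite \<times> 'y2::finite) pmf"
  assumes M: "1 \<le> M"
  shows "error_prob ch n M c \<le>
    (\<Sum>w\<in>{1..M}. measure_pmf.prob (memoryless ch n (enc c w)) {(y, z). dec1 c (conf21 c z) y \<noteq> w}) / M +
    (\<Sum>w\<in>{1..M}. measure_pmf.prob (memoryless (\<lambda>x. map_pmf prod.swap (ch x)) n (enc c w))
       {(y, z). dec2 c (conf12 c z) y \<noteq> w}) / M"
proof -
  let ?E = "{(w, y1, y2). dec1 c (conf21 c y2) y1 \<noteq> w \<or> dec2 c (conf12 c y1) y2 \<noteq> w}"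
  let ?P = "do {w \<leftarrow> pmf_of_set {1..M}; (y1, y2) \<leftarrow> memoryless ch n (enc c w); return_pmf (w, y1, y2)}"
  have ne: "{1..M} \<noteq> {}" using M by simp
  have "?P = pmf_of_set {1..M} \<bind> (\<lambda>w. map_pmf (Pair w) (memoryless ch n (enc c w)))"
    by (simp add: map_pmf_def case_prod_unfold)
  then have "error_prob ch n M c = measure_pmf.expectation (pmf_of_set {1..M} \<bind> (\<lambda>w.
    map_pmf (Pair w) (memoryless ch n (enc c w))))
      (\<lambda>a. of_bool (a \<in> ?E))"
    by (simp add: error_prob_def expectation_of_bool del: integral_indicator)
  also have "\<dots> = measure_pmf.expectation (pmf_of_set {1..M})
      (\<lambda>w. measure_pmf.prob (memoryless ch n (enc c w)) {a. (w, a) \<in> ?E})"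
    using ne by (subst expectation_bind_pmf_finite)
      (simp_all add: finite_set_memoryless expectation_of_bool del: integral_indicator)
  also have "\<dots> = (\<Sum>w\<in>{1..M}. measure_pmf.prob (memoryless ch n (enc c w)) {a. (w, a) \<in> ?E}) / M"
    using ne by (simp add: integral_pmf_of_set)
  also have "\<dots> \<le> (\<Sum>w\<in>{1..M}. measure_pmf.prob (memoryless ch n (enc c w)) {(y, z).
    dec1 c (conf21 c z) y \<noteq> w} +
      measure_pmf.prob (memoryless (\<lambda>x. map_pmf prod.swap (ch x)) n (enc c w)) {(y, z).
        dec2 c (conf12 c z) y \<noteq> w}) / M"
  proof (intro divide_right_mono sum_mono)
    fix w
    have "{a. (w, a) \<in> ?E} \<subseteq> {(y, z). dec1 c (conf21 c z) y \<noteq> w} \<union>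
        prod.swap -` {(y, z). dec2 c (conf12 c z) y \<noteq> w}" by auto
    then have "measure_pmf.prob (memoryless ch n (enc c w)) {a. (w, a) \<in> ?E} \<le>
        measure_pmf.prob (memoryless ch n (enc c w)) {(y, z). dec1 c (conf21 c z) y \<noteq> w} +
        measure_pmf.prob (memoryless ch n (enc c w)) (prod.swap -` {(y, z). dec2 c (conf12 c z) y \<noteq> w})"
      by (intro order_trans[OF measure_pmf.finite_measure_mono measure_Un_le]) auto
    then show "measure_pmf.prob (memoryless ch n (enc c w)) {a. (w, a) \<in> ?E} \<le>
        measure_pmf.prob (memoryless ch n (enc c w)) {(y, z). dec1 c (conf21 c z) y \<noteq> w} +
        measure_pmf.prob (memoryless (\<lambda>x. map_pmf prod.swap (ch x)) n (enc c w)) {(y, z).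
          dec2 c (conf12 c z) y \<noteq> w}"
      by (simp add: memoryless_swap)
  qed simp
  finally show ?thesis by (simp add: sum.distrib add_divide_distrib)
qed

lemma error_prob_nonneg: "0 \<le> error_prob ch n M c"
  by (simp add: error_prob_def)

lemma achievable_if_less_rate_bound:
  fixes ch :: "'x::finite \<Rightarrow> ('y1::finite \<times> 'y2::finite) pmf"
    and qu :: "'y2 \<Rightarrow> 'u::countable pmf" and qv :: "'y1 \<Rightarrow> 'v::countable pmf"
  assumes fin: "\<And>y2. finite (set_pmf (qu y2))" "\<And>y1. finite (set_pmf (qv y1))"
    and C: "0 \<le> C12" "0 \<le> C21" and R: "0 \<le> R"
    and link: "link_constraints C12 C21 (joint ch px qu qv)"
    and rate: "R < rate_bound (joint ch px qu qv)"
  shows "achievable C12 C21 ch R"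
proof -
  define M where "M n = nat \<lceil>2 powr (real n * R)\<rceil>" for n :: nat
  define X where "X n = Pi_pmf {1..M n} undefined (\<lambda>_. Pi_pmf {..<n} undefined (\<lambda>_. px))" for n :: nat
  let ?sw = "\<lambda>x. map_pmf prod.swap (ch x)"
  let ?P1 = "quantized_joint px ch qu" and ?P2 = "quantized_joint px ?sw qv"
  have M1: "1 \<le> M n" for n
  proof -
    have "0 < 2 powr (real n * R)" by simp
    then show ?thesis unfolding M_def by linarith
  qed
  have fin_X: "finite (set_pmf (X n))" for n
    unfolding X_def by (auto intro!: finite_set_Pi_pmf)
  have l1: "measure_pmf.expectation ?P1 (info_density ?P1 pU pZ) -
    measure_pmf.expectation ?P1 (info_density ?P1 pU pY) \<le> C21"
    and l2: "measure_pmf.expectation ?P2 (info_density ?P2 pU pZ) -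
      measure_pmf.expectation ?P2 (info_density ?P2 pU pY) \<le> C12"
    using link unfolding link_constraints_def mi_joint by (simp_all add: mi_eq_expectation_info_density)
  have r1: "R < measure_pmf.expectation ?P1 (info_density ?P1 pX pYU)"
    and r2: "R < measure_pmf.expectation ?P2 (info_density ?P2 pX pYU)"
    using rate unfolding rate_bound_def mi_joint by (simp_all add: mi_eq_expectation_info_density)
  obtain e1 where e1: "e1 \<longlonglongrightarrow> 0" "\<forall>n. \<exists>\<phi>. measure_pmf.expectation (X n) \<phi> \<le> e1 n \<and>
     (\<forall>xs\<in>set_pmf (X n). \<exists>h g. (\<forall>z. h z \<in> {1..num_conf_msgs n C21}) \<and> (\<forall>b y. g b y \<in> {1..M n}) \<and>
        (\<Sum>w\<in>{1..M n}. measure_pmf.prob (memoryless ch n (xs w)) {(y, z). g (h z) y \<noteq> w}) / M n \<le> \<phi> xs)"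
    using compress_forward_asymptotic[OF fin(1) C(2) R l1 r1, of undefined undefined]
    unfolding M_def[symmetric] X_def[symmetric] by (elim exE conjE)
  obtain e2 where e2: "e2 \<longlonglongrightarrow> 0" "\<forall>n. \<exists>\<phi>. measure_pmf.expectation (X n) \<phi> \<le> e2 n \<and>
     (\<forall>xs\<in>set_pmf (X n). \<exists>h g. (\<forall>z. h z \<in> {1..num_conf_msgs n C12}) \<and> (\<forall>b y. g b y \<in> {1..M n}) \<and>
        (\<Sum>w\<in>{1..M n}. measure_pmf.prob (memoryless ?sw n (xs w)) {(y, z). g (h z) y \<noteq> w}) / M n \<le> \<phi> xs)"
    using compress_forward_asymptotic[OF fin(2) C(1) R l2 r2, of undefined undefined]
    unfolding M_def[symmetric] X_def[symmetric] by (elim exE conjE)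
  have "\<exists>c :: ('x, 'y1, 'y2) conf_code. is_conf_code C12 C21 n (M n) c \<and> error_prob ch n (M n) c \<le>
    e1 n + e2 n" for n
  proof -
    obtain \<phi>1 where \<phi>1: "measure_pmf.expectation (X n) \<phi>1 \<le> e1 n"
      "\<forall>xs\<in>set_pmf (X n). \<exists>h g. (\<forall>z. h z \<in> {1..num_conf_msgs n C21}) \<and> (\<forall>b y. g b y \<in> {1..M n}) \<and>
        (\<Sum>w\<in>{1..M n}. measure_pmf.prob (memoryless ch n (xs w)) {(y, z). g (h z) y \<noteq> w}) / M n \<le> \<phi>1 xs"
      using e1(2)[rule_format, of n] by (elim exE conjE)
    obtain \<phi>2 where \<phi>2: "measure_pmf.expectation (X n) \<phi>2 \<le> e2 n"
      "\<forall>xs\<in>set_pmf (X n). \<exists>h g. (\<forall>z. h z \<in> {1..num_conf_msgs n C12}) \<and> (\<forall>b y. g b y \<in> {1..M n}) \<and>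
        (\<Sum>w\<in>{1..M n}. measure_pmf.prob (memoryless ?sw n (xs w)) {(y, z). g (h z) y \<noteq> w}) / M n \<le> \<phi>2 xs"
      using e2(2)[rule_format, of n] by (elim exE conjE)
    \<comment> \<open>Two codebooks chosen separately could differ; averaging the sum yields one
      that serves both receivers. Conference functions and decoders are chosen afterwards.\<close>
    have "measure_pmf.expectation (X n) (\<lambda>xs. \<phi>1 xs + \<phi>2 xs) \<le> e1 n + e2 n"
      using \<phi>1(1) \<phi>2(1) by (simp add: expectation_add_finite fin_X)
    then obtain xs where xs: "xs \<in> set_pmf (X n)" "\<phi>1 xs + \<phi>2 xs \<le> e1 n + e2 n"
      using ex_le_expectation[OF fin_X] by blast
    obtain h1 g1 where 1: "\<forall>z. h1 z \<in> {1..num_conf_msgs n C21}" "\<forall>b y. g1 b y \<in> {1..M n}"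
        "(\<Sum>w\<in>{1..M n}. measure_pmf.prob (memoryless ch n (xs w)) {(y, z). g1 (h1 z) y \<noteq> w}) / M n \<le> \<phi>1 xs"
      using bspec[OF \<phi>1(2) xs(1)] by (elim exE conjE)
    obtain h2 g2 where 2: "\<forall>z. h2 z \<in> {1..num_conf_msgs n C12}" "\<forall>b y. g2 b y \<in> {1..M n}"
        "(\<Sum>w\<in>{1..M n}. measure_pmf.prob (memoryless ?sw n (xs w)) {(y, z). g2 (h2 z) y \<noteq> w}) / M n \<le> \<phi>2 xs"
      using bspec[OF \<phi>2(2) xs(1)] by (elim exE conjE)
    let ?c = "\<lparr>enc = xs, rate12 = C12, rate21 = C21, conf12 = h2, conf21 = h1, dec1 = g1, dec2 = g2\<rparr>"
    have "is_conf_code C12 C21 n (M n) ?c"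
      unfolding is_conf_code_def conf_code.simps using C 1(1,2) 2(1,2) M1 by blast
    moreover have "error_prob ch n (M n) ?c \<le> e1 n + e2 n"
      using error_prob_le[OF M1[of n], where ch = ch and n = n and c =
        ?c] 1(3) 2(3) xs(2) unfolding conf_code.simps by linarith
    ultimately show ?thesis by blast
  qed
  then obtain c :: "nat \<Rightarrow> ('x, 'y1, 'y2) conf_code" where c: "\<And>n.
    is_conf_code C12 C21 n (M n) (c n)" "\<And>n. error_prob ch n (M n) (c n) \<le> e1 n + e2 n"
    by metis
  have "(\<lambda>n. e1 n + e2 n) \<longlonglongrightarrow> 0" using tendsto_add[OF e1(1) e2(1)] by simp
  then have "(\<lambda>n. error_prob ch n (M n) (c n)) \<longlonglongrightarrow> 0"
    by (rule tendsto_sandwich[rotated 3, where f = "\<lambda>_. 0"]) (auto simp: c(2) error_prob_nonneg)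
  then show ?thesis using c(1) unfolding achievable_def M_def by blast
qed

section \<open>The extreme rates: zero and the supremum\<close>

lemma limit_achievable_zero:
  fixes ch :: "'x::finite \<Rightarrow> ('y1::finite \<times> 'y2::finite) pmf"
  assumes "0 \<le> C12" "0 \<le> C21"
  shows "limit_achievable C12 C21 ch 0"
proof -
  let ?c = "\<lparr>enc = \<lambda>_. undefined, rate12 = C12, rate21 = C21, conf12 = \<lambda>_. 1, conf21 = \<lambda>_. 1,
    dec1 = \<lambda>_ _. 1, dec2 = \<lambda>_ _. 1\<rparr> :: ('x, 'y1, 'y2) conf_code"
  have "is_conf_code C12 C21 n 1 ?c" for n
    using assms num_conf_msgs_bounds(1)[OF assms(1), of n] num_conf_msgs_bounds(1)[OF assms(2), of n]
    by (simp add: is_conf_code_def)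
  moreover have "error_prob ch n 1 ?c = 0" for n
    using error_prob_le[where M = 1 and ch = ch and n = n and c =
      ?c] error_prob_nonneg[of ch n 1 ?c] by simp
  ultimately show ?thesis
    unfolding limit_achievable_def
    by (intro exI[of _ "\<lambda>_. 1"] exI[of _ "\<lambda>_. ?c"]) simp
qed

text \<open>Diagonal argument: at block length \<open>n\<close> a code of rate \<open>r k\<close> is
  used, where \<open>k\<close> grows so slowly that the \<open>k\<close>-th sequence of codes
  already has error at most \<open>1 / (k + 1)\<close>.\<close>

lemma limit_achievable_if_achievable_below:
  assumes R: "0 < R" and ach: "\<And>R'. 0 \<le> R' \<Longrightarrow> R' < R \<Longrightarrow> achievable C12 C21 ch R'"
  shows "limit_achievable C12 C21 ch R"
proof -
  define r where "r k = R * (1 - 1 / real (Suc k))" for k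
  define M where "M k n = nat \<lceil>2 powr (real n * r k)\<rceil>" for k n :: nat
  have r: "0 \<le> r k" "r k < R" for k
    using R by (simp_all add: r_def mult_less_cancel_left1 divide_simps)
  have "\<exists>code. (\<forall>n. is_conf_code C12 C21 n (M k n) (code n)) \<and> (\<lambda>n.
    error_prob ch n (M k n) (code n)) \<longlonglongrightarrow> 0" for k
    using ach[OF r] unfolding achievable_def M_def .
  then obtain c where c: "\<And>k n. is_conf_code C12 C21 n (M k n) (c k n)"
    "\<And>k. (\<lambda>n. error_prob ch n (M k n) (c k n)) \<longlonglongrightarrow> 0" by metis
  have "\<exists>N. \<forall>n\<ge>N. error_prob ch n (M k n) (c k n) \<le> 1 / real (Suc k)" for k
    using LIMSEQ_D[OF c(2), of "1 / real (Suc k)" k] by (force simp: error_prob_nonneg)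
  then obtain N where N: "\<And>k n. N k \<le> n \<Longrightarrow> error_prob ch n (M k n) (c k n) \<le> 1 / real (Suc k)" by metis
  \<comment> \<open>The bound \<open>k \<le> n\<close> makes the set finite, and the inserted 0
    gives the maximum a value while the set is still empty.\<close>
  define K where "K n = {k. k \<le> n \<and> N k \<le> n}" for n
  define \<kappa> where "\<kappa> n = Max (insert 0 (K n))" for n
  have fin_K: "finite (K n)" for n unfolding K_def by (rule finite_subset[of _ "{..n}"]) auto
  have \<kappa>_ge: "k \<le> \<kappa> n" if "k \<le> n" "N k \<le> n" for k n
    unfolding \<kappa>_def using that fin_K by (intro Max_ge) (auto simp: K_def)
  have \<kappa>_in: "N (\<kappa> n) \<le> n" if "N 0 \<le> n" for n
  proof -
    have "\<kappa> n \<in> insert 0 (K n)" unfolding \<kappa>_def using fin_K by (intro Max_in) auto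
    then show ?thesis using that by (auto simp: K_def)
  qed
  have \<kappa>: "filterlim \<kappa> at_top sequentially"
    unfolding filterlim_at_top
  proof
    fix k
    show "\<forall>\<^sub>F n in sequentially. k \<le> \<kappa> n"
      using eventually_ge_at_top[of "max k (N k)"] by eventually_elim (auto intro: \<kappa>_ge)
  qed
  have inv: "(\<lambda>n. 1 / real (Suc (\<kappa> n))) \<longlonglongrightarrow> 0"
    using filterlim_compose[OF LIMSEQ_inverse_real_of_nat \<kappa>] by (simp add: inverse_eq_divide)
  have "(\<lambda>n. error_prob ch n (M (\<kappa> n) n) (c (\<kappa> n) n)) \<longlonglongrightarrow> 0"
  proof (rule tendsto_sandwich[OF _ _ tendsto_const inv])
    show "\<forall>\<^sub>F n in sequentially. error_prob ch n (M (\<kappa> n) n) (c (\<kappa> n) n) \<le> 1 / real (Suc (\<kappa> n))"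
      using eventually_ge_at_top[of "N 0"] by eventually_elim (intro N \<kappa>_in)
  qed (simp add: error_prob_nonneg)
  moreover have "(\<lambda>n. log 2 (real (M (\<kappa> n) n)) / real n) \<longlonglongrightarrow> R"
  proof (rule tendsto_sandwich)
    \<comment> \<open>Rounding up the number of messages costs at most one bit per block, hence
      \<open>1 / n\<close> in rate.\<close>
    have b: "r k \<le> log 2 (real (M k n)) / real n \<and> log 2 (real (M k n)) / real n \<le> r k + 1 / real n"
      if n: "n > 0" for k n
    proof -
      have 1: "1 \<le> 2 powr (real n * r k)" using r by (intro ge_one_powr_ge_zero) auto
      have lo: "2 powr (real n * r k) \<le> real (M k n)" unfolding M_def by linarith
      have "real (M k n) \<le> 2 powr (real n * r k) + 1" unfolding M_def using 1 by linarith
      then have hi: "real (M k n) \<le> 2 powr (real n * r k + 1)" using 1 by (simp add: powr_add)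
      have Mpos: "0 < real (M k n)" using 1 lo by linarith
      have "real n * r k \<le> log 2 (real (M k n))" using lo Mpos by (simp add: le_log_iff)
      moreover have "log 2 (real (M k n)) \<le> real n * r k + 1" using hi Mpos by (simp add: log_le_iff)
      ultimately show ?thesis using n by (simp add: field_simps)
    qed
    show "\<forall>\<^sub>F n in sequentially. r (\<kappa> n) \<le> log 2 (real (M (\<kappa> n) n)) / real n"
      using eventually_gt_at_top[of 0] by eventually_elim (use b in blast)
    show "\<forall>\<^sub>F n in sequentially. log 2 (real (M (\<kappa> n) n)) / real n \<le> r (\<kappa> n) + 1 / real n"
      using eventually_gt_at_top[of 0] by eventually_elim (use b in blast)
    have rl: "(\<lambda>n. r (\<kappa> n)) \<longlonglongrightarrow> R * (1 - 0)"
      unfolding r_def by (intro tendsto_intros inv)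
    then show "(\<lambda>n. r (\<kappa> n)) \<longlonglongrightarrow> R" by simp
    show "(\<lambda>n. r (\<kappa> n) + 1 / real n) \<longlonglongrightarrow> R"
      using tendsto_add[OF rl lim_1_over_n] by simp
  qed
  ultimately show ?thesis
    unfolding limit_achievable_def using c(1)
    by (intro exI[of _ "\<lambda>n. M (\<kappa> n) n"] exI[of _ "\<lambda>n. c (\<kappa> n) n"]) blast
qed

section \<open>Reducing the auxiliary alphabet\<close>

text \<open>Stated for families, where equal vectors at two indices are already dependent with
  coefficients 1 and -1. An injective family reduces to the dimension bound for sets.\<close>

lemma exists_linear_dependence:
  fixes f :: "'i \<Rightarrow> 'v::euclidean_space"
  assumes "finite S" "card S > DIM('v)"
  shows "\<exists>c. (\<exists>i\<in>S. c i \<noteq> 0) \<and> (\<Sum>i\<in>S. c i *\<^sub>R f i) = 0"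
proof (cases "inj_on f S")
  case True
  then have "card (f ` S) > DIM('v)" using assms by (simp add: card_image)
  then have "dependent (f ` S)" by (intro dependent_biggerset) auto
  then obtain c where c: "\<exists>v\<in>f ` S. c v \<noteq> 0" "(\<Sum>v\<in>f ` S. c v *\<^sub>R v) = 0"
    using assms by (subst (asm) dependent_finite) auto
  then show ?thesis using True by (intro exI[of _ "\<lambda>i. c (f i)"]) (auto simp: sum.reindex)
next
  case False
  then obtain i j where ij: "i \<in> S" "j \<in> S" "i \<noteq> j" "f i = f j" by (auto simp: inj_on_def)
  have "(\<Sum>k\<in>S. (of_bool (k = i) - of_bool (k = j)) *\<^sub>R f k) =
      (\<Sum>k\<in>S. if k = i then f k else 0) - (\<Sum>k\<in>S. if k = j then f k else 0)"
    by (subst sum_subtractf[symmetric], intro sum.cong) auto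
  also have "\<dots> = 0" using ij assms by (simp add: sum.delta)
  finally show ?thesis using ij by (intro exI[of _ "\<lambda>k. of_bool (k = i) - of_bool (k = j)"]) force
qed

text \<open>The functional \<open>l\<close> bounds the set of feasible weights, so that every direction preserving the
  constraints leaves the nonnegative orthant. The direction is chosen so that the objective \<open>f\<close> does
  not decrease; this is what saves one point compared to preserving \<open>f\<close> by Caratheodory's theorem.\<close>

lemma exists_sparse_weights:
  fixes v :: "'i \<Rightarrow> 'v::euclidean_space" and f :: "'i \<Rightarrow> real"
  assumes U: "finite U" and l: "linear l" "\<And>u. u \<in> U \<Longrightarrow> (l (v u) :: real) > 0"
    and m: "\<And>u. u \<in> U \<Longrightarrow> 0 \<le> m u"
  shows "\<exists>m'. (\<forall>u\<in>U. 0 \<le> m' u) \<and> (\<Sum>u\<in>U. m' u *\<^sub>R v u) = (\<Sum>u\<in>U. m u *\<^sub>R v u) \<and>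
    (\<Sum>u\<in>U. m u * f u) \<le> (\<Sum>u\<in>U. m' u * f u) \<and> card {u \<in> U. m' u \<noteq> 0} \<le> DIM('v)"
  using m
proof (induction "card {u \<in> U. m u \<noteq> 0}" arbitrary: m rule: less_induct)
  case less
  let ?S = "{u \<in> U. m u \<noteq> 0}"
  have fin_S: "finite ?S" using U by simp
  show ?case
  proof (cases "card ?S \<le> DIM('v)")
    case True
    then show ?thesis using less.prems by (intro exI[of _ m]) auto
  next
    case False
    then obtain c where c: "\<exists>u\<in>?S. c u \<noteq> 0" "(\<Sum>u\<in>?S. c u *\<^sub>R v u) = 0"
      using exists_linear_dependence[OF fin_S, of v] by auto
    define d where "d u = (if u \<in> ?S then if (\<Sum>u\<in>?S. c u * f u) \<ge> 0 then c u else - c u else 0)" for u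
    have sum_d: "(\<Sum>u\<in>U. d u *\<^sub>R v u) = 0"
    proof -
      have "(\<Sum>u\<in>U. d u *\<^sub>R v u) = (\<Sum>u\<in>?S. d u *\<^sub>R v u)"
        using U by (intro sum.mono_neutral_right) (auto simp: d_def)
      also have "\<dots> = (if (\<Sum>u\<in>?S. c u * f u) \<ge> 0 then (\<Sum>u\<in>?S. c u *\<^sub>R v u) else - (\<Sum>u\<in>?S. c u *\<^sub>R v u))"
        by (auto simp: d_def sum_negf[symmetric] intro!: sum.cong)
      finally show ?thesis using c(2) by simp
    qed
    have sum_df: "(\<Sum>u\<in>U. d u * f u) \<ge> 0"
    proof -
      have "(\<Sum>u\<in>U. d u * f u) = (\<Sum>u\<in>?S. d u * f u)"
        using U by (intro sum.mono_neutral_right) (auto simp: d_def)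
      also have "\<dots> = \<bar>\<Sum>u\<in>?S. c u * f u\<bar>"
        by (auto simp: d_def sum_negf[symmetric] abs_if intro!: sum.cong)
      finally show ?thesis by simp
    qed
    have "\<exists>w\<in>?S. d w < 0"
    proof (rule ccontr)
      assume neg: "\<not> (\<exists>w\<in>?S. d w < 0)"
      have nn: "d u \<ge> 0" for u
      proof (cases "u \<in> ?S")
        case True
        then show ?thesis using neg not_le by blast
      qed (auto simp: d_def)
      obtain w where "w \<in> ?S" "c w \<noteq> 0" using c(1) by auto
      then have "w \<in> U" "d w > 0" using nn[of w] by (auto simp: d_def split: if_splits)
      then have "0 < (\<Sum>u\<in>U. d u * l (v u))"
        using U l(2) nn by (intro sum_pos2[of _ w]) (auto simp: less_imp_le)
      also have "\<dots> = l (\<Sum>u\<in>U. d u *\<^sub>R v u)"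
        by (simp add: linear_sum[OF l(1)] linear_scale[OF l(1)])
      also have "\<dots> = 0" by (simp add: sum_d linear_0[OF l(1)])
      finally show False by simp
    qed
    then obtain w where w: "w \<in> ?S" "d w < 0" by blast
    define N where "N = {u \<in> ?S. d u < 0}"
    \<comment> \<open>Ratio test of the simplex method: the longest step that keeps all weights
      nonnegative, at which one more weight vanishes.\<close>
    define t where "t = Min ((\<lambda>u. m u / - d u) ` N)"
    have N: "finite N" "N \<noteq> {}" using U w by (auto simp: N_def)
    have t_le: "t \<le> m u / - d u" if "u \<in> N" for u
      unfolding t_def using N that by (intro Min_le) auto
    have "t \<in> (\<lambda>u. m u / - d u) ` N" unfolding t_def using N by (intro Min_in) auto
    then obtain k where k: "k \<in> N" "t = m k / - d k" by auto
    have t0: "t \<ge> 0" unfolding k(2) using k(1) less.prems by (intro divide_nonneg_pos) (auto simp: N_def)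
    define m2 where "m2 u = m u + t * d u" for u
    have m2_nonneg: "0 \<le> m2 u" if u: "u \<in> U" for u
    proof (cases "u \<in> N")
      case True
      then have "0 < - d u" by (simp add: N_def)
      then have "t * - d u \<le> m u" using t_le[OF True] by (simp only: pos_le_divide_eq)
      then show ?thesis by (simp add: m2_def)
    next
      case False
      then have "d u \<ge> 0" using u by (cases "u \<in> ?S") (auto simp: N_def d_def)
      then show ?thesis using less.prems[OF u] t0 by (simp add: m2_def)
    qed
    have "{u \<in> U. m2 u \<noteq> 0} \<subset> ?S"
    proof
      show "{u \<in> U. m2 u \<noteq> 0} \<subseteq> ?S" by (auto simp: m2_def d_def split: if_splits)
      have "k \<in> ?S" "m2 k = 0" using k by (auto simp: N_def m2_def)
      then show "{u \<in> U. m2 u \<noteq> 0} \<noteq> ?S" by auto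
    qed
    then have "card {u \<in> U. m2 u \<noteq> 0} < card ?S" using fin_S by (intro psubset_card_mono)
    from less.hyps[OF this m2_nonneg] obtain m' where m':
      "\<forall>u\<in>U. 0 \<le> m' u" "(\<Sum>u\<in>U. m' u *\<^sub>R v u) = (\<Sum>u\<in>U. m2 u *\<^sub>R v u)"
      "(\<Sum>u\<in>U. m2 u * f u) \<le> (\<Sum>u\<in>U. m' u * f u)" "card {u \<in> U. m' u \<noteq> 0} \<le> DIM('v)"
      by blast
    have "(\<Sum>u\<in>U. m2 u *\<^sub>R v u) = (\<Sum>u\<in>U. m u *\<^sub>R v u) + t *\<^sub>R (\<Sum>u\<in>U. d u *\<^sub>R v u)"
      by (simp add: m2_def scaleR_add_left sum.distrib scaleR_sum_right)
    moreover have "(\<Sum>u\<in>U. m2 u * f u) = (\<Sum>u\<in>U. m u * f u) + t * (\<Sum>u\<in>U. d u * f u)"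
      by (simp add: m2_def distrib_right sum.distrib sum_distrib_left mult.assoc)
    moreover have "t * (\<Sum>u\<in>U. d u * f u) \<ge> 0" using t0 sum_df by simp
    ultimately show ?thesis using m' sum_d by (intro exI[of _ m']) auto
  qed
qed

section \<open>Reweighting an auxiliary variable\<close>

lemma exists_pmf_with_weights:
  assumes "finite A" "\<And>x. 0 \<le> f x" "\<And>x. x \<notin> A \<Longrightarrow> f x = 0" "(\<Sum>x\<in>A. f x) = (1::real)"
  shows "\<exists>p. \<forall>x. pmf p x = f x"
proof -
  have "(\<integral>\<^sup>+x. ennreal (f x) \<partial>count_space UNIV) = (\<Sum>x\<in>A. ennreal (f x))"
    using assms by (intro nn_integral_count_space') auto
  also have "\<dots> = 1" using assms by (simp add: sum_ennreal)
  finally show ?thesis using pmf_embed_pmf[of f] assms(2) by blast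
qed

lemma pU_eq_snd_pYU: "pU \<omega> = snd (pYU \<omega>)"
  by (simp add: pU_def pYU_def case_prod_unfold)

lemma pmf_map_eq_expectation: "pmf (map_pmf F P) a = measure_pmf.expectation P (\<lambda>\<omega>. of_bool (F \<omega> = a))"
  by (simp add: expectation_of_bool pmf_map vimage_def del: integral_indicator)

lemma map_pY_quantized_joint: "map_pmf pY (quantized_joint px ch q) = px \<bind> (\<lambda>x. map_pmf fst (ch x))"
  by (simp add: quantized_joint_def pY_def map_bind_pmf case_prod_unfold bind_return_pmf'
      pmf.map_comp o_def map_pmf_def[symmetric])

lemma map_pZ_quantized_joint: "map_pmf pZ (quantized_joint px ch q) = px \<bind> (\<lambda>x. map_pmf snd (ch x))"
  by (simp add: quantized_joint_def pZ_def map_bind_pmf case_prod_unfold bind_return_pmf'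
      pmf.map_comp o_def map_pmf_def[symmetric])

text \<open>\<open>q'\<close> is tied to \<open>q\<close> only at outputs of positive probability:
  weights that preserve the law of \<open>z\<close> normalize \<open>m u * pmf (q z) u\<close>
  there, but not necessarily elsewhere.\<close>

context
  fixes ch :: "'x::finite \<Rightarrow> ('y::finite \<times> 'z::finite) pmf" and px :: "'x pmf"
    and q q' :: "'z \<Rightarrow> 'u pmf" and m :: "'u \<Rightarrow> real" and P P'
  assumes fin_q: "\<And>z. finite (set_pmf (q z))" "\<And>z. finite (set_pmf (q' z))"
  defines "P \<equiv> quantized_joint px ch q" and "P' \<equiv> quantized_joint px ch q'"
  assumes q': "\<And>z u. z \<in> pZ ` set_pmf P \<Longrightarrow> pmf (q' z) u = m u * pmf (q z) u"
begin

text \<open>Only the factor \<open>pmf (q z) u\<close> of the joint law changes, so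
  \<open>m (pU \<omega>)\<close> is the density of \<open>P'\<close> relative to
  \<open>P\<close>.\<close>

lemma expectation_reweighted:
  fixes g :: "_ \<Rightarrow> real"
  shows "measure_pmf.expectation P' g = measure_pmf.expectation P (\<lambda>\<omega>. m (pU \<omega>) * g \<omega>)"
proof -
  have tilt: "measure_pmf.expectation (q' z) f = measure_pmf.expectation (q z) (\<lambda>u. m u * f u)"
    if "z \<in> pZ ` set_pmf P" for z and f :: "_ \<Rightarrow> real"
  proof -
    let ?A = "set_pmf (q z) \<union> set_pmf (q' z)"
    have "measure_pmf.expectation (q' z) f = (\<Sum>u\<in>?A. pmf (q' z) u *\<^sub>R f u)"
      using fin_q by (intro integral_measure_pmf) auto
    also have "\<dots> = (\<Sum>u\<in>?A. pmf (q z) u *\<^sub>R (m u * f u))"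
      using q'[OF that] by (simp add: mult_ac)
    also have "\<dots> = measure_pmf.expectation (q z) (\<lambda>u. m u * f u)"
      using fin_q by (intro integral_measure_pmf[symmetric]) auto
    finally show ?thesis .
  qed
  have Z: "z \<in> pZ ` set_pmf P" if "x \<in> set_pmf px" "(y, z) \<in> set_pmf (ch x)" for x y z
  proof -
    obtain u where "u \<in> set_pmf (q z)" using set_pmf_not_empty[of "q z"] by blast
    then have "(x, y, z, u) \<in> set_pmf P" using that by (force simp: P_def quantized_joint_def)
    then show ?thesis by force
  qed
  have "measure_pmf.expectation P' g = measure_pmf.expectation px (\<lambda>x.
    measure_pmf.expectation (ch x) (\<lambda>(y, z).
      measure_pmf.expectation (q' z) (\<lambda>u. g (x, y, z, u))))"
    unfolding P'_def by (intro expectation_quantized_joint fin_q) auto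
  also have "\<dots> = measure_pmf.expectation px (\<lambda>x. measure_pmf.expectation (ch x) (\<lambda>(y, z).
      measure_pmf.expectation (q z) (\<lambda>u. m u * g (x, y, z, u))))"
    using Z by (intro expectation_cong_pmf) (auto simp: tilt split: prod.splits)
  also have "\<dots> = measure_pmf.expectation P (\<lambda>\<omega>. m (pU \<omega>) * g \<omega>)"
    unfolding P_def by (subst expectation_quantized_joint) (auto simp: fin_q)
  finally show ?thesis .
qed

text \<open>\<open>F\<close> reveals the value of \<open>pU\<close>, so the weight is constant on
  each fibre of \<open>F\<close>.\<close>

lemma pmf_map_reweighted:
  assumes "\<And>\<omega>. pU \<omega> = G (F \<omega>)"
  shows "pmf (map_pmf F P') a = m (G a) * pmf (map_pmf F P) a"
proof -
  have "pmf (map_pmf F P') a = measure_pmf.expectation P (\<lambda>\<omega>. m (pU \<omega>) * of_bool (F \<omega> = a))"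
    by (simp add: pmf_map_eq_expectation expectation_reweighted)
  also have "\<dots> = measure_pmf.expectation P (\<lambda>\<omega>. m (G a) * of_bool (F \<omega> = a))"
    by (intro Bochner_Integration.integral_cong) (auto simp: assms)
  finally show ?thesis by (simp add: pmf_map_eq_expectation)
qed

text \<open>In each density the numerator and exactly one factor of the denominator involve
  \<open>u\<close>. Both acquire the factor \<open>m\<close>, which cancels, while the laws of
  \<open>x\<close>, \<open>y\<close> and \<open>z\<close> do not depend on the quantizer.\<close>

lemma info_density_reweighted:
  assumes "m (pU \<omega>) \<noteq> 0"
  shows "info_density P' pX pYU \<omega> = info_density P pX pYU \<omega>"
    "info_density P' pU pY \<omega> = info_density P pU pY \<omega>"
    "info_density P' pU pZ \<omega> = info_density P pU pZ \<omega>"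
proof -
  have XYU: "pmf (map_pmf (\<lambda>\<omega>. (pX \<omega>, pYU \<omega>)) P') (pX \<omega>, pYU \<omega>) =
      m (pU \<omega>) * pmf (map_pmf (\<lambda>\<omega>. (pX \<omega>, pYU \<omega>)) P) (pX \<omega>, pYU \<omega>)"
    by (subst pmf_map_reweighted[where G = "\<lambda>a. snd (snd a)"]) (simp_all add: pU_eq_snd_pYU)
  have YU: "pmf (map_pmf pYU P') (pYU \<omega>) = m (pU \<omega>) * pmf (map_pmf pYU P) (pYU \<omega>)"
    by (subst pmf_map_reweighted[where G = snd]) (simp_all add: pU_eq_snd_pYU)
  have U: "pmf (map_pmf pU P') (pU \<omega>) = m (pU \<omega>) * pmf (map_pmf pU P) (pU \<omega>)"
    by (subst pmf_map_reweighted[where G = "\<lambda>u. u"]) simp_all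
  have UY: "pmf (map_pmf (\<lambda>\<omega>. (pU \<omega>, pY \<omega>)) P') (pU \<omega>, pY \<omega>) =
      m (pU \<omega>) * pmf (map_pmf (\<lambda>\<omega>. (pU \<omega>, pY \<omega>)) P) (pU \<omega>, pY \<omega>)"
    by (subst pmf_map_reweighted[where G = fst]) simp_all
  have UZ: "pmf (map_pmf (\<lambda>\<omega>. (pU \<omega>, pZ \<omega>)) P') (pU \<omega>, pZ \<omega>) =
      m (pU \<omega>) * pmf (map_pmf (\<lambda>\<omega>. (pU \<omega>, pZ \<omega>)) P) (pU \<omega>, pZ \<omega>)"
    by (subst pmf_map_reweighted[where G = fst]) simp_all
  have marg: "map_pmf pX P' = map_pmf pX P" "map_pmf pY P' = map_pmf pY P" "map_pmf pZ P' = map_pmf pZ P"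
    by (simp_all add: P_def P'_def map_pX_quantized_joint map_pY_quantized_joint map_pZ_quantized_joint)
  show "info_density P' pX pYU \<omega> = info_density P pX pYU \<omega>"
    "info_density P' pU pY \<omega> = info_density P pU pY \<omega>"
    "info_density P' pU pZ \<omega> = info_density P pU pZ \<omega>"
    using assms unfolding info_density_def XYU YU U UY UZ marg by simp_all
qed

text \<open>Linear in \<open>m\<close>, since the densities on the right belong to the fixed law
  \<open>P\<close>. Where \<open>m\<close> vanishes, the density of \<open>P'\<close> may differ but
  has weight zero.\<close>

lemma expectation_info_density_reweighted:
  "measure_pmf.expectation P' (info_density P' pX pYU) = measure_pmf.expectation P (\<lambda>\<omega>.
    m (pU \<omega>) * info_density P pX pYU \<omega>)"
  "measure_pmf.expectation P' (info_density P' pU pY) = measure_pmf.expectation P (\<lambda>\<omega>.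
    m (pU \<omega>) * info_density P pU pY \<omega>)"
  "measure_pmf.expectation P' (info_density P' pU pZ) = measure_pmf.expectation P (\<lambda>\<omega>.
    m (pU \<omega>) * info_density P pU pZ \<omega>)"
proof -
  have *: "measure_pmf.expectation P (\<lambda>\<omega>. m (pU \<omega>) * g \<omega>) = measure_pmf.expectation P (\<lambda>\<omega>. m (pU \<omega>) * h \<omega>)"
    if "\<And>\<omega>. m (pU \<omega>) \<noteq> 0 \<Longrightarrow> g \<omega> = h \<omega>" for g h :: "_ \<Rightarrow> real"
    by (intro Bochner_Integration.integral_cong refl) (use that in force)
  show "measure_pmf.expectation P' (info_density P' pX pYU) = measure_pmf.expectation P (\<lambda>\<omega>.
    m (pU \<omega>) * info_density P pX pYU \<omega>)"
    "measure_pmf.expectation P' (info_density P' pU pY) = measure_pmf.expectation P (\<lambda>\<omega>.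
      m (pU \<omega>) * info_density P pU pY \<omega>)"
    "measure_pmf.expectation P' (info_density P' pU pZ) = measure_pmf.expectation P (\<lambda>\<omega>.
      m (pU \<omega>) * info_density P pU pZ \<omega>)"
    unfolding expectation_reweighted by (intro * info_density_reweighted; assumption)+
qed

end

lemma exists_small_alphabet:
  fixes ch :: "'x::finite \<Rightarrow> ('y::finite \<times> 'z::finite) pmf" and px :: "'x pmf" and q :: "'z \<Rightarrow> 'u pmf"
  assumes fin_q: "\<And>z. finite (set_pmf (q z))"
  defines "P \<equiv> quantized_joint px ch q"
  shows "\<exists>(q' :: 'z \<Rightarrow> 'u pmf) \<U>. finite \<U> \<and> card \<U> \<le> CARD('z) + 1 \<and> (\<forall>z. set_pmf (q' z) \<subseteq> \<U>) \<and>
    (let P' = quantized_joint px ch q' in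
      measure_pmf.expectation P (info_density P pX pYU) \<le> measure_pmf.expectation P' (info_density P' pX
        pYU) \<and>
      measure_pmf.expectation P' (info_density P' pU pZ) - measure_pmf.expectation P' (info_density P'
        pU pY) =
      measure_pmf.expectation P (info_density P pU pZ) - measure_pmf.expectation P (info_density P pU pY))"
proof -
  have fin_P: "finite (set_pmf P)" unfolding P_def by (intro finite_set_quantized_joint fin_q) auto
  define U where "U = pU ` set_pmf P"
  have fin_U: "finite U" using fin_P by (simp add: U_def)
  define c where "c g u = measure_pmf.expectation P (\<lambda>\<omega>. of_bool (pU \<omega> =
    u) * g \<omega>)" for g :: "_ \<Rightarrow> real" and u
  have sum_c: "(\<Sum>u\<in>U. w u * c g u) = measure_pmf.expectation P (\<lambda>\<omega>. w (pU \<omega>) * g \<omega>)" for w g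
  proof -
    have "(\<Sum>u\<in>U. w u * c g u) = measure_pmf.expectation P (\<lambda>\<omega>. \<Sum>u\<in>U. w u * (of_bool (pU \<omega> = u) * g \<omega>))"
      unfolding c_def by (simp add: expectation_sum_finite[OF fin_P])
    also have "\<dots> = measure_pmf.expectation P (\<lambda>\<omega>. w (pU \<omega>) * g \<omega>)"
    proof (rule expectation_cong_pmf)
      fix \<omega> assume "\<omega> \<in> set_pmf P"
      then have "pU \<omega> \<in> U" by (simp add: U_def)
      moreover have "(\<Sum>u\<in>U. w u * (of_bool (pU \<omega> = u) * g \<omega>)) = (\<Sum>u\<in>U. if u = pU \<omega> then w u * g \<omega> else 0)"
        by (intro sum.cong) auto
      ultimately show "(\<Sum>u\<in>U. w u * (of_bool (pU \<omega> = u) * g \<omega>)) = w (pU \<omega>) * g \<omega>"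
        using fin_U by simp
    qed
    finally show ?thesis .
  qed
  define p where "p z u = c (\<lambda>\<omega>. of_bool (pZ \<omega> = z)) u" for z u
  have p: "p z u = pmf (map_pmf pZ P) z * pmf (q z) u" for z u
  proof -
    have "p z u = pmf (map_pmf (\<lambda>\<omega>. (pU \<omega>, pZ \<omega>)) P) (u, z)"
      unfolding p_def c_def pmf_map_eq_expectation by (simp add: of_bool_conj)
    then show ?thesis unfolding P_def by (simp add: pmf_ZU_quantized_joint)
  qed
  \<comment> \<open>The \<open>CARD('z) + 1\<close> preserved quantities: the law of
    \<open>z\<close>, which keeps the new quantizer normalized, and the link functional. The rate is
    the objective.\<close>
  define v where "v u = ((\<chi> z. p z u) :: real ^ 'z, c (info_density P pU pZ) u - c (info_density P pU
    pY) u)" for u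
  \<comment> \<open>Adding the coordinates over \<open>z\<close> gives the probability of
    \<open>u\<close>, a positive linear functional of \<open>v u\<close>.\<close>
  define l where "l a = (\<Sum>z\<in>UNIV. fst a $ z)" for a :: "(real ^ 'z) \<times> real"
  have lin: "linear l"
    by (rule linearI) (simp_all add: l_def sum.distrib sum_distrib_left)
  have l_pos: "l (v u) > 0" if "u \<in> U" for u
  proof -
    have "l (v u) = measure_pmf.expectation P (\<lambda>\<omega>. \<Sum>z\<in>UNIV. of_bool (pU \<omega> = u) * of_bool (pZ \<omega> = z))"
      unfolding l_def v_def p_def c_def by (subst expectation_sum_finite[OF fin_P]) simp
    also have "\<dots> = pmf (map_pmf pU P) u"
      unfolding pmf_map_eq_expectation by (simp add: sum_distrib_left[symmetric])
    finally show ?thesis using that by (simp add: pmf_positive U_def)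
  qed
  obtain m0 where m0: "\<forall>u\<in>U. 0 \<le> m0 u" "(\<Sum>u\<in>U. m0 u *\<^sub>R v u) = (\<Sum>u\<in>U. 1 *\<^sub>R v u)"
    "(\<Sum>u\<in>U. 1 * c (info_density P pX pYU) u) \<le> (\<Sum>u\<in>U. m0 u * c (info_density P pX pYU) u)"
    "card {u \<in> U. m0 u \<noteq> 0} \<le> DIM((real ^ 'z) \<times> real)"
    using exists_sparse_weights[where U = U and l = l and v = v and m = "\<lambda>_. 1" and f =
      "c (info_density P pX pYU)",
        OF fin_U lin l_pos] by auto
  define m where "m u = (if u \<in> U then m0 u else 0)" for u
  define \<U> where "\<U> = {u. m u \<noteq> 0}"
  have \<U>: "\<U> = {u \<in> U. m0 u \<noteq> 0}" by (auto simp: \<U>_def m_def)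
  have m: "0 \<le> m u" for u using m0(1) by (simp add: m_def)
  have mv: "(\<Sum>u\<in>U. m u *\<^sub>R v u) = (\<Sum>u\<in>U. v u)" using m0(2) by (simp add: m_def)
  have mp: "(\<Sum>u\<in>U. m u * p z u) = (\<Sum>u\<in>U. p z u)" for z
    using arg_cong[OF mv, of "\<lambda>a. fst a $ z"] by (simp add: fst_sum v_def sum_component)
  have ml: "(\<Sum>u\<in>U. m u * (c (info_density P pU pZ) u - c (info_density P pU pY) u)) =
      (\<Sum>u\<in>U. c (info_density P pU pZ) u - c (info_density P pU pY) u)"
    using arg_cong[OF mv, of snd] by (simp add: snd_sum v_def)
  have q_out: "pmf (q z) u = 0" if "z \<in> pZ ` set_pmf P" "u \<notin> U" for z u
  proof -
    have "u \<notin> set_pmf (q z)" using that by (force simp: U_def P_def quantized_joint_def image_iff)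
    then show ?thesis by (simp add: set_pmf_iff)
  qed
  have norm: "(\<Sum>u\<in>U. m u * pmf (q z) u) = 1" if z: "z \<in> pZ ` set_pmf P" for z
  proof -
    have "pmf (map_pmf pZ P) z > 0" using z by (intro pmf_positive) simp
    moreover have "pmf (map_pmf pZ P) z * (\<Sum>u\<in>U. m u * pmf (q z) u) = pmf (map_pmf pZ P) z * (\<Sum>u\<in>U.
      pmf (q z) u)"
      using mp[of z] unfolding p sum_distrib_left by (simp add: mult_ac)
    moreover have "(\<Sum>u\<in>U. pmf (q z) u) = 1"
      using q_out[OF z] fin_U by (intro sum_pmf_eq_1) (simp, metis set_pmf_iff subsetI)
    ultimately show ?thesis by simp
  qed
  have "\<exists>p. \<forall>u. pmf p u = m u * pmf (q z) u" if z: "z \<in> pZ ` set_pmf P" for z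
    using norm[OF z] fin_U m by (intro exists_pmf_with_weights[of U]) (auto simp: m_def)
  then obtain r where r: "\<And>z u. z \<in> pZ ` set_pmf P \<Longrightarrow> pmf (r z) u = m u * pmf (q z) u" by metis
  \<comment> \<open>Outputs that never occur still need a quantizer value inside the small
    alphabet.\<close>
  obtain u0 where u0: "u0 \<in> \<U>"
  proof -
    obtain \<omega> where "\<omega> \<in> set_pmf P" using set_pmf_not_empty[of P] by blast
    then have "(\<Sum>u\<in>U. m u * pmf (q (pZ \<omega>)) u) \<noteq> 0" using norm[of "pZ \<omega>"] by simp
    then obtain u where "m u * pmf (q (pZ \<omega>)) u \<noteq> 0" by (meson sum.not_neutral_contains_not_neutral)
    then show ?thesis using that by (auto simp: \<U>_def)
  qed
  define q' where "q' z = (if z \<in> pZ ` set_pmf P then r z else return_pmf u0)" for z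
  have set_q': "set_pmf (q' z) \<subseteq> \<U>" for z
  proof (cases "z \<in> pZ ` set_pmf P")
    case True
    show ?thesis
    proof
      fix u assume "u \<in> set_pmf (q' z)"
      then have "pmf (r z) u \<noteq> 0" using True by (simp add: q'_def set_pmf_iff)
      then show "u \<in> \<U>" by (auto simp: r[OF True] \<U>_def)
    qed
  next
    case False
    then show ?thesis using u0 unfolding q'_def by simp
  qed
  have fin_\<U>: "finite \<U>" using fin_U by (simp add: \<U>)
  have fin_q': "finite (set_pmf (q' z))" for z using finite_subset[OF set_q' fin_\<U>] .
  have q': "pmf (q' z) u = m u * pmf (q z) u" if "z \<in> pZ ` set_pmf (quantized_joint px ch q)" for z u
    using that by (simp add: q'_def P_def[symmetric] r)
  note E = expectation_info_density_reweighted[where px = px and ch = ch and q = q and q' = q' and m = m,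
      OF fin_q fin_q' q', folded P_def]
  show ?thesis
    unfolding Let_def
  proof (intro exI[of _ q'] exI[of _ \<U>] conjI allI fin_\<U> set_q')
    show "card \<U> \<le> CARD('z) + 1" using m0(4) by (simp add: \<U>)
    show "measure_pmf.expectation P (info_density P pX pYU) \<le>
        measure_pmf.expectation (quantized_joint px ch q') (info_density (quantized_joint px ch q') pX pYU)"
      using m0(3) sum_c[where w = "\<lambda>_. 1" and g = "info_density P pX pYU"] sum_c[where w = m and g =
        "info_density P pX pYU"]
      by (simp add: E m_def)
    show "measure_pmf.expectation (quantized_joint px ch q') (info_density (quantized_joint px ch q') pU
      pZ) -
        measure_pmf.expectation (quantized_joint px ch q') (info_density (quantized_joint px ch q') pU pY) =
        measure_pmf.expectation P (info_density P pU pZ) - measure_pmf.expectation P (info_density P pU pY)"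
      using ml sum_c[where w = "\<lambda>_. 1" and g = "info_density P pU pZ"] sum_c[where w = m and g =
        "info_density P pU pZ"]
        sum_c[where w = "\<lambda>_. 1" and g = "info_density P pU pY"] sum_c[where w = m and g =
          "info_density P pU pY"]
      by (simp add: E right_diff_distrib sum_subtractf)
  qed
qed

section \<open>The conference rate\<close>

text \<open>The joint law is at most the marginal of \<open>B\<close>, so the density is at most the
  logarithm of \<open>1 / p\<close> with \<open>p\<close> the probability of the value of
  \<open>A\<close>. Bounding that by \<open>1 / (p * ln 2)\<close> leaves at most
  \<open>1 / ln 2\<close> per letter; crude, but enough for a finite supremum.\<close>

lemma expectation_info_density_le:
  fixes A :: "'w \<Rightarrow> 'x::finite"
  assumes fin: "finite (set_pmf P)"
  shows "measure_pmf.expectation P (info_density P A B) \<le> CARD('x) / ln 2"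
proof -
  let ?p = "map_pmf A P"
  have "measure_pmf.expectation P (info_density P A B) \<le>
      measure_pmf.expectation P (\<lambda>\<omega>. 1 / pmf ?p (A \<omega>) / ln 2)"
  proof (rule expectation_mono_finite[OF fin])
    fix \<omega> assume \<omega>: "\<omega> \<in> set_pmf P"
    let ?AB = "map_pmf (\<lambda>\<omega>. (A \<omega>, B \<omega>)) P"
    have pos: "pmf ?p (A \<omega>) > 0" "pmf (map_pmf B P) (B \<omega>) > 0" "pmf ?AB (A \<omega>, B \<omega>) > 0"
      using pmf_map_pos[OF \<omega>, of A] pmf_map_pos[OF \<omega>, of B] pmf_map_pos[OF \<omega>, of "\<lambda>\<omega>. (A \<omega>, B \<omega>)"] by auto
    have le: "pmf ?AB (A \<omega>, B \<omega>) \<le> pmf (map_pmf B P) (B \<omega>)"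
      unfolding pmf_map by (intro measure_pmf.finite_measure_mono) auto
    have "info_density P A B \<omega> \<le> log 2 (1 / pmf ?p (A \<omega>))"
      unfolding info_density_def using pos le by (subst log_le_cancel_iff) (auto simp: field_simps)
    also have "\<dots> \<le> 1 / pmf ?p (A \<omega>) / ln 2"
      unfolding log_def using pos ln_bound[of "1 / pmf ?p (A \<omega>)"] by (intro divide_right_mono) auto
    finally show "info_density P A B \<omega> \<le> 1 / pmf ?p (A \<omega>) / ln 2" .
  qed
  also have "\<dots> = measure_pmf.expectation ?p (\<lambda>x. 1 / pmf ?p x / ln 2)" by simp
  also have "\<dots> = (\<Sum>x\<in>UNIV. (1 / pmf ?p x / ln 2) * pmf ?p x)"
    by (intro integral_measure_pmf_real) auto
  also have "\<dots> \<le> (\<Sum>x\<in>(UNIV :: 'x set). 1 / ln 2)"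
    by (intro sum_mono) auto
  also have "\<dots> = CARD('x) / ln 2" by simp
  finally show ?thesis .
qed

lemma rate_bound_le:
  fixes ch :: "'x::finite \<Rightarrow> ('y1::finite \<times> 'y2::finite) pmf"
    and qu :: "'y2 \<Rightarrow> 'u::countable pmf" and qv :: "'y1 \<Rightarrow> 'v::countable pmf"
  assumes fin: "\<And>y2. finite (set_pmf (qu y2))"
  shows "rate_bound (joint ch px qu qv) \<le> CARD('x) / ln 2"
proof -
  have "mi (quantized_joint px ch qu) pX pYU \<le> CARD('x) / ln 2"
    unfolding mi_eq_expectation_info_density
    by (intro expectation_info_density_le finite_set_quantized_joint fin) auto
  then show ?thesis unfolding rate_bound_def mi_joint by simp
qed

lemma info_density_const:
  assumes "\<omega> \<in> set_pmf P"
  shows "info_density P (\<lambda>_. a) B \<omega> = 0"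
proof -
  have "pmf (map_pmf (Pair a) (map_pmf B P)) (a, B \<omega>) = pmf (map_pmf B P) (B \<omega>)"
    by (rule pmf_map_inj') (auto simp: inj_on_def)
  then show ?thesis using pmf_map_pos[OF assms, of B]
    by (simp add: info_density_def pmf.map_comp o_def)
qed

lemma mi_const:
  fixes B :: "'w \<Rightarrow> 'b::countable" and a :: "'a::countable"
  shows "mi P (\<lambda>_. a) B = 0"
  unfolding mi_eq_expectation_info_density
  by (subst expectation_cong_pmf[where g = "\<lambda>_. 0"]) (auto simp: info_density_const)

lemma link_constraints_trivial:
  fixes ch :: "'x::finite \<Rightarrow> ('y1::finite \<times> 'y2::finite) pmf"
  assumes "0 \<le> C12" "0 \<le> C21"
  shows "link_constraints C12 C21 (joint ch px (\<lambda>_. return_pmf (0::nat)) (\<lambda>_. return_pmf (0::nat)))"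
proof -
  have J: "joint ch px (\<lambda>_. return_pmf (0::nat)) (\<lambda>_. return_pmf (0::nat)) =
      map_pmf (\<lambda>(x, y1, y2). (x, y1, y2, 0, 0)) (px \<bind> (\<lambda>x. map_pmf (Pair x) (ch x)))"
    by (simp add: joint_def map_bind_pmf bind_return_pmf case_prod_unfold pmf.map_comp o_def)
      (simp add: map_pmf_def)
  show ?thesis
    using assms unfolding J link_constraints_def
    by (simp add: mi_map_pmf mi_const rvU_def rvV_def case_prod_unfold)
qed

text \<open>Each auxiliary variable is reduced on its own with the input distribution fixed, since
  \<open>qu\<close> and \<open>qv\<close> occur in disjoint terms. The links stay feasible because
  both link functionals are preserved exactly.\<close>

lemma rates_with_alphabets_reduce:
  fixes ch :: "'x::finite \<Rightarrow> ('y1::finite \<times> 'y2::finite) pmf"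
  assumes r: "r \<in> rates_with_alphabets C12 C21 ch \<U> \<V>" and fin: "finite \<U>" "finite \<V>"
  shows "\<exists>\<U>' \<V>'. finite \<U>' \<and> card \<U>' \<le> CARD('y2) + 1 \<and> finite \<V>' \<and> card \<V>' \<le> CARD('y1) + 1 \<and>
    (\<exists>r'\<in>rates_with_alphabets C12 C21 ch \<U>' \<V>'. r \<le> r')"
proof -
  obtain px qu qv where q: "r = rate_bound (joint ch px qu qv)"
    "\<And>y2. set_pmf (qu y2) \<subseteq> \<U>" "\<And>y1. set_pmf (qv y1) \<subseteq> \<V>"
    "link_constraints C12 C21 (joint ch px qu qv)"
    using r by (auto simp: rates_with_alphabets_def)
  let ?sw = "\<lambda>x. map_pmf prod.swap (ch x)"
  have fin_qu: "finite (set_pmf (qu y2))" for y2 using q(2) fin(1) by (rule finite_subset)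
  have fin_qv: "finite (set_pmf (qv y1))" for y1 using q(3) fin(2) by (rule finite_subset)
  obtain qu' :: "'y2 \<Rightarrow> nat pmf" and \<U>' where u: "finite \<U>'" "card \<U>' \<le> CARD('y2) + 1" "\<forall>z.
    set_pmf (qu' z) \<subseteq> \<U>'"
    "mi (quantized_joint px ch qu) pX pYU \<le> mi (quantized_joint px ch qu') pX pYU"
    "mi (quantized_joint px ch qu') pU pZ - mi (quantized_joint px ch qu') pU pY =
     mi (quantized_joint px ch qu) pU pZ - mi (quantized_joint px ch qu) pU pY"
    using exists_small_alphabet[where q = qu and px = px and ch = ch, OF fin_qu]
    unfolding mi_eq_expectation_info_density[symmetric] Let_def by (elim exE conjE)
  obtain qv' :: "'y1 \<Rightarrow> nat pmf" and \<V>' where v: "finite \<V>'" "card \<V>' \<le> CARD('y1) + 1" "\<forall>z.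
    set_pmf (qv' z) \<subseteq> \<V>'"
    "mi (quantized_joint px ?sw qv) pX pYU \<le> mi (quantized_joint px ?sw qv') pX pYU"
    "mi (quantized_joint px ?sw qv') pU pZ - mi (quantized_joint px ?sw qv') pU pY =
     mi (quantized_joint px ?sw qv) pU pZ - mi (quantized_joint px ?sw qv) pU pY"
    using exists_small_alphabet[where q = qv and px = px and ch = ?sw, OF fin_qv]
    unfolding mi_eq_expectation_info_density[symmetric] Let_def by (elim exE conjE)
  have "link_constraints C12 C21 (joint ch px qu' qv')"
    using q(4) u(5) v(5) unfolding link_constraints_def mi_joint by simp
  then have "rate_bound (joint ch px qu' qv') \<in> rates_with_alphabets C12 C21 ch \<U>' \<V>'"
    using u(3) v(3) unfolding rates_with_alphabets_def by blast
  moreover have "r \<le> rate_bound (joint ch px qu' qv')"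
    unfolding q(1) rate_bound_def mi_joint using u(4) v(4) by (rule min.mono)
  ultimately show ?thesis using u(1,2) v(1,2) by blast
qed

lemma rates_with_trivial_alphabets_nonempty:
  fixes ch :: "'x::finite \<Rightarrow> ('y1::finite \<times> 'y2::finite) pmf"
  assumes "0 \<le> C12" "0 \<le> C21"
  shows "\<exists>r. r \<in> rates_with_alphabets C12 C21 ch {0} {0}"
proof -
  let ?J = "joint ch undefined (\<lambda>_. return_pmf (0::nat)) (\<lambda>_. return_pmf (0::nat))"
  have "rate_bound ?J \<in> rates_with_alphabets C12 C21 ch {0} {0}"
    unfolding rates_with_alphabets_def
    by (intro CollectI exI conjI allI) (rule refl, simp, simp, rule link_constraints_trivial[OF assms])
  then show ?thesis ..
qed

lemma conference_rate_eq_bounded: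
  fixes ch :: "'x::finite \<Rightarrow> ('y1::finite \<times> 'y2::finite) pmf"
  assumes C: "0 \<le> C12" "0 \<le> C21"
  shows "conference_rate C12 C21 ch = conference_rate_bounded C12 C21 ch"
proof -
  let ?A = "\<Union>{rates_with_alphabets C12 C21 ch \<U> \<V> | \<U> \<V>. finite \<U> \<and> finite \<V>}"
  let ?B = "\<Union>{rates_with_alphabets C12 C21 ch \<U> \<V> | \<U> \<V>.
      finite \<U> \<and> card \<U> \<le> CARD('y2) + 1 \<and> finite \<V> \<and> card \<V> \<le> CARD('y1) + 1}"
  have sub: "?B \<subseteq> ?A" by blast
  obtain r0 where r0: "r0 \<in> rates_with_alphabets C12 C21 ch {0} {0}"
    using rates_with_trivial_alphabets_nonempty[OF C, of ch] by blast
  have ne: "?B \<noteq> {}"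
  proof -
    have "rates_with_alphabets C12 C21 ch {0} {0} \<in> {rates_with_alphabets C12 C21 ch \<U> \<V> | \<U> \<V>.
      finite \<U> \<and> card \<U> \<le> CARD('y2) + 1 \<and> finite \<V> \<and> card \<V> \<le> CARD('y1) + 1}"
      by (intro CollectI exI[of _ "{0}"] conjI refl) auto
    then show ?thesis using r0 by blast
  qed
  have bdd: "bdd_above ?A"
  proof (rule bdd_aboveI)
    fix r assume "r \<in> ?A"
    then obtain \<U> px and qu :: "'y2 \<Rightarrow> nat pmf" and qv :: "'y1 \<Rightarrow> nat pmf" where "finite \<U>" "r =
      rate_bound (joint ch px qu qv)" "\<forall>y2. set_pmf (qu y2) \<subseteq> \<U>"
      by (auto simp: rates_with_alphabets_def)
    then show "r \<le> CARD('x) / ln 2" using rate_bound_le[of qu ch px qv] by (meson finite_subset)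
  qed
  have "Sup ?A \<le> Sup ?B"
  proof (rule cSup_least)
    show "?A \<noteq> {}" using ne sub by blast
    fix r assume "r \<in> ?A"
    then obtain \<U> \<V> where "r \<in> rates_with_alphabets C12 C21 ch \<U> \<V>" "finite \<U>" "finite \<V>" by blast
    then obtain r' where "r' \<in> ?B" "r \<le> r'"
      using rates_with_alphabets_reduce[of r C12 C21 ch \<U> \<V>] by blast
    then show "r \<le> Sup ?B" using bdd_above_mono[OF bdd sub] by (intro cSup_upper2)
  qed
  moreover have "Sup ?B \<le> Sup ?A" using ne bdd sub by (rule cSup_subset_mono)
  ultimately show ?thesis unfolding conference_rate_def conference_rate_bounded_def by (rule antisym)
qed

lemma achievable_if_less_conference_rate:
  fixes ch :: "'x::finite \<Rightarrow> ('y1::finite \<times> 'y2::finite) pmf"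
  assumes C: "0 \<le> C12" "0 \<le> C21" and R: "0 \<le> R" "R < conference_rate C12 C21 ch"
  shows "achievable C12 C21 ch R"
proof -
  let ?A = "\<Union>{rates_with_alphabets C12 C21 ch \<U> \<V> | \<U> \<V>. finite \<U> \<and> finite \<V>}"
  obtain r0 where "r0 \<in> rates_with_alphabets C12 C21 ch {0} {0}"
    using rates_with_trivial_alphabets_nonempty[OF C, of ch] ..
  moreover have "rates_with_alphabets C12 C21 ch {0} {0} \<in>
      {rates_with_alphabets C12 C21 ch \<U> \<V> | \<U> \<V>. finite \<U> \<and> finite \<V>}"
    by (intro CollectI exI[of _ "{0}"] conjI refl) auto
  ultimately have "?A \<noteq> {}" by blast
  then have "\<exists>r\<in>?A. R < r" using R(2)[unfolded conference_rate_def] by (rule less_cSupD)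
  then obtain r where "r \<in> ?A" "R < r" by blast
  then obtain \<U> \<V> :: "nat set" and px qu qv where *: "finite \<U>" "finite \<V>" "R < rate_bound (joint ch px
    qu qv)"
    "\<forall>y2. set_pmf (qu y2) \<subseteq> \<U>" "\<forall>y1. set_pmf (qv y1) \<subseteq> \<V>" "link_constraints C12 C21 (joint ch px qu qv)"
    by (auto simp: rates_with_alphabets_def)
  have "finite (set_pmf (qu y2))" "finite (set_pmf (qv y1))" for y1 y2
    by (rule finite_subset[OF spec[OF *(4)] *(1)], rule finite_subset[OF spec[OF *(5)] *(2)])
  then show ?thesis using C R(1) *(6,3) by (rule achievable_if_less_rate_bound)
qed

theorem theorem3:
  fixes ch :: "'x::finite \<Rightarrow> ('y1::finite \<times> 'y2::finite) pmf"
    and C12 C21 R :: real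
  assumes "0 \<le> C12" and "0 \<le> C21" and "0 \<le> R"
    and "R \<le> conference_rate C12 C21 ch"
  shows "limit_achievable C12 C21 ch R \<and>
         (R < conference_rate C12 C21 ch \<longrightarrow> achievable C12 C21 ch R) \<and>
         conference_rate C12 C21 ch = conference_rate_bounded C12 C21 ch"
proof (intro conjI impI)
  show "limit_achievable C12 C21 ch R"
  proof (cases "R = 0")
    case True
    then show ?thesis using limit_achievable_zero assms by simp
  next
    case False
    then show ?thesis
      using assms by (intro limit_achievable_if_achievable_below achievable_if_less_conference_rate) auto
  qed
qed (use assms in \<open>auto intro: achievable_if_less_conference_rate conference_rate_eq_bounded\<close>)

end
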